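(* Let $n\ge 2$ and $q\in\left(2,\frac{2n}{n-1}\right)$. There exists $\lambda>0$ such that the equation $$-\Delta_{g_{FS}}u+\lambda u=\lambda u^{q-1}$$ has a nonconstant positive solution $u$ on $(\mathbb{C}\mathbf{P}^n,g_{FS})$, invariant under the action of $U(n)$, which is degenerate, i.e. the linearized equation $-\Delta_{g_{FS}}v+\lambda v=\lambda(q-1)u^{q-2}v$ has a nontrivial solution $v$.
   Context: $g_{FS}$ is the Fubini–Study metric on $\mathbb{C}\mathbf{P}^n$, normalized so that the eigenvalues of $-\Delta_{g_{FS}}$ are $4k(k+n)$, $k\ge 0$. $\Delta_{g_{FS}}$ is the Laplace–Beltrami operator. $U(n)$ acts on $\mathbb{C}\mathbf{P}^n$ by $A\cdot[z_0:z_1:\dots:z_n]=[z_0:A(z_1,\dots,z_n)]$ (cohomogeneity one action fixing $[1:0:\dots:0]$); invariant means constant on orbits. A solution $(u_0,\lambda_0)$ of $-\Delta u+\lambda u=\lambda u^{q-1}$ is called degenerate if $-\Delta v+\lambda_0 v=\lambda_0(q-1)u_0^{q-2}v$ has a nontrivial solution. *)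

theory Defs
  imports "HOL-Analysis.Analysis"
begin

text \<open>Model of CP^n: points of C^{n+1} = complex x complex^'n (z_0 first).
 Functions on CP^n are functions on C^{n+1} - {0} invariant under complex scaling.\<close>

definition cscale :: "complex \<Rightarrow> complex \<times> (complex^'n) \<Rightarrow> complex \<times> (complex^'n)" where
  "cscale c z = (c * fst z, c *s snd z)"

definition cp_function :: "(complex \<times> (complex^'n) \<Rightarrow> real) \<Rightarrow> bool" where
  "cp_function u \<longleftrightarrow> (\<forall>z c. z \<noteq> 0 \<and> c \<noteq> 0 \<longrightarrow> u (cscale c z) = u z)"

definition unitary_mat :: "complex^'n^'n \<Rightarrow> bool" where
  "unitary_mat A \<longleftrightarrow> A ** (\<chi> i j. cnj (A $ j $ i)) = mat 1"

definition Un_invariant :: "(complex \<times> (complex^'n) \<Rightarrow> real) \<Rightarrow> bool" where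
  "Un_invariant u \<longleftrightarrow> (\<forall>A z0 w. unitary_mat A \<and> (z0, w) \<noteq> 0 \<longrightarrow> u (z0, A *v w) = u (z0, w))"

definition C2_on :: "'a::euclidean_space set \<Rightarrow> ('a \<Rightarrow> real) \<Rightarrow> bool" where
  "C2_on S f \<longleftrightarrow> (\<exists>Df :: 'a \<Rightarrow> 'a \<Rightarrow>\<^sub>L real.
      (\<forall>x\<in>S. (f has_derivative blinfun_apply (Df x)) (at x)) \<and>
      (\<exists>D2f :: 'a \<Rightarrow> 'a \<Rightarrow>\<^sub>L ('a \<Rightarrow>\<^sub>L real).
         (\<forall>x\<in>S. (Df has_derivative blinfun_apply (D2f x)) (at x)) \<and> continuous_on S D2f))"

definition eucl_laplacian :: "('a::euclidean_space \<Rightarrow> real) \<Rightarrow> 'a \<Rightarrow> real" where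
  "eucl_laplacian f x = (\<Sum>b\<in>Basis. deriv (\<lambda>t. deriv (\<lambda>s. f (x + s *\<^sub>R b)) t) 0)"

text \<open>For a function on CP^n (scale invariant, hence 0-homogeneous on R^{2n+2}-{0}), the
 Laplace-Beltrami operator of the Fubini-Study metric (normalized with eigenvalues 4k(k+n))
 at [z] equals the Euclidean Laplacian of the lift at a unit representative z
 (Hopf fibration S^{2n+1} -> CP^n is a Riemannian submersion with totally geodesic fibres).\<close>
definition lap_FS :: "(complex \<times> (complex^'n) \<Rightarrow> real) \<Rightarrow> complex \<times> (complex^'n) \<Rightarrow> real" where
  "lap_FS u z = eucl_laplacian u z"

end

theory Submission
  imports Defs
begin

text \<open>Invariant functions are profiles \<open>U(y)\<close> with \<open>y = |w|^2 / |z|^2\<close> in \<open>[0,1]\<close>, and the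
  equation becomes \<open>((1 - y) y^n U')' + \<kappa> y^(n-1) (U^p - U) = 0\<close> with \<open>p = q - 1\<close> and
  \<open>\<lambda> = 4 \<kappa>\<close>. Shoot from the fixed point \<open>y = 0\<close> with \<open>U(0) = b\<close>; the flux
  \<open>R = - (1 - y) U'\<close> solves a regular Volterra equation on \<open>[0,1)\<close>, and \<open>U\<close> is smooth at \<open>y = 1\<close>
  iff the defect \<open>c(\<kappa>, b) = R(1-)\<close> vanishes. Let \<open>\<kappa>1\<close> be the value where the linearisation at
  the constant \<open>1\<close> becomes singular. For \<open>\<kappa> < \<kappa>1\<close> the defect is positive for \<open>b\<close> slightly above
  \<open>1\<close>, whereas at \<open>\<kappa>1\<close> it is negative there, because the first eigenfunction has positive third
  moment; so there are zeros with \<open>b > 1\<close> and \<open>\<kappa> < \<kappa>1\<close>. A Pohozaev identity (subcriticality)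
  bounds all zeros, and small \<open>\<kappa>\<close> admit none. At the smallest \<open>\<kappa>\<close> with a zero \<open>b > 1\<close> the
  function \<open>c(\<kappa>, \<cdot>)\<close> is nonnegative, hence has a minimum at \<open>b\<close>: its derivative, the defect of the
  linearised profile, vanishes, and that profile is the required kernel element.

  To keep the nonlinearity globally Lipschitz, \<open>u^p\<close> is replaced by \<open>0\<close> for \<open>u < 0\<close> and by its tangent
  for \<open>u > M\<close>, with \<open>M\<close> above the a priori bound.\<close>

section \<open>A singular Volterra equation\<close>

text \<open>The profile equation degenerates at both ends. At \<open>y = 0\<close> the rescaled
  average \<open>avg\<close> absorbs the singularity. At \<open>y = 1\<close> a shot with nonzero
  defect diverges like the logarithm \<open>ell\<close>, so every estimate must tolerate logarithmic
  growth. This is possible because averaging undoes the pole introduced by \<open>prim\<close>, and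
  \<open>ell\<close> and its square have bounded averages; all constants are therefore uniform up to
  \<open>y = 1\<close>, and the defect is differentiable in \<open>b\<close>, uniformly in
  \<open>\<kappa>\<close> and \<open>b\<close>.

  The zeros of the defect are never shown to form a curve, and no bifurcation theorem enters: the
  degenerate solution comes from minimising \<open>\<kappa>\<close> over a compact set of zeros.
  Compactness requires the zeros to stay away from the trivial family \<open>b = 1\<close>, which is
  why the sign of the linearised defect at \<open>1\<close> is quantified uniformly in
  \<open>\<kappa>\<close>.

  For \<open>n = 1\<close> the first eigenfunction is odd about the midpoint of \<open>[0,1]\<close>
  and its third moment vanishes; for \<open>n \<ge> 2\<close> the fixed point and the opposite orbit
  are no longer symmetric, and the moment is positive.\<close>

definition avg :: "nat \<Rightarrow> (real \<Rightarrow> real) \<Rightarrow> real \<Rightarrow> real" where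
  "avg m G y = integral {0..1} (\<lambda>\<sigma>. \<sigma> ^ m * G (y * \<sigma>))"

text \<open>A profile with flux \<open>R = - (1 - y) U'\<close> and value \<open>b\<close> at
  \<open>0\<close> is \<open>b - prim R\<close>.\<close>

definition prim :: "(real \<Rightarrow> real) \<Rightarrow> real \<Rightarrow> real" where
  "prim R s = integral {0..s} (\<lambda>t. R t / (1 - t))"

text \<open>The growth at \<open>1\<close> of a profile whose flux is merely bounded:
  \<open>ell\<close> is \<open>prim\<close> of the constant \<open>1\<close>.\<close>

definition ell :: "real \<Rightarrow> real" where
  "ell y = - ln (1 - y)"

lemma continuous_on_subinterval:
  fixes G :: "real \<Rightarrow> real"
  assumes "continuous_on {0..<1} G" "y < 1"
  shows "continuous_on {0..y} G"
  using assms by (auto intro: continuous_on_subset)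

lemma mult_unit_interval:
  fixes y \<sigma> :: real
  assumes "0 \<le> y" "y < c" "0 \<le> \<sigma>" "\<sigma> \<le> 1"
  shows "y * \<sigma> \<in> {0..<c}" "y * \<sigma> \<le> y" "0 \<le> y * \<sigma>"
proof -
  have "y * \<sigma> \<le> y * 1" using assms by (intro mult_left_mono) auto
  then show "y * \<sigma> \<in> {0..<c}" "y * \<sigma> \<le> y" "0 \<le> y * \<sigma>" using assms by auto
qed

lemma continuous_on_avg_param:
  assumes "continuous_on S G" and "\<And>y \<sigma>. y \<in> S \<Longrightarrow> 0 \<le> \<sigma> \<Longrightarrow> \<sigma> \<le> 1 \<Longrightarrow> y * \<sigma> \<in> S"
  shows "continuous_on S (avg m G)"
proof -
  have "continuous_on (S \<times> cbox 0 1) (\<lambda>(y, \<sigma>). \<sigma> ^ m * G (y * \<sigma>))"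
    unfolding split_beta
    by (intro continuous_intros continuous_on_compose2[OF assms(1)]) (auto intro: assms(2))
  from integral_continuous_on_param[OF this] show ?thesis
    by (simp add: avg_def[abs_def])
qed

lemma continuous_on_avg: "continuous_on {0..<1} G \<Longrightarrow> continuous_on {0..<1} (avg m G)"
  by (rule continuous_on_avg_param) (auto dest: mult_unit_interval)

lemma avg_integrable:
  fixes G :: "real \<Rightarrow> real"
  assumes "continuous_on {0..y} G" "0 \<le> y"
  shows "(\<lambda>\<sigma>. \<sigma> ^ m * G (y * \<sigma>)) integrable_on {0..1}"
  by (intro integrable_continuous_interval continuous_intros continuous_on_compose2[OF assms(1)])
     (use assms(2) in \<open>auto intro: mult_left_le\<close>)

lemma avg_at_0: "avg m G 0 = G 0 / real (Suc m)"
proof -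
  have "((\<lambda>\<sigma>::real. \<sigma> ^ m) has_integral (1 ^ Suc m / real (Suc m) - 0 ^ Suc m / real (Suc m))) {0..1}"
  proof (intro fundamental_theorem_of_calculus)
    fix x :: real
    have "((\<lambda>x. x ^ Suc m / real (Suc m)) has_real_derivative real (Suc m) * x ^ m / real (Suc m)) (at x within {0..1})"
      by (auto intro!: derivative_eq_intros simp del: power_Suc of_nat_Suc)
    then show "((\<lambda>x. x ^ Suc m / real (Suc m)) has_vector_derivative x ^ m) (at x within {0..1})"
      by (simp add: has_real_derivative_iff_has_vector_derivative del: of_nat_Suc power_Suc)
  qed simp
  from has_integral_mult_left[OF this, of "G 0"]
  have "((\<lambda>\<sigma>. \<sigma> ^ m * G 0) has_integral G 0 / real (Suc m)) {0..1}" by simp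
  then show ?thesis unfolding avg_def by (simp only: mult_zero_left integral_unique)
qed

text \<open>This is where \<open>avg\<close> comes from: the flux equation determines
  \<open>y ^ Suc m * R y\<close> as an integral, and rescaling that integral to \<open>[0,1]\<close>
  gives a formula for \<open>R\<close> that is meaningful and continuous at
  \<open>y = 0\<close>.\<close>

lemma power_times_avg:
  assumes G: "continuous_on {0..y} G" and y: "0 \<le> y"
  shows "y ^ Suc m * avg m G y = integral {0..y} (\<lambda>s. s ^ m * G s)"
proof (cases "y = 0")
  case False
  then have y0: "y > 0" using y by simp
  have int: "(\<lambda>s. s ^ m * G s) integrable_on {0..y}"
    by (intro integrable_continuous_interval continuous_intros G)
  have im: "(\<lambda>x. x / y) ` {0..y} = {0..1}"
    using y0 by (simp add: image_divide_atLeastAtMost)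
  have "((\<lambda>\<sigma>. (y * \<sigma>) ^ m * G (y * \<sigma>)) has_integral (1 / \<bar>y\<bar>) *\<^sub>R integral {0..y} (\<lambda>s. s ^ m * G s)) {0..1}"
    using has_integral_stretch_real[OF integrable_integral[OF int], of y] y0 unfolding im by simp
  then have "integral {0..1} (\<lambda>\<sigma>. y ^ m * (\<sigma> ^ m * G (y * \<sigma>))) = integral {0..y} (\<lambda>s. s ^ m * G s) / y"
    unfolding power_mult_distrib mult.assoc using y0 by (simp add: integral_unique del: integral_mult_right)
  then have "y ^ m * avg m G y = integral {0..y} (\<lambda>s. s ^ m * G s) / y"
    by (simp add: avg_def)
  then show ?thesis using y0 by (simp add: eq_divide_eq mult_ac)
qed simp

lemma abs_avg_le:
  assumes "continuous_on {0..y} G" "continuous_on {0..y} H" "0 \<le> y"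
    and "\<And>s. 0 \<le> s \<Longrightarrow> s \<le> y \<Longrightarrow> \<bar>G s\<bar> \<le> H s"
  shows "\<bar>avg m G y\<bar> \<le> avg m H y"
  unfolding avg_def real_norm_def[symmetric]
  by (intro integral_norm_bound_integral avg_integrable assms)
     (use assms(3) mult_left_le[of _ y] in \<open>auto simp: abs_mult intro!: mult_left_mono assms(4)\<close>)

lemma avg_const: "avg m (\<lambda>_. c) y = c / real (Suc m)"
  using avg_at_0[of m "\<lambda>_. c"] by (simp add: avg_def)

lemma avg_add:
  assumes "continuous_on {0..y} G" "continuous_on {0..y} H" "0 \<le> y"
  shows "avg m (\<lambda>s. G s + H s) y = avg m G y + avg m H y"
  unfolding avg_def by (simp add: distrib_left integral_add avg_integrable assms)

lemma avg_diff:
  assumes "continuous_on {0..y} G" "continuous_on {0..y} H" "0 \<le> y"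
  shows "avg m (\<lambda>s. G s - H s) y = avg m G y - avg m H y"
  unfolding avg_def by (simp add: right_diff_distrib integral_diff avg_integrable assms)

lemma avg_cmult: "avg m (\<lambda>s. c * G s) y = c * avg m G y"
  unfolding avg_def by (simp add: mult.left_commute[of _ c])

lemma avg_cong:
  assumes "0 \<le> y" "\<And>s. 0 \<le> s \<Longrightarrow> s \<le> y \<Longrightarrow> G s = H s"
  shows "avg m G y = avg m H y"
proof -
  have "G (y * \<sigma>) = H (y * \<sigma>)" if "\<sigma> \<in> {0..1}" for \<sigma>
    using that assms(1) mult_left_le[of \<sigma> y] by (intro assms(2)) auto
  then show ?thesis unfolding avg_def by (intro integral_cong) simp
qed

lemma continuous_on_quot:
  fixes R :: "real \<Rightarrow> real"
  assumes "continuous_on {0..<1} R"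
  shows "continuous_on {0..<1} (\<lambda>t::real. R t / (1 - t))"
  by (intro continuous_intros assms) auto

lemma prim_integrable:
  fixes R :: "real \<Rightarrow> real"
  assumes "continuous_on {0..<1} R" "y < 1"
  shows "(\<lambda>t. R t / (1 - t)) integrable_on {0..y}"
  by (intro integrable_continuous_interval continuous_on_subinterval[OF continuous_on_quot] assms)

lemma prim_0 [simp]: "prim R 0 = 0"
  by (simp add: prim_def)

lemma integral_upper_deriv_within:
  assumes "continuous_on {0..<1} R" "0 \<le> y" "y < 1"
  shows "((\<lambda>y. integral {0..y} R) has_real_derivative R y) (at y within {0..<1})"
proof -
  define z where "z = (1 + y) / 2"
  have z: "y < z" "z < 1" using assms by (auto simp: z_def)
  have "((\<lambda>y. integral {0..y} R) has_real_derivative R y) (at y within {0..z})"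
    by (rule integral_has_real_derivative)
       (use z assms in \<open>auto intro: continuous_on_subinterval\<close>)
  moreover have "at y within {0..z} = at y within {0..<1}"
    by (rule at_within_nhd[of _ "{..<z}"]) (use z assms in auto)
  ultimately show ?thesis by simp
qed

lemma prim_deriv_within:
  assumes "continuous_on {0..<1} R" "0 \<le> y" "y < 1"
  shows "(prim R has_real_derivative R y / (1 - y)) (at y within {0..<1})"
  unfolding prim_def[abs_def]
  using integral_upper_deriv_within[OF continuous_on_quot[OF assms(1)] assms(2,3)] .

lemma at_within_interior_unit: "0 < y \<Longrightarrow> y < 1 \<Longrightarrow> at y within {0..<1} = at (y::real)"
  by (rule at_within_interior) (simp add: interior_atLeastLessThan)

lemma continuous_on_prim:
  assumes "continuous_on {0..<1} R"
  shows "continuous_on {0..<1} (prim R)"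
  unfolding continuous_on_eq_continuous_within
  using DERIV_continuous[OF prim_deriv_within[OF assms]] by auto

lemma prim_mono:
  assumes "continuous_on {0..<1} A" "continuous_on {0..<1} B" "y < 1"
    and "\<And>s. 0 \<le> s \<Longrightarrow> s \<le> y \<Longrightarrow> \<bar>A s\<bar> \<le> B s"
  shows "\<bar>prim A y\<bar> \<le> prim B y"
  unfolding prim_def real_norm_def[symmetric]
  by (intro integral_norm_bound_integral prim_integrable assms)
     (use assms in \<open>auto simp: abs_div intro!: divide_right_mono\<close>)

lemma prim_diff:
  assumes "continuous_on {0..<1} A" "continuous_on {0..<1} B" "y < 1"
  shows "prim (\<lambda>t. A t - B t) y = prim A y - prim B y"
  unfolding prim_def by (simp add: diff_divide_distrib integral_diff prim_integrable assms)

lemma prim_cmult: "prim (\<lambda>t. c * A t) y = c * prim A y"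
proof -
  have "(\<lambda>t. c * A t / (1 - t)) = (\<lambda>t. c * (A t / (1 - t)))" by auto
  then show ?thesis unfolding prim_def by (simp only: integral_mult_right)
qed

text \<open>The factor \<open>1 / (1 - t)\<close> is compensated by the averaging, so that the composite operator
  is an ordinary Volterra operator up to the singular end point.\<close>

lemma avg_prim_le:
  assumes A: "continuous_on {0..<1} A" and pos: "\<And>t. 0 \<le> t \<Longrightarrow> t < 1 \<Longrightarrow> 0 \<le> A t"
    and y: "0 \<le> y" "y < 1"
  shows "avg m (prim A) y \<le> integral {0..y} A"
proof (cases "y = 0")
  case True
  then show ?thesis by (simp add: avg_at_0)
next
  case False
  then have y0: "y > 0" using y by simp
  have W: "continuous_on {0..<1} (prim A)" by (rule continuous_on_prim[OF A])
  have W0: "0 \<le> prim A s" if "0 \<le> s" "s \<le> y" for s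
    unfolding prim_def using that y
    by (intro integral_nonneg prim_integrable A divide_nonneg_nonneg pos) auto
  \<comment> \<open>As \<open>\<sigma> ^ m \<le> 1\<close>, the exponent \<open>0\<close> is the
    worst case, and there \<open>y * avg 0\<close> is a plain integral.\<close>
  have "avg m (prim A) y \<le> avg 0 (prim A) y"
    unfolding avg_def
  proof (intro integral_le avg_integrable)
    fix \<sigma> :: real assume "\<sigma> \<in> {0..1}"
    then show "\<sigma> ^ m * prim A (y * \<sigma>) \<le> \<sigma> ^ 0 * prim A (y * \<sigma>)"
      using y0 by (intro mult_right_mono W0) (auto intro: mult_left_le power_le_one)
  qed (use y W in \<open>auto intro: continuous_on_subinterval\<close>)
  moreover have "y * avg 0 (prim A) y = integral {0..y} (prim A)"
    using power_times_avg[of y "prim A" 0] W y by (auto intro: continuous_on_subinterval)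
  moreover have "integral {0..y} (prim A) \<le> integral {0..y} (\<lambda>t. y * A t)"
  proof -
    \<comment> \<open>Integration by parts: \<open>(y - s) * prim A s\<close> vanishes at both ends,
      so the integral of \<open>prim A\<close> equals that of
      \<open>(y - s) / (1 - s) * A s\<close>.\<close>
    have "((\<lambda>s. (y - s) * (A s / (1 - s)) - prim A s) has_integral ((y - y) * prim A y - (y - 0) * prim A 0)) {0..y}"
    proof (rule fundamental_theorem_of_calculus)
      fix s assume s: "s \<in> {0..y}"
      have "((\<lambda>s. (y - s) * prim A s) has_real_derivative (y - s) * (A s / (1 - s)) - prim A s) (at s within {0..<1})"
        using DERIV_mult'[OF DERIV_diff[OF DERIV_const DERIV_ident] prim_deriv_within[OF A, of s], of y] s y
        by (simp add: algebra_simps)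
      then have "((\<lambda>s. (y - s) * prim A s) has_real_derivative (y - s) * (A s / (1 - s)) - prim A s) (at s within {0..y})"
        by (rule has_field_derivative_subset) (use y in auto)
      then show "((\<lambda>s. (y - s) * prim A s) has_vector_derivative (y - s) * (A s / (1 - s)) - prim A s) (at s within {0..y})"
        by (simp add: has_real_derivative_iff_has_vector_derivative)
    qed (use y in auto)
    then have i0: "((\<lambda>s. (y - s) * (A s / (1 - s)) - prim A s) has_integral 0) {0..y}" by simp
    have i1: "prim A integrable_on {0..y}" "A integrable_on {0..y}"
      using W A y by (auto intro!: integrable_continuous_interval intro: continuous_on_subinterval)
    have "((\<lambda>s. (y - s) * (A s / (1 - s))) has_integral integral {0..y} (prim A)) {0..y}"
      using has_integral_add[OF i0 integrable_integral[OF i1(1)]] by simp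
    moreover have "((\<lambda>s. y * A s) has_integral integral {0..y} (\<lambda>s. y * A s)) {0..y}"
      using integrable_integral[OF integrable_on_cmult_left[OF i1(2), of y], simplified of_real_eq_id id_apply] .
    ultimately show ?thesis
    proof (rule has_integral_le)
      fix s assume s: "s \<in> {0..y}"
      \<comment> \<open>The zero of \<open>y - s\<close> compensates the pole: the kernel
        \<open>(y - s) / (1 - s)\<close> never exceeds \<open>y\<close>, however close
        \<open>y\<close> is to \<open>1\<close>.\<close>
      have "s * y \<le> s" using s y by (intro mult_left_le) auto
      then have "(y - s) / (1 - s) \<le> y" using s y by (simp add: field_simps)
      then have "(y - s) / (1 - s) * A s \<le> y * A s"
        using s y by (intro mult_right_mono pos) auto
      then show "(y - s) * (A s / (1 - s)) \<le> y * A s" by simp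
    qed
  qed
  ultimately have "y * avg m (prim A) y \<le> y * integral {0..y} A"
    using mult_left_mono[of "avg m (prim A) y" "avg 0 (prim A) y" y] y0
    unfolding integral_mult_right by linarith
  then show ?thesis using y0 by simp
qed

section \<open>Stability and solvability of the Volterra equation\<close>

lemma gronwall:
  fixes D :: "real \<Rightarrow> real"
  assumes D: "continuous_on {0..<1} D" and "0 \<le> C" and y: "0 \<le> y" "y < 1"
    and le: "\<And>s. 0 \<le> s \<Longrightarrow> s \<le> y \<Longrightarrow> D s \<le> \<alpha> + C * integral {0..s} D"
  shows "D y \<le> \<alpha> * exp (C * y)"
proof -
  let ?I = "\<lambda>s. integral {0..s} D"
  let ?\<phi> = "\<lambda>s. (\<alpha> + C * ?I s) * exp (- C * s)"
  have "?\<phi> y \<le> ?\<phi> 0"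
  proof (rule DERIV_nonpos_imp_decreasing_open[OF y(1)])
    fix s assume s: "0 < s" "s < y"
    have "(?I has_real_derivative D s) (at s)"
      using integral_upper_deriv_within[OF D, of s] s y by (simp add: at_within_interior_unit)
    then have "(?\<phi> has_real_derivative C * (D s - (\<alpha> + C * ?I s)) * exp (- C * s)) (at s)"
      by (auto intro!: derivative_eq_intros simp: algebra_simps)
    moreover have "C * (D s - (\<alpha> + C * ?I s)) * exp (- C * s) \<le> 0"
      using le[of s] s \<open>0 \<le> C\<close> by (intro mult_nonpos_nonneg mult_nonneg_nonpos) auto
    ultimately show "\<exists>d. (?\<phi> has_real_derivative d) (at s) \<and> d \<le> 0" by blast
  next
    have "continuous_on {0..<1} ?I"
      unfolding continuous_on_eq_continuous_within
      using DERIV_continuous[OF integral_upper_deriv_within[OF D]] by auto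
    then show "continuous_on {0..y} ?\<phi>"
      by (intro continuous_intros) (use y in \<open>auto intro: continuous_on_subinterval\<close>)
  qed
  then have "\<alpha> + C * ?I y \<le> \<alpha> * exp (C * y)"
    by (simp add: exp_minus field_simps)
  with le[of y] y show ?thesis by simp
qed

text \<open>All bounds on fluxes and on their dependence on \<open>b\<close> and
  \<open>\<kappa>\<close> are instances of this estimate with different forcings
  \<open>\<rho>\<close>. Only the average of \<open>\<rho>\<close> has to be bounded, so the forcing
  may blow up logarithmically at \<open>1\<close>.\<close>

lemma volterra_stability:
  assumes D: "continuous_on {0..<1} D" and \<rho>: "continuous_on {0..<1} \<rho>" and L: "0 \<le> L"
    and y: "0 \<le> y" "y < 1"
    and G: "continuous_on {0..<1} G" "\<And>s. 0 \<le> s \<Longrightarrow> s < 1 \<Longrightarrow> D s = avg m G s"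
    and le: "\<And>s. 0 \<le> s \<Longrightarrow> s < 1 \<Longrightarrow> \<bar>G s\<bar> \<le> \<rho> s + L * \<bar>prim D s\<bar>"
    and avg: "\<And>s. 0 \<le> s \<Longrightarrow> s < 1 \<Longrightarrow> avg m \<rho> s \<le> \<alpha>"
  shows "\<bar>D y\<bar> \<le> \<alpha> * exp L"
proof -
  have cD: "continuous_on {0..<1} (\<lambda>s. \<bar>D s\<bar>)" by (intro continuous_intros D)
  have step: "\<bar>D s\<bar> \<le> \<alpha> + L * integral {0..s} (\<lambda>s. \<bar>D s\<bar>)" if s: "0 \<le> s" "s \<le> y" for s
  proof -
    have s1: "s < 1" using s y by simp
    note ci = continuous_on_subinterval[OF _ s1]
    have c: "continuous_on {0..<1} (\<lambda>s. L * prim (\<lambda>s. \<bar>D s\<bar>) s)"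
      by (intro continuous_intros continuous_on_prim D)
    have "\<bar>D s\<bar> = \<bar>avg m G s\<bar>" using G(2) s s1 by simp
    also have "\<dots> \<le> avg m (\<lambda>s. \<rho> s + L * prim (\<lambda>s. \<bar>D s\<bar>) s) s"
    proof (rule abs_avg_le)
      fix t assume t: "0 \<le> t" "t \<le> s"
      then have "\<bar>prim D t\<bar> \<le> prim (\<lambda>s. \<bar>D s\<bar>) t"
        using s1 by (intro prim_mono D cD) auto
      then have "L * \<bar>prim D t\<bar> \<le> L * prim (\<lambda>s. \<bar>D s\<bar>) t" using L by (rule mult_left_mono)
      then show "\<bar>G t\<bar> \<le> \<rho> t + L * prim (\<lambda>s. \<bar>D s\<bar>) t" using le[of t] t s1 by linarith
    qed (use s s1 in \<open>auto intro!: ci G continuous_intros \<rho> c\<close>)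
    also have "\<dots> = avg m \<rho> s + L * avg m (prim (\<lambda>s. \<bar>D s\<bar>)) s"
      using s by (subst avg_add) (auto intro!: ci \<rho> c simp: avg_cmult)
    also have "\<dots> \<le> \<alpha> + L * integral {0..s} (\<lambda>s. \<bar>D s\<bar>)"
      using s s1 by (intro add_mono avg mult_left_mono avg_prim_le cD L) auto
    finally show ?thesis .
  qed
  have a: "0 \<le> \<alpha>" using step[of 0] y by simp
  have "\<bar>D y\<bar> \<le> \<alpha> * exp (L * y)"
    by (rule gronwall[OF cD L y]) (use step in auto)
  also have "\<dots> \<le> \<alpha> * exp L"
    using a L y by (intro mult_left_mono) (auto intro: mult_left_le)
  finally show ?thesis .
qed

text \<open>Picard iteration. By \<open>avg_prim_le\<close> the increments are at most
  \<open>G0 * (L * y) ^ k / fact k\<close>, so the iterates converge uniformly on the whole of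
  \<open>{0..<1}\<close>, for any size of \<open>L\<close>. The bound \<open>G0\<close> controls the
  first iterate.\<close>

lemma volterra_exists:
  fixes g :: "real \<Rightarrow> real \<Rightarrow> real"
  assumes cont: "\<And>u. continuous_on {0..<1} u \<Longrightarrow> continuous_on {0..<1} (\<lambda>s. g s (u s))"
    and lip: "\<And>s a b. 0 \<le> s \<Longrightarrow> s < 1 \<Longrightarrow> \<bar>g s a - g s b\<bar> \<le> L * \<bar>a - b\<bar>"
    and L: "0 \<le> L"
    and bd: "\<And>s. 0 \<le> s \<Longrightarrow> s < 1 \<Longrightarrow> \<bar>g s b\<bar> \<le> G0"
  shows "\<exists>R. continuous_on {0..<1} R \<and> (\<forall>y\<in>{0..<1}. R y = avg m (\<lambda>s. g s (b - prim R s)) y)"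
proof -
  define T where "T R y = avg m (\<lambda>s. g s (b - prim R s)) y" for R y
  have cg: "continuous_on {0..<1} (\<lambda>s. g s (b - prim R s))" if "continuous_on {0..<1} R" for R
    by (intro cont continuous_intros continuous_on_prim that)
  have cT: "continuous_on {0..<1} (T R)" if "continuous_on {0..<1} R" for R
    unfolding T_def[abs_def] by (intro continuous_on_avg cg that)
  have Tdiff: "\<bar>T R y - T Q y\<bar> \<le> L * integral {0..y} A"
    if R: "continuous_on {0..<1} R" and Q: "continuous_on {0..<1} Q" and A: "continuous_on {0..<1} A"
      and le: "\<And>t. 0 \<le> t \<Longrightarrow> t < 1 \<Longrightarrow> \<bar>R t - Q t\<bar> \<le> A t" and y: "0 \<le> y" "y < 1" for R Q A y
  proof -
    note ci = continuous_on_subinterval[OF _ y(2)]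
    have "\<bar>T R y - T Q y\<bar> = \<bar>avg m (\<lambda>s. g s (b - prim R s) - g s (b - prim Q s)) y\<bar>"
      unfolding T_def by (subst avg_diff) (auto intro!: ci cg R Q y)
    also have "\<dots> \<le> avg m (\<lambda>s. L * prim A s) y"
    proof (rule abs_avg_le)
      fix s assume s: "0 \<le> s" "s \<le> y"
      have "\<bar>g s (b - prim R s) - g s (b - prim Q s)\<bar> \<le> L * \<bar>(b - prim R s) - (b - prim Q s)\<bar>"
        using s y by (intro lip) auto
      also have "\<bar>(b - prim R s) - (b - prim Q s)\<bar> = \<bar>prim (\<lambda>t. R t - Q t) s\<bar>"
        using s y by (subst prim_diff) (auto intro: R Q)
      also have "L * \<dots> \<le> L * prim A s"
        using s y by (intro mult_left_mono L prim_mono continuous_intros R Q A le) auto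
      finally show "\<bar>g s (b - prim R s) - g s (b - prim Q s)\<bar> \<le> L * prim A s" .
    qed (auto intro!: ci continuous_intros cg R Q y continuous_on_prim A)
    also have "\<dots> = L * avg m (prim A) y" by (rule avg_cmult)
    also have "\<dots> \<le> L * integral {0..y} A"
    proof (intro mult_left_mono avg_prim_le A y L)
      fix t :: real assume "0 \<le> t" "t < 1"
      then show "0 \<le> A t" using le[of t] by (meson abs_ge_zero order_trans)
    qed
    finally show ?thesis .
  qed
  define X where "X k = (T ^^ k) (\<lambda>_. 0)" for k
  have X0: "X 0 = (\<lambda>_. 0)" and XS: "X (Suc k) = T (X k)" for k by (auto simp: X_def)
  have cX: "continuous_on {0..<1} (X k)" for k
    by (induction k) (auto simp: X0 XS intro!: cT)
  have G0: "0 \<le> G0" using bd[of 0] by simp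
  have Xd: "\<bar>X (Suc k) y - X k y\<bar> \<le> G0 * (L * y) ^ k / fact k" if "0 \<le> y" "y < 1" for k y
    using that
  proof (induction k arbitrary: y)
    case 0
    have "\<bar>T (\<lambda>_. 0) y\<bar> \<le> avg m (\<lambda>_. G0) y"
      unfolding T_def using 0
      by (intro abs_avg_le) (auto simp: prim_def bd intro!: continuous_on_subinterval cont)
    also have "\<dots> \<le> G0" using G0 by (simp add: avg_const field_simps)
    finally show ?case using 0 by (simp add: XS X0)
  next
    case (Suc k)
    let ?A = "\<lambda>t. G0 * (L * t) ^ k / fact k"
    have cA: "continuous_on {0..<1} ?A" by (intro continuous_intros) auto
    have "((\<lambda>t. G0 * (L * t) ^ k / fact k) has_integral
        (G0 * L ^ k * y ^ Suc k / fact (Suc k) - G0 * L ^ k * 0 ^ Suc k / fact (Suc k))) {0..y}"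
    proof (intro fundamental_theorem_of_calculus)
      fix x :: real
      have "((\<lambda>y. G0 * L ^ k * y ^ Suc k / fact (Suc k)) has_real_derivative G0 * L ^ k * (real (Suc k) * x ^ k) / fact (Suc k)) (at x within {0..y})"
        by (auto intro!: derivative_eq_intros simp del: power_Suc fact_Suc of_nat_Suc)
      also have "G0 * L ^ k * (real (Suc k) * x ^ k) / fact (Suc k) = G0 * (L * x) ^ k / fact k"
        by (simp add: power_mult_distrib field_simps del: of_nat_Suc)
      finally show "((\<lambda>y. G0 * L ^ k * y ^ Suc k / fact (Suc k)) has_vector_derivative G0 * (L * x) ^ k / fact k) (at x within {0..y})"
        by (simp add: has_real_derivative_iff_has_vector_derivative)
    qed (use Suc.prems in auto)
    then have "integral {0..y} ?A = G0 * L ^ k * y ^ Suc k / fact (Suc k)"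
      by (subst integral_unique, assumption) simp
    then have "L * integral {0..y} ?A = G0 * (L * y) ^ Suc k / fact (Suc k)"
      by (simp only:) (simp add: power_mult_distrib del: fact_Suc)
    moreover have "\<bar>X (Suc (Suc k)) y - X (Suc k) y\<bar> \<le> L * integral {0..y} ?A"
      unfolding XS[of "Suc k"] using Tdiff[OF cX[of "Suc k"] cX[of k] cA Suc.IH Suc.prems] unfolding XS .
    ultimately show ?case by simp
  qed
  define R where "R y = (\<Sum>i. X (Suc i) y - X i y)" for y
  have sm: "summable (\<lambda>k. G0 * L ^ k / fact k)"
  proof -
    have "(\<lambda>k. G0 * (inverse (fact k) * L ^ k)) = (\<lambda>k. G0 * L ^ k / fact k)"
      by (simp add: fun_eq_iff field_simps)
    then show ?thesis using summable_mult[OF summable_exp[of L], of G0] by simp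
  qed
  have "uniform_limit {0..<1} (\<lambda>k y. \<Sum>i<k. X (Suc i) y - X i y) R sequentially"
    unfolding R_def[abs_def]
  proof (rule Weierstrass_m_test[OF _ sm])
    fix k y assume y: "y \<in> {0..<1::real}"
    have "(L * y) ^ k \<le> L ^ k" using y L by (intro power_mono) (auto intro: mult_left_le)
    then have "G0 * (L * y) ^ k / fact k \<le> G0 * L ^ k / fact k"
      using G0 by (intro divide_right_mono mult_left_mono) auto
    then show "norm (X (Suc k) y - X k y) \<le> G0 * L ^ k / fact k"
      using Xd[of y k] y by simp
  qed
  moreover have "(\<Sum>i<k. X (Suc i) y - X i y) = X k y" for k y
    by (simp add: sum_lessThan_telescope[of "\<lambda>i. X i y"] X0)
  ultimately have ul: "uniform_limit {0..<1} X R sequentially" by simp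
  have cR: "continuous_on {0..<1} R"
    by (rule uniform_limit_theorem[OF _ ul]) (auto simp: cX)
  have "R y = T R y" if y: "0 \<le> y" "y < 1" for y
  proof (rule LIMSEQ_unique)
    have "(\<lambda>k. X k y) \<longlonglongrightarrow> R y" using tendsto_uniform_limitI[OF ul] y by simp
    then show "(\<lambda>k. X (Suc k) y) \<longlonglongrightarrow> R y" by (rule LIMSEQ_Suc)
    show "(\<lambda>k. X (Suc k) y) \<longlonglongrightarrow> T R y"
    proof (rule LIMSEQ_I)
      fix r :: real assume r: "r > 0"
      define e where "e = r / (2 * (L + 1))"
      have e: "e > 0" using r L by (simp add: e_def)
      obtain N where N: "\<And>k t. k \<ge> N \<Longrightarrow> t \<in> {0..<1} \<Longrightarrow> dist (X k t) (R t) < e"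
        using uniform_limitD[OF ul e] unfolding eventually_sequentially by blast
      have "norm (X (Suc k) y - T R y) < r" if k: "k \<ge> N" for k
      proof -
        have "\<bar>T (X k) y - T R y\<bar> \<le> L * integral {0..y} (\<lambda>_. e)"
          using N[OF k] by (intro Tdiff cX cR y) (auto simp: dist_real_def intro: less_imp_le)
        also have "\<dots> \<le> L * e" using y e L by (auto simp: content_real mult_left_le intro!: mult_left_mono)
        also have "\<dots> < r"
        proof -
          have "L * r < 2 * (L + 1) * r" using r L by (intro mult_strict_right_mono) auto
          then show ?thesis using r L by (simp add: e_def field_simps)
        qed
        finally show ?thesis by (simp add: XS)
      qed
      then show "\<exists>N. \<forall>k\<ge>N. norm (X (Suc k) y - T R y) < r" by blast
    qed
  qed
  then show ?thesis using cR unfolding T_def by auto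
qed

section \<open>Calculus of the logarithm \<open>ell\<close>\<close>

lemma ell_0 [simp]: "ell 0 = 0"
  by (simp add: ell_def)

lemma ell_nonneg: "0 \<le> y \<Longrightarrow> y < 1 \<Longrightarrow> 0 \<le> ell y"
  by (simp add: ell_def)

lemma ell_deriv: "y < 1 \<Longrightarrow> (ell has_real_derivative 1 / (1 - y)) (at y within S)"
  unfolding ell_def[abs_def] by (auto intro!: derivative_eq_intros simp: field_simps)

lemma continuous_on_ell: "continuous_on {0..<1} ell"
  unfolding ell_def[abs_def] by (intro continuous_intros) auto

lemma has_integral_deriv_within:
  fixes B A :: "real \<Rightarrow> real"
  assumes "\<And>t. 0 \<le> t \<Longrightarrow> t \<le> y \<Longrightarrow> (B has_real_derivative A t) (at t within {0..y})" "0 \<le> y"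
  shows "(A has_integral B y - B 0) {0..y}"
  using assms
  by (intro fundamental_theorem_of_calculus) (auto simp flip: has_real_derivative_iff_has_vector_derivative)

lemma prim_one:
  assumes "0 \<le> y" "y < 1"
  shows "prim (\<lambda>_. 1) y = ell y"
proof -
  have "((\<lambda>t. 1 / (1 - t)) has_integral ell y - ell 0) {0..y}"
    by (rule has_integral_deriv_within) (use assms in \<open>auto intro!: ell_deriv\<close>)
  then show ?thesis unfolding prim_def by (simp add: integral_unique)
qed

lemma prim_ell:
  assumes "0 \<le> y" "y < 1"
  shows "prim (\<lambda>t. 2 * ell t) y = (ell y)\<^sup>2"
proof -
  have "((\<lambda>t. 2 * ell t / (1 - t)) has_integral (ell y)\<^sup>2 - (ell 0)\<^sup>2) {0..y}"
    by (rule has_integral_deriv_within) (use assms in \<open>auto intro!: derivative_eq_intros ell_deriv\<close>)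
  then show ?thesis unfolding prim_def by (simp add: integral_unique)
qed

lemma integral_ell:
  assumes "0 \<le> y" "y < 1"
  shows "integral {0..y} ell = y - (1 - y) * ell y"
proof -
  have "(ell has_integral (y - (1 - y) * ell y) - (0 - (1 - 0) * ell 0)) {0..y}"
    by (rule has_integral_deriv_within)
       (use assms in \<open>auto intro!: derivative_eq_intros ell_deriv\<close>)
  then show ?thesis by (simp add: integral_unique)
qed

lemma prim_le_ell:
  assumes "continuous_on {0..<1} R" "0 \<le> y" "y < 1"
    and "\<And>s. 0 \<le> s \<Longrightarrow> s < 1 \<Longrightarrow> \<bar>R s\<bar> \<le> C"
  shows "\<bar>prim R y\<bar> \<le> C * ell y"
proof -
  have "\<bar>prim R y\<bar> \<le> prim (\<lambda>t. C * 1) y"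
    using assms by (intro prim_mono) auto
  then show ?thesis unfolding prim_cmult using assms by (simp add: prim_one)
qed

lemma avg_ell_le:
  assumes "0 \<le> y" "y < 1"
  shows "avg m ell y \<le> 1"
proof -
  have "avg m ell y = avg m (prim (\<lambda>_. 1)) y"
    using assms by (intro avg_cong) (auto simp: prim_one)
  also have "\<dots> \<le> integral {0..y} (\<lambda>_. 1)"
    using assms by (intro avg_prim_le) auto
  finally show ?thesis using assms by simp
qed

text \<open>Since \<open>(ell y)^2\<close> is \<open>prim\<close> of \<open>2 * ell\<close>,
  averaging reduces it to the integral of \<open>2 * ell\<close>, which stays below
  \<open>2\<close>.\<close>

lemma avg_ell_sq_le:
  assumes "0 \<le> y" "y < 1"
  shows "avg m (\<lambda>s. (ell s)\<^sup>2) y \<le> 2"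
proof -
  have "avg m (\<lambda>s. (ell s)\<^sup>2) y = avg m (prim (\<lambda>t. 2 * ell t)) y"
    using assms by (intro avg_cong) (auto simp: prim_ell)
  also have "\<dots> \<le> integral {0..y} (\<lambda>t. 2 * ell t)"
    using assms by (intro avg_prim_le) (auto intro!: continuous_intros continuous_on_ell simp: ell_nonneg)
  also have "\<dots> = 2 * (y - (1 - y) * ell y)" using assms by (simp add: integral_ell)
  also have "\<dots> \<le> 2"
  proof -
    have *: "2 * (y - z) \<le> 2" if "0 \<le> z" for z using that assms by simp
    show ?thesis by (rule *) (use assms ell_nonneg[of y] in simp)
  qed
  finally show ?thesis .
qed

text \<open>The tail integral of \<open>1 + ell\<close>.\<close>

definition ltail :: "real \<Rightarrow> real" where
  "ltail y = (1 - y) * (ell y + 2)"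

lemma ltail_deriv: "y < 1 \<Longrightarrow> (ltail has_real_derivative - (1 + ell y)) (at y within S)"
  unfolding ltail_def[abs_def]
  by (auto intro!: derivative_eq_intros ell_deriv simp: field_simps)

lemma ltail_nonneg: "0 \<le> y \<Longrightarrow> y < 1 \<Longrightarrow> 0 \<le> ltail y"
  using ell_nonneg[of y] by (simp add: ltail_def)

lemma tendsto_one_minus_ell: "((\<lambda>y. (1 - y) * ell y) \<longlongrightarrow> 0) (at_left 1)"
proof (rule tendsto_sandwich)
  have ev: "\<forall>\<^sub>F y in at_left (1::real). 0 \<le> y \<and> y < 1"
    using eventually_at_left_real[of 0 "1::real"] by (auto elim: eventually_mono)
  show "\<forall>\<^sub>F y in at_left 1. 0 \<le> (1 - y) * ell y"
    using ev by eventually_elim (auto simp: ell_nonneg)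
  show "\<forall>\<^sub>F y in at_left 1. (1 - y) * ell y \<le> 2 * sqrt (1 - y)"
    using ev
  proof eventually_elim
    case (elim y)
    \<comment> \<open>Applying \<open>ln t \<le> t\<close> to \<open>t = 1 / x\<close>, with
      \<open>x\<close> the square root of \<open>1 - y\<close>, leaves one factor \<open>x\<close>
      of decay.\<close>
    define x where "x = sqrt (1 - y)"
    have x: "0 < x" "1 - y = x ^ 2" using elim by (auto simp: x_def)
    have "ln (1 / x) \<le> 1 / x" using ln_le_minus_one[of "1 / x"] x by simp
    then have "- ln x \<le> 1 / x" using x by (simp add: ln_div)
    then have "x ^ 2 * (- ln x) \<le> x ^ 2 * (1 / x)" by (intro mult_left_mono) auto
    then have "x ^ 2 * (- (2 * ln x)) \<le> 2 * x" using x by (simp add: power2_eq_square)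
    moreover have "ell y = - (2 * ln x)" unfolding ell_def x(2) using x(1) by (simp add: ln_realpow)
    ultimately have "(1 - y) * ell y \<le> 2 * x" by (simp only: x(2))
    then show ?case by (simp only: x_def)
  qed
  show "((\<lambda>y. 2 * sqrt (1 - y)) \<longlongrightarrow> 0) (at_left (1::real))"
    by (rule tendsto_eq_intros refl | simp)+
qed simp

lemma tendsto_ltail: "(ltail \<longlongrightarrow> 0) (at_left 1)"
proof -
  have "((\<lambda>y. (1 - y) * ell y + 2 * (1 - y)) \<longlongrightarrow> 0 + 2 * (1 - 1)) (at_left 1)"
    by (intro tendsto_intros tendsto_one_minus_ell)
  then show ?thesis by (simp add: ltail_def[abs_def] algebra_simps)
qed

text \<open>\<open>- ltail\<close> is a primitive of \<open>1 + ell\<close>, so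
  \<open>\<phi> + K * ltail\<close> and \<open>- \<phi> + K * ltail\<close> both decrease.\<close>

lemma log_bounded_deriv:
  assumes cont: "continuous_on {a..b} \<phi>" and ab: "0 \<le> a" "a \<le> b" "b < 1"
    and d: "\<And>y. a < y \<Longrightarrow> y < b \<Longrightarrow> (\<phi> has_real_derivative \<phi>' y) (at y)"
    and le: "\<And>y. a < y \<Longrightarrow> y < b \<Longrightarrow> \<bar>\<phi>' y\<bar> \<le> K * (1 + ell y)"
  shows "\<bar>\<phi> b - \<phi> a\<bar> \<le> K * (ltail a - ltail b)"
proof -
  have cl: "continuous_on {a..b} ltail"
    unfolding continuous_on_eq_continuous_within
    using DERIV_continuous[OF ltail_deriv] ab by auto
  have "\<phi> b + K * ltail b \<le> \<phi> a + K * ltail a"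
  proof (rule DERIV_nonpos_imp_decreasing_open[OF ab(2)])
    fix y assume y: "a < y" "y < b"
    then have "((\<lambda>y. \<phi> y + K * ltail y) has_real_derivative \<phi>' y - K * (1 + ell y)) (at y)"
      using ab by (auto intro!: derivative_eq_intros d ltail_deriv simp: algebra_simps)
    moreover have "\<phi>' y - K * (1 + ell y) \<le> 0" using le[OF y] by linarith
    ultimately show "\<exists>d. ((\<lambda>y. \<phi> y + K * ltail y) has_real_derivative d) (at y) \<and> d \<le> 0"
      by blast
  qed (intro continuous_intros cont cl)
  moreover have "- \<phi> b + K * ltail b \<le> - \<phi> a + K * ltail a"
  proof (rule DERIV_nonpos_imp_decreasing_open[OF ab(2)])
    fix y assume y: "a < y" "y < b"
    then have "((\<lambda>y. - \<phi> y + K * ltail y) has_real_derivative - \<phi>' y - K * (1 + ell y)) (at y)"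
      using ab by (auto intro!: derivative_eq_intros d ltail_deriv simp: algebra_simps)
    moreover have "- \<phi>' y - K * (1 + ell y) \<le> 0" using le[OF y] by linarith
    ultimately show "\<exists>d. ((\<lambda>y. - \<phi> y + K * ltail y) has_real_derivative d) (at y) \<and> d \<le> 0"
      by blast
  qed (intro continuous_intros cont cl)
  ultimately show ?thesis by (simp add: right_diff_distrib abs_le_iff)
qed

text \<open>The hypothesis makes \<open>\<phi> + K * ltail\<close> nonincreasing and bounded below;
  it tends to its infimum, and \<open>ltail\<close> tends to \<open>0\<close>.\<close>

lemma left_limit_exists:
  assumes le: "\<And>a b. a0 \<le> a \<Longrightarrow> a \<le> b \<Longrightarrow> b < 1 \<Longrightarrow> \<bar>\<phi> b - \<phi> a\<bar> \<le> K * (ltail a - ltail b)"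
    and a0: "0 \<le> a0" "a0 < 1" and K: "0 \<le> K"
  shows "\<exists>l. (\<phi> \<longlongrightarrow> l) (at_left 1)"
proof -
  let ?\<psi> = "\<lambda>y. \<phi> y + K * ltail y"
  define l where "l = Inf (?\<psi> ` {a0..<1})"
  have bd: "bdd_below (?\<psi> ` {a0..<1})"
  proof (rule bdd_belowI2)
    fix y assume y: "y \<in> {a0..<1}"
    then show "\<phi> a0 - K * ltail a0 \<le> ?\<psi> y"
      using le[of a0 y] K ltail_nonneg[of y] a0
      by (auto simp: abs_le_iff right_diff_distrib) (smt (verit) mult_nonneg_nonneg)
  qed
  have "(?\<psi> \<longlongrightarrow> l) (at_left 1)"
  proof (rule decreasing_tendsto)
    show "\<forall>\<^sub>F y in at_left 1. l \<le> ?\<psi> y"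
      using eventually_at_left_real[OF a0(2)]
      by eventually_elim (auto simp: l_def intro!: cInf_lower bd)
    fix x assume "l < x"
    then obtain z where z: "z \<in> {a0..<1}" "?\<psi> z < x"
      unfolding l_def using cInf_lessD[of "?\<psi> ` {a0..<1}" x] a0 by auto
    have "\<forall>\<^sub>F y in at_left 1. y \<in> {z<..<1}" using z by (intro eventually_at_left_real) auto
    then show "\<forall>\<^sub>F y in at_left 1. ?\<psi> y < x"
    proof eventually_elim
      case (elim y)
      then show ?case using le[of z y] z by (auto simp: abs_le_iff right_diff_distrib)
    qed
  qed
  moreover have "((\<lambda>y. K * ltail y) \<longlongrightarrow> K * 0) (at_left 1)"
    by (intro tendsto_intros tendsto_ltail)
  ultimately have "((\<lambda>y. ?\<psi> y - K * ltail y) \<longlongrightarrow> l - K * 0) (at_left 1)"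
    by (rule tendsto_diff)
  then show ?thesis by auto
qed

section \<open>The flux as a function of \<open>y\<close> and its limit at \<open>1\<close>\<close>

lemma eventually_left_one: "a < 1 \<Longrightarrow> \<forall>\<^sub>F y in at_left (1::real). a < y \<and> y < 1"
  using eventually_at_left_real[of a 1] by (auto elim: eventually_mono)

lemma flux_deriv:
  assumes G: "continuous_on {0..<1} G" and R: "\<And>y. 0 \<le> y \<Longrightarrow> y < 1 \<Longrightarrow> R y = avg m G y"
    and y: "0 < y" "y < 1"
  shows "((\<lambda>y. y ^ Suc m * R y) has_real_derivative y ^ m * G y) (at y)"
proof -
  have "((\<lambda>y. integral {0..y} (\<lambda>s. s ^ m * G s)) has_real_derivative y ^ m * G y) (at y within {0..<1})"
    by (rule integral_upper_deriv_within) (use y G in \<open>auto intro!: continuous_intros\<close>)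
  then have "((\<lambda>y. integral {0..y} (\<lambda>s. s ^ m * G s)) has_real_derivative y ^ m * G y) (at y)"
    using y by (simp add: at_within_interior_unit)
  moreover have "\<forall>\<^sub>F x in nhds y. x \<in> {0<..<1}"
    using y by (intro eventually_nhds_in_open) auto
  then have "\<forall>\<^sub>F x in nhds y. integral {0..x} (\<lambda>s. s ^ m * G s) = x ^ Suc m * R x"
    by eventually_elim (simp add: R power_times_avg[symmetric] continuous_on_subinterval[OF G])
  ultimately show ?thesis
    by (subst (asm) DERIV_cong_ev[OF refl _ refl]) auto
qed

lemma flux_deriv':
  assumes G: "continuous_on {0..<1} G" and R: "\<And>y. 0 \<le> y \<Longrightarrow> y < 1 \<Longrightarrow> R y = avg m G y"
    and y: "0 < y" "y < 1"
  shows "(R has_real_derivative (G y - real (Suc m) * R y) / y) (at y)"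
proof -
  have "((\<lambda>y. (y ^ Suc m * R y) / y ^ Suc m) has_real_derivative
      (y ^ m * G y * y ^ Suc m - (y ^ Suc m * R y) * (real (Suc m) * y ^ m)) / (y ^ Suc m * y ^ Suc m)) (at y)"
    using y by (intro DERIV_divide flux_deriv[OF G R]) (auto intro!: derivative_eq_intros simp del: power_Suc of_nat_Suc)
  moreover have "(y ^ m * G y * y ^ Suc m - (y ^ Suc m * R y) * (real (Suc m) * y ^ m)) / (y ^ Suc m * y ^ Suc m)
      = (G y - real (Suc m) * R y) / y"
    using y by (simp add: field_simps del: of_nat_Suc)
  moreover have "\<forall>\<^sub>F x in nhds y. x \<in> {0<..<1}"
    using y by (intro eventually_nhds_in_open) auto
  then have "\<forall>\<^sub>F x in nhds y. (x ^ Suc m * R x) / x ^ Suc m = R x"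
    by eventually_elim simp
  ultimately show ?thesis
    by (subst (asm) DERIV_cong_ev[OF refl _ refl]) auto
qed

lemma flux_variation:
  assumes G: "continuous_on {0..<1} G" and R: "\<And>y. 0 \<le> y \<Longrightarrow> y < 1 \<Longrightarrow> R y = avg m G y"
    and le: "\<And>y. 0 \<le> y \<Longrightarrow> y < 1 \<Longrightarrow> \<bar>G y\<bar> \<le> K * (1 + ell y)"
    and ab: "0 \<le> a" "a \<le> b" "b < 1"
  shows "\<bar>b ^ Suc m * R b - a ^ Suc m * R a\<bar> \<le> K * (ltail a - ltail b)"
proof (rule log_bounded_deriv[OF _ ab])
  have "continuous_on {0..<1} R"
    using continuous_on_avg[OF G, of m] R by (subst continuous_on_cong[OF refl, of _ _ "avg m G"]) auto
  then show "continuous_on {a..b} (\<lambda>y. y ^ Suc m * R y)"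
    by (intro continuous_intros) (use ab in \<open>auto intro: continuous_on_subset\<close>)
  fix y assume y: "a < y" "y < b"
  then show "((\<lambda>y. y ^ Suc m * R y) has_real_derivative y ^ m * G y) (at y)"
    using ab by (intro flux_deriv[OF G R]) auto
  have "\<bar>y ^ m * G y\<bar> \<le> 1 * \<bar>G y\<bar>"
    unfolding abs_mult using y ab by (intro mult_right_mono) (auto simp: power_le_one)
  then show "\<bar>y ^ m * G y\<bar> \<le> K * (1 + ell y)" using le[of y] y ab by simp
qed

lemma flux_limit:
  assumes G: "continuous_on {0..<1} G" and R: "\<And>y. 0 \<le> y \<Longrightarrow> y < 1 \<Longrightarrow> R y = avg m G y"
    and le: "\<And>y. 0 \<le> y \<Longrightarrow> y < 1 \<Longrightarrow> \<bar>G y\<bar> \<le> K * (1 + ell y)"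
  shows "\<exists>l. (R \<longlongrightarrow> l) (at_left 1)"
proof -
  have K: "0 \<le> K" using le[of 0] by simp
  obtain l where l: "((\<lambda>y. y ^ Suc m * R y) \<longlongrightarrow> l) (at_left 1)"
    using left_limit_exists[of 0 "\<lambda>y. y ^ Suc m * R y" K] flux_variation[OF G R le] K by auto
  have "((\<lambda>y. (y ^ Suc m * R y) / y ^ Suc m) \<longlongrightarrow> l / 1 ^ Suc m) (at_left 1)"
    by (intro tendsto_divide l tendsto_intros) auto
  moreover have "\<forall>\<^sub>F y in at_left 1. (y ^ Suc m * R y) / y ^ Suc m = R y"
    using eventually_left_one[OF zero_less_one] by eventually_elim auto
  ultimately show ?thesis by (auto simp: tendsto_cong)
qed

lemma abs_le_left_limit:
  assumes "(f \<longlongrightarrow> l) (at_left (1::real))" "\<And>y. 0 \<le> y \<Longrightarrow> y < 1 \<Longrightarrow> \<bar>f y\<bar> \<le> (C::real)"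
  shows "\<bar>l\<bar> \<le> C"
proof (rule tendsto_upperbound[OF tendsto_rabs[OF assms(1)]])
  show "\<forall>\<^sub>F y in at_left 1. \<bar>f y\<bar> \<le> C"
    using eventually_left_one[OF zero_less_one] by eventually_elim (auto intro: assms(2))
qed simp

section \<open>The truncated nonlinearity\<close>

text \<open>For negative \<open>u\<close> the interval \<open>{0..u}\<close> is empty and the
  integral is \<open>0\<close>; this agrees with a primitive of \<open>G\<close> because
  \<open>G\<close> vanishes on the negative axis.\<close>

lemma integral_from_0_deriv:
  fixes G :: "real \<Rightarrow> real"
  assumes G: "continuous_on UNIV G" and 0: "\<And>t. t \<le> 0 \<Longrightarrow> G t = 0"
  shows "((\<lambda>u. integral {0..u} G) has_real_derivative G u) (at u)"
proof -
  define a where "a = min 0 (u - 1)"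
  have int: "G integrable_on {x..y}" for x y
    by (rule integrable_continuous_interval) (rule continuous_on_subset[OF G], simp)
  have eq: "integral {a..x} G = integral {0..x} G" if "a < x" for x
  proof (cases "x \<le> 0")
    case True
    have "integral {a..x} G = integral {a..x} (\<lambda>_. 0)"
      by (rule integral_cong) (use True in \<open>auto intro: 0\<close>)
    moreover have "integral {0..x} G = 0" using True by (cases "x = 0") auto
    ultimately show ?thesis by simp
  next
    case False
    have "integral {a..0} G = integral {a..0} (\<lambda>_. 0)"
      by (rule integral_cong) (auto intro: 0)
    then show ?thesis
      using Henstock_Kurzweil_Integration.integral_combine[of a 0 x G] int False by (auto simp: a_def)
  qed
  have "((\<lambda>x. integral {a..x} G) has_real_derivative G u) (at u within {a..u + 1})"
    by (rule integral_has_real_derivative) (auto simp: a_def intro: continuous_on_subset[OF G])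
  moreover have "at u within {a..u + 1} = at u"
    by (rule at_within_interior) (auto simp: a_def)
  moreover have "\<forall>\<^sub>F x in nhds u. x \<in> {a<..}"
    by (intro eventually_nhds_in_open) (auto simp: a_def)
  then have "\<forall>\<^sub>F x in nhds u. integral {a..x} G = integral {0..x} G"
    by eventually_elim (auto intro: eq)
  ultimately show ?thesis by (simp add: DERIV_cong_ev[OF refl _ refl])
qed

text \<open>Small increments are handled by the mean value theorem and uniform continuity, large
  ones by boundedness of the derivative together with
  \<open>\<bar>k\<bar> \<le> k^2 / \<delta>\<close>. The estimate has to cover all \<open>k\<close>,
  because two profiles may differ by an unbounded logarithm near \<open>y = 1\<close>.\<close>

lemma uniform_taylor:
  fixes \<phi> \<Phi> :: "real \<Rightarrow> real"
  assumes d: "\<And>u. (\<Phi> has_real_derivative \<phi> u) (at u)"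
    and uc: "uniformly_continuous_on UNIV \<phi>" and bd: "\<And>u. \<bar>\<phi> u\<bar> \<le> L" and e: "0 < e"
  shows "\<exists>C\<ge>0. \<forall>u k. \<bar>\<Phi> (u + k) - \<Phi> u - \<phi> u * k\<bar> \<le> e * \<bar>k\<bar> + C * k\<^sup>2"
proof -
  obtain \<delta> where \<delta>: "\<delta> > 0" "\<And>u v. \<bar>v - u\<bar> < \<delta> \<Longrightarrow> \<bar>\<phi> v - \<phi> u\<bar> < e"
    using uc e unfolding uniformly_continuous_on_def dist_real_def by auto
  have L: "0 \<le> L" using bd[of 0] by linarith
  have "\<bar>\<Phi> (u + k) - \<Phi> u - \<phi> u * k\<bar> \<le> e * \<bar>k\<bar> + (2 * L / \<delta>) * k\<^sup>2" for u k
  proof (cases "k = 0")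
    case False
    have "\<exists>z. \<bar>z - u\<bar> < \<bar>k\<bar> \<and> \<Phi> (u + k) - \<Phi> u = k * \<phi> z"
    proof (cases "k > 0")
      case True
      then obtain z where "u < z" "z < u + k" "\<Phi> (u + k) - \<Phi> u = (u + k - u) * \<phi> z"
        using MVT2[of u "u + k" \<Phi> \<phi>] d by auto
      then show ?thesis by (intro exI[of _ z]) auto
    next
      case neg: False
      then obtain z where "u + k < z" "z < u" "\<Phi> u - \<Phi> (u + k) = (u - (u + k)) * \<phi> z"
        using MVT2[of "u + k" u \<Phi> \<phi>] d False by auto
      then show ?thesis by (intro exI[of _ z]) (auto simp: algebra_simps)
    qed
    then obtain z where z: "\<bar>z - u\<bar> < \<bar>k\<bar>" "\<Phi> (u + k) - \<Phi> u = k * \<phi> z" by auto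
    have eq: "\<bar>\<Phi> (u + k) - \<Phi> u - \<phi> u * k\<bar> = \<bar>\<phi> z - \<phi> u\<bar> * \<bar>k\<bar>"
      unfolding z(2) by (simp add: abs_mult[symmetric] algebra_simps)
    show ?thesis
    proof (cases "\<bar>k\<bar> < \<delta>")
      case True
      then have "\<bar>\<phi> z - \<phi> u\<bar> * \<bar>k\<bar> \<le> e * \<bar>k\<bar>"
        using \<delta>(2)[of z u] z by (intro mult_right_mono) auto
      moreover have "0 \<le> (2 * L / \<delta>) * k\<^sup>2" using L \<delta> by simp
      ultimately show ?thesis using eq by linarith
    next
      case False
      have "\<bar>\<phi> z - \<phi> u\<bar> * \<bar>k\<bar> \<le> (2 * L) * \<bar>k\<bar>"
        using bd[of z] bd[of u] by (intro mult_right_mono) auto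
      also have "\<dots> = (2 * L / \<delta>) * (\<delta> * \<bar>k\<bar>)" using \<delta> by simp
      also have "\<dots> \<le> (2 * L / \<delta>) * (\<bar>k\<bar> * \<bar>k\<bar>)"
        using L \<delta> False by (intro mult_left_mono mult_right_mono) auto
      also have "\<bar>k\<bar> * \<bar>k\<bar> = k\<^sup>2" by (simp add: power2_eq_square)
      finally have "\<bar>\<phi> z - \<phi> u\<bar> * \<bar>k\<bar> \<le> (2 * L / \<delta>) * k\<^sup>2" .
      moreover have "0 \<le> e * \<bar>k\<bar>" using e by simp
      ultimately show ?thesis using eq by linarith
    qed
  qed simp
  then show ?thesis using L \<delta> by (intro exI[of _ "2 * L / \<delta>"]) auto
qed

text \<open>The same global form of an expansion, now around one point and for a bounded function:
  for \<open>\<bar>k\<bar> \<ge> \<delta>\<close> constants and linear terms are both dominated by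
  \<open>k^2\<close>.\<close>

lemma deriv_global_estimate:
  fixes \<phi> :: "real \<Rightarrow> real"
  assumes d: "(\<phi> has_real_derivative D) (at a)" and bd: "\<And>u. \<bar>\<phi> u\<bar> \<le> L" and e: "0 < e"
  shows "\<exists>C\<ge>0. \<forall>k. \<bar>\<phi> (a + k) - \<phi> a - D * k\<bar> \<le> e * \<bar>k\<bar> + C * k\<^sup>2"
proof -
  have "((\<lambda>k. (\<phi> (a + k) - \<phi> a) / k) \<longlongrightarrow> D) (at 0)" using d by (simp add: DERIV_def)
  from tendstoD[OF this e] obtain \<delta> where \<delta>: "\<delta> > 0"
    "\<And>k. k \<noteq> 0 \<Longrightarrow> \<bar>k\<bar> < \<delta> \<Longrightarrow> \<bar>(\<phi> (a + k) - \<phi> a) / k - D\<bar> < e"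
    unfolding eventually_at dist_real_def by auto
  have L: "0 \<le> L" using bd[of 0] by linarith
  let ?C = "2 * L / \<delta>\<^sup>2 + \<bar>D\<bar> / \<delta>"
  have C: "0 \<le> ?C" using L \<delta> by simp
  have "\<bar>\<phi> (a + k) - \<phi> a - D * k\<bar> \<le> e * \<bar>k\<bar> + ?C * k\<^sup>2" for k
  proof (cases "\<bar>k\<bar> < \<delta>")
    case True
    show ?thesis
    proof (cases "k = 0")
      case False
      have "\<phi> (a + k) - \<phi> a - D * k = ((\<phi> (a + k) - \<phi> a) / k - D) * k"
        using False by (simp add: field_simps)
      then have "\<bar>\<phi> (a + k) - \<phi> a - D * k\<bar> = \<bar>(\<phi> (a + k) - \<phi> a) / k - D\<bar> * \<bar>k\<bar>"
        by (simp only: abs_mult)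
      also have "\<dots> \<le> e * \<bar>k\<bar>" using \<delta>(2)[OF False True] by (intro mult_right_mono) auto
      finally have "\<bar>\<phi> (a + k) - \<phi> a - D * k\<bar> \<le> e * \<bar>k\<bar>" .
      moreover have "0 \<le> ?C * k\<^sup>2" using C by simp
      ultimately show ?thesis by linarith
    qed simp
  next
    case False
    have "1 \<le> \<bar>k\<bar> / \<delta>" using False \<delta> by simp
    then have k1: "1 \<le> (\<bar>k\<bar> / \<delta>)\<^sup>2" by (simp add: one_le_power)
    have "\<bar>\<phi> (a + k) - \<phi> a - D * k\<bar> \<le> 2 * L + \<bar>D\<bar> * \<bar>k\<bar>"
      using bd[of "a + k"] bd[of a] abs_mult[of D k] by linarith
    also have "2 * L \<le> 2 * L * (\<bar>k\<bar> / \<delta>)\<^sup>2" using k1 L by (simp add: mult_le_cancel_left1)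
    also have "\<bar>D\<bar> * \<bar>k\<bar> \<le> \<bar>D\<bar> * \<bar>k\<bar> * (\<bar>k\<bar> / \<delta>)"
      using mult_left_mono[OF \<open>1 \<le> \<bar>k\<bar> / \<delta>\<close>, of "\<bar>D\<bar> * \<bar>k\<bar>"] by simp
    also have "2 * L * (\<bar>k\<bar> / \<delta>)\<^sup>2 + \<bar>D\<bar> * \<bar>k\<bar> * (\<bar>k\<bar> / \<delta>) = ?C * k\<^sup>2"
      using \<delta> by (simp add: field_simps power2_eq_square)
    finally have "\<bar>\<phi> (a + k) - \<phi> a - D * k\<bar> \<le> ?C * k\<^sup>2" by simp
    moreover have "0 \<le> e * \<bar>k\<bar>" using e by simp
    ultimately show ?thesis by linarith
  qed
  then show ?thesis using C by blast
qed

section \<open>The truncated power, its derivative and its potential\<close>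

definition clamp0 :: "real \<Rightarrow> real \<Rightarrow> real" where
  "clamp0 M u = max 0 (min u M)"

text \<open>The truncation is prescribed through its derivative: clamping the argument makes
  \<open>dtpow\<close> continuous and bounded at once, and its primitive \<open>tpow\<close> is then
  C^1, zero on the negative axis, the true power on \<open>[0, M]\<close> and affine above
  \<open>M\<close>.\<close>

definition dtpow :: "real \<Rightarrow> real \<Rightarrow> real \<Rightarrow> real" where
  "dtpow p M u = p * clamp0 M u powr (p - 1)"

definition tpow :: "real \<Rightarrow> real \<Rightarrow> real \<Rightarrow> real" where
  "tpow p M u = integral {0..u} (dtpow p M)"

definition nlin :: "real \<Rightarrow> real \<Rightarrow> real \<Rightarrow> real" where
  "nlin p M u = tpow p M u - u"

definition dnlin :: "real \<Rightarrow> real \<Rightarrow> real \<Rightarrow> real" where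
  "dnlin p M u = dtpow p M u - 1"

definition Nlin :: "real \<Rightarrow> real \<Rightarrow> real \<Rightarrow> real" where
  "Nlin p M u = integral {0..u} (tpow p M) - u\<^sup>2 / 2"

definition lipc :: "real \<Rightarrow> real \<Rightarrow> real" where
  "lipc p M = p * M powr (p - 1) + 1"

locale truncation =
  fixes p M :: real
  assumes p: "1 < p" and M: "1 < M"
begin

lemma continuous_dh: "continuous_on S (dtpow p M)"
  unfolding dtpow_def[abs_def] clamp0_def using p
  by (intro continuous_intros continuous_on_powr') auto

lemma dh_nonneg: "0 \<le> dtpow p M u"
  using p by (simp add: dtpow_def)

lemma dh_le: "dtpow p M u \<le> p * M powr (p - 1)"
  using p M by (auto simp: dtpow_def clamp0_def intro!: mult_left_mono powr_mono2)

lemma h_deriv: "(tpow p M has_real_derivative dtpow p M u) (at u)"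
  unfolding tpow_def[abs_def]
  by (rule integral_from_0_deriv[OF continuous_dh]) (use M in \<open>auto simp: dtpow_def clamp0_def\<close>)

lemma h_mono: "u \<le> v \<Longrightarrow> tpow p M u \<le> tpow p M v"
  by (rule DERIV_nonneg_imp_nondecreasing) (use h_deriv dh_nonneg in blast)+

lemma h_neg: "u \<le> 0 \<Longrightarrow> tpow p M u = 0"
  unfolding tpow_def by (cases "u = 0") auto

lemma h_nonneg: "0 \<le> tpow p M u"
  by (cases "u \<le> 0") (use h_mono[of 0 u] h_neg[of 0] h_neg[of u] in auto)

lemma h_powr:
  assumes "0 \<le> u" "u \<le> M"
  shows "tpow p M u = u powr p"
proof -
  have "(dtpow p M has_integral u powr p - 0 powr p) {0..u}"
  proof (rule fundamental_theorem_of_calculus_interior)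
    show "continuous_on {0..u} (\<lambda>x. x powr p)" using p by (intro continuous_on_powr') (auto intro: continuous_intros)
    fix x assume x: "x \<in> {0<..<u}"
    have "((\<lambda>x. x powr p) has_real_derivative p * x powr (p - 1)) (at x)"
      using x by (auto intro!: derivative_eq_intros)
    moreover have "dtpow p M x = p * x powr (p - 1)" using x assms by (simp add: dtpow_def clamp0_def)
    ultimately show "((\<lambda>x. x powr p) has_vector_derivative dtpow p M x) (at x)"
      by (simp add: has_real_derivative_iff_has_vector_derivative)
  qed (use assms in auto)
  then show ?thesis by (simp add: tpow_def integral_unique)
qed

text \<open>The doubling property of the power survives truncation with a constant independent of
  \<open>M\<close>, since \<open>clamp0 M x / 2 \<le> clamp0 M (x / 2)\<close> for
  \<open>x \<ge> 0\<close>. It keeps \<open>M\<close> out of the bound on the end value in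
  \<open>reg_end_bound\<close>.\<close>

lemma h_half:
  assumes "0 \<le> u"
  shows "2 powr (- p) * tpow p M u \<le> tpow p M (u / 2)"
proof -
  let ?\<phi> = "\<lambda>u. tpow p M (u / 2) - 2 powr (- p) * tpow p M u"
  have "?\<phi> 0 \<le> ?\<phi> u"
  proof (rule DERIV_nonneg_imp_nondecreasing[OF assms])
    fix x :: real assume x: "0 \<le> x"
    have d: "(?\<phi> has_real_derivative dtpow p M (x / 2) * (1 / 2) - 2 powr (- p) * dtpow p M x) (at x)"
      by (auto intro!: derivative_eq_intros h_deriv DERIV_chain2[OF h_deriv])
    have "2 powr (- p) * dtpow p M x = (1 / 2) * (p * (clamp0 M x / 2) powr (p - 1))"
      using M x by (simp add: dtpow_def clamp0_def powr_divide powr_diff powr_minus field_simps)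
    also have "\<dots> \<le> (1 / 2) * (p * clamp0 M (x / 2) powr (p - 1))"
      using M x p by (intro mult_left_mono powr_mono2) (auto simp: clamp0_def)
    finally have "0 \<le> dtpow p M (x / 2) * (1 / 2) - 2 powr (- p) * dtpow p M x" by (simp add: dtpow_def)
    with d show "\<exists>y. (?\<phi> has_real_derivative y) (at x) \<and> 0 \<le> y" by blast
  qed
  then show ?thesis by (simp add: h_neg)
qed

text \<open>At \<open>u0\<close> the inequality is one for the true power; beyond \<open>u0\<close>
  the slope of \<open>tpow\<close> is at least \<open>c\<close>.\<close>

lemma h_ge_linear:
  assumes c: "1 \<le> c" and u0: "1 \<le> u0" "u0 \<le> M" "c \<le> u0 powr (p - 1)" and u: "u0 \<le> u"
  shows "c * u \<le> tpow p M u"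
proof -
  have "tpow p M u0 - c * u0 \<le> tpow p M u - c * u"
  proof (rule DERIV_nonneg_imp_nondecreasing[OF u])
    fix x assume x: "u0 \<le> x" "x \<le> u"
    have "c \<le> u0 powr (p - 1)" by fact
    also have "\<dots> \<le> clamp0 M x powr (p - 1)"
      using x u0 p by (intro powr_mono2) (auto simp: clamp0_def)
    also have "\<dots> \<le> dtpow p M x" using p by (simp add: dtpow_def mult_le_cancel_right1)
    finally have "0 \<le> dtpow p M x - c" by simp
    moreover have "((\<lambda>u. tpow p M u - c * u) has_real_derivative dtpow p M x - c) (at x)"
      by (auto intro!: derivative_eq_intros h_deriv)
    ultimately show "\<exists>y. ((\<lambda>u. tpow p M u - c * u) has_real_derivative y) (at x) \<and> 0 \<le> y" by blast
  qed
  moreover have "c * u0 \<le> tpow p M u0"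
  proof -
    have "c * u0 \<le> u0 powr (p - 1) * u0" using u0 by (intro mult_right_mono) auto
    also have "\<dots> = u0 powr p" using u0 by (simp add: powr_mult_base[symmetric] mult.commute powr_diff)
    finally show ?thesis using u0 by (simp add: h_powr)
  qed
  ultimately show ?thesis by simp
qed

lemma f_deriv: "(nlin p M has_real_derivative dnlin p M u) (at u)"
  unfolding nlin_def[abs_def] dnlin_def by (auto intro!: derivative_eq_intros h_deriv)

lemma continuous_f: "continuous_on S (nlin p M)"
  using DERIV_continuous_on[of S "nlin p M" "dnlin p M"] f_deriv by (auto intro: has_field_derivative_at_within)

lemma continuous_df: "continuous_on S (dnlin p M)"
  unfolding dnlin_def[abs_def] by (intro continuous_intros continuous_dh)

lemma lipc_ge: "1 \<le> lipc p M"
  using p by (simp add: lipc_def)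

lemma abs_df_le: "\<bar>dnlin p M u\<bar> \<le> lipc p M"
  using dh_nonneg[of u] dh_le[of u] p by (simp add: dnlin_def lipc_def abs_le_iff)

lemma f_lipschitz: "\<bar>nlin p M u - nlin p M v\<bar> \<le> lipc p M * \<bar>u - v\<bar>"
  using field_differentiable_bound[of UNIV "nlin p M" "dnlin p M" "lipc p M" u v] f_deriv abs_df_le by auto

lemma f_1: "nlin p M 1 = 0"
  using M by (simp add: nlin_def h_powr)

lemma df_1: "dnlin p M 1 = p - 1"
  using M by (simp add: dnlin_def dtpow_def clamp0_def)

lemma f_powr: "0 \<le> u \<Longrightarrow> u \<le> M \<Longrightarrow> nlin p M u = u powr p - u"
  by (simp add: nlin_def h_powr)

lemma df_powr: "0 \<le> u \<Longrightarrow> u \<le> M \<Longrightarrow> dnlin p M u = p * u powr (p - 1) - 1"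
  by (simp add: dnlin_def dtpow_def clamp0_def)

lemma f_gt_1: assumes "1 < u" shows "0 < nlin p M u"
proof -
  have "nlin p M 1 < nlin p M u"
  proof (rule DERIV_pos_imp_increasing[OF assms])
    fix x assume x: "1 \<le> x" "x \<le> u"
    have "1 powr (p - 1) \<le> clamp0 M x powr (p - 1)"
      using x M p by (intro powr_mono2) (auto simp: clamp0_def)
    then have "p * 1 \<le> dtpow p M x" unfolding dtpow_def using p by (intro mult_left_mono) auto
    then have "0 < dnlin p M x" using p by (simp add: dnlin_def)
    then show "\<exists>y. (nlin p M has_real_derivative y) (at x) \<and> 0 < y" using f_deriv by blast
  qed
  then show ?thesis by (simp add: f_1)
qed

lemma f_ge: assumes "0 \<le> u" shows "- 1 \<le> nlin p M u"
proof (cases "u \<le> 1")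
  case True
  then show ?thesis using h_nonneg[of u] by (simp add: nlin_def)
next
  case False
  then show ?thesis using f_gt_1[of u] by simp
qed

lemma f_ge_minus: "- u \<le> nlin p M u"
  using h_nonneg[of u] by (simp add: nlin_def)

lemma F_deriv: "(Nlin p M has_real_derivative nlin p M u) (at u)"
proof -
  have "continuous_on UNIV (tpow p M)"
    using DERIV_continuous_on[of UNIV "tpow p M" "dtpow p M"] h_deriv by auto
  from integral_from_0_deriv[OF this h_neg] show ?thesis
    unfolding Nlin_def[abs_def] nlin_def by (auto intro!: derivative_eq_intros)
qed

lemma F_strict: assumes "1 \<le> u" "u < v" shows "Nlin p M u < Nlin p M v"
proof (rule DERIV_pos_imp_increasing_open[OF assms(2)])
  fix x assume "u < x" "x < v"
  then show "\<exists>y. (Nlin p M has_real_derivative y) (at x) \<and> 0 < y"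
    using F_deriv f_gt_1[of x] assms by auto
qed (auto intro!: continuous_at_imp_continuous_on DERIV_isCont F_deriv)

lemma F_powr:
  assumes "0 \<le> u" "u \<le> M"
  shows "Nlin p M u = u powr (p + 1) / (p + 1) - u\<^sup>2 / 2"
proof -
  have "(tpow p M has_integral u powr (p + 1) / (p + 1) - 0 powr (p + 1) / (p + 1)) {0..u}"
  proof (rule fundamental_theorem_of_calculus_interior)
    show "continuous_on {0..u} (\<lambda>x. x powr (p + 1) / (p + 1))"
      using p by (intro continuous_intros continuous_on_powr') auto
    fix x assume x: "x \<in> {0<..<u}"
    have "((\<lambda>x. x powr (p + 1) / (p + 1)) has_real_derivative x powr p) (at x)"
      using x p by (auto intro!: derivative_eq_intros)
    moreover have "tpow p M x = x powr p" using x assms by (simp add: h_powr)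
    ultimately show "((\<lambda>x. x powr (p + 1) / (p + 1)) has_vector_derivative tpow p M x) (at x)"
      by (simp add: has_real_derivative_iff_has_vector_derivative)
  qed (use assms in auto)
  then show ?thesis using p by (simp add: Nlin_def integral_unique)
qed

text \<open>Uniform continuity of \<open>dnlin\<close> on the whole line holds because
  \<open>dnlin\<close> factors through \<open>clamp0\<close>, which is 1-Lipschitz with compact
  range.\<close>

lemma f_taylor:
  assumes "0 < e"
  shows "\<exists>C\<ge>0. \<forall>u k. \<bar>nlin p M (u + k) - nlin p M u - dnlin p M u * k\<bar> \<le> e * \<bar>k\<bar> + C * k\<^sup>2"
proof (rule uniform_taylor[OF f_deriv _ abs_df_le assms])
  have "uniformly_continuous_on {0..M} (dnlin p M)"
    by (intro compact_uniformly_continuous continuous_df) auto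
  then have "uniformly_continuous_on (clamp0 M ` UNIV) (dnlin p M)"
    unfolding uniformly_continuous_on_def using M
    by (elim all_forward imp_forward ex_forward conj_forward) (auto simp: clamp0_def)
  moreover have "uniformly_continuous_on UNIV (clamp0 M)"
    unfolding uniformly_continuous_on_def dist_real_def
  proof (intro allI impI)
    fix e :: real assume "0 < e"
    moreover have "\<bar>clamp0 M u - clamp0 M v\<bar> \<le> \<bar>u - v\<bar>" for u v
      unfolding clamp0_def by (simp add: max_def min_def abs_if)
    ultimately show "\<exists>d>0. \<forall>x\<in>UNIV. \<forall>x'\<in>UNIV. \<bar>x' - x\<bar> < d \<longrightarrow> \<bar>clamp0 M x' - clamp0 M x\<bar> < e"
      by (intro exI[of _ e]) (meson le_less_trans)
  qed
  ultimately have "uniformly_continuous_on UNIV (\<lambda>u. dnlin p M (clamp0 M u))"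
    using uniformly_continuous_on_compose[of UNIV "clamp0 M" "dnlin p M"] by simp
  moreover have "dnlin p M (clamp0 M u) = dnlin p M u" for u
    using M by (simp add: dnlin_def dtpow_def clamp0_def)
  ultimately show "uniformly_continuous_on UNIV (dnlin p M)" by simp
qed

text \<open>\<open>p * (p - 1)\<close> is the second derivative of \<open>u powr p - u\<close> at
  \<open>1\<close>, the coefficient that decides the sign of the defect at
  \<open>\<kappa>1\<close>.\<close>

lemma df_taylor_1:
  assumes "0 < e"
  shows "\<exists>C\<ge>0. \<forall>k. \<bar>dnlin p M (1 + k) - (p - 1) - p * (p - 1) * k\<bar> \<le> e * \<bar>k\<bar> + C * k\<^sup>2"
proof -
  have "((\<lambda>u. p * u powr (p - 1) - 1) has_real_derivative p * (p - 1)) (at 1)"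
    by (auto intro!: derivative_eq_intros)
  moreover have "\<forall>\<^sub>F u in nhds 1. u \<in> {0<..<M}"
    using M by (intro eventually_nhds_in_open) auto
  then have "\<forall>\<^sub>F u in nhds 1. dnlin p M u = p * u powr (p - 1) - 1"
    by eventually_elim (simp add: df_powr)
  ultimately have "(dnlin p M has_real_derivative p * (p - 1)) (at 1)"
    by (simp add: DERIV_cong_ev[OF refl _ refl])
  from deriv_global_estimate[OF this abs_df_le assms] show ?thesis
    by (simp add: df_1)
qed

end

section \<open>Shooting from the fixed point\<close>

locale shooting = truncation +
  fixes m :: nat
begin

definition flux_eq :: "real \<Rightarrow> real \<Rightarrow> (real \<Rightarrow> real) \<Rightarrow> bool" where
  "flux_eq \<kappa> b R \<longleftrightarrow> continuous_on {0..<1} R \<and>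
     (\<forall>y\<in>{0..<1}. R y = avg m (\<lambda>s. \<kappa> * nlin p M (b - prim R s)) y)"

definition flux :: "real \<Rightarrow> real \<Rightarrow> real \<Rightarrow> real" where
  "flux \<kappa> b = (SOME R. flux_eq \<kappa> b R)"

definition prof :: "real \<Rightarrow> real \<Rightarrow> real \<Rightarrow> real" where
  "prof \<kappa> b y = b - prim (flux \<kappa> b) y"

text \<open>The flux equation differentiated in the starting value \<open>b\<close>; hence the
  linearised profile \<open>1 - prim S\<close> starts from \<open>1\<close>.\<close>

definition lflux_eq :: "real \<Rightarrow> real \<Rightarrow> (real \<Rightarrow> real) \<Rightarrow> bool" where
  "lflux_eq \<kappa> b S \<longleftrightarrow> continuous_on {0..<1} S \<and>
     (\<forall>y\<in>{0..<1}. S y = avg m (\<lambda>s. \<kappa> * dnlin p M (prof \<kappa> b s) * (1 - prim S s)) y)"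

definition lflux :: "real \<Rightarrow> real \<Rightarrow> real \<Rightarrow> real" where
  "lflux \<kappa> b = (SOME S. lflux_eq \<kappa> b S)"

definition lprof :: "real \<Rightarrow> real \<Rightarrow> real \<Rightarrow> real" where
  "lprof \<kappa> b y = 1 - prim (lflux \<kappa> b) y"

definition defect :: "real \<Rightarrow> real \<Rightarrow> real" where
  "defect \<kappa> b = Lim (at_left 1) (flux \<kappa> b)"

definition ldefect :: "real \<Rightarrow> real \<Rightarrow> real" where
  "ldefect \<kappa> b = Lim (at_left 1) (lflux \<kappa> b)"

abbreviation "L \<equiv> lipc p M"

lemma continuous_comp_nlin:
  "continuous_on A u \<Longrightarrow> continuous_on A (\<lambda>s. nlin p M (u s))"
  "continuous_on A u \<Longrightarrow> continuous_on A (\<lambda>s. dnlin p M (u s))"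
  using continuous_on_compose2[OF continuous_f[of UNIV]] continuous_on_compose2[OF continuous_df[of UNIV]]
  by auto

lemma flux_eq_flux:
  assumes "0 \<le> \<kappa>"
  shows "flux_eq \<kappa> b (flux \<kappa> b)"
proof -
  have "\<exists>R. continuous_on {0..<1} R \<and> (\<forall>y\<in>{0..<1}. R y = avg m (\<lambda>s. \<kappa> * nlin p M (b - prim R s)) y)"
  proof (rule volterra_exists[where L = "\<kappa> * L" and ?G0.0 = "\<kappa> * \<bar>nlin p M b\<bar>"])
    show "\<bar>\<kappa> * nlin p M a - \<kappa> * nlin p M c\<bar> \<le> \<kappa> * L * \<bar>a - c\<bar>" for a c
      using mult_left_mono[OF f_lipschitz[of a c] assms] assms
      by (simp add: abs_mult mult.assoc flip: right_diff_distrib)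
  qed (use assms lipc_ge in \<open>auto intro!: continuous_intros continuous_comp_nlin simp: abs_mult\<close>)
  then show ?thesis unfolding flux_def flux_eq_def by (rule someI_ex)
qed

lemma
  assumes "0 \<le> \<kappa>"
  shows continuous_on_flux: "continuous_on {0..<1} (flux \<kappa> b)"
    and flux: "0 \<le> y \<Longrightarrow> y < 1 \<Longrightarrow> flux \<kappa> b y = avg m (\<lambda>s. \<kappa> * nlin p M (prof \<kappa> b s)) y"
    and continuous_on_prof: "continuous_on {0..<1} (prof \<kappa> b)"
  using flux_eq_flux[OF assms, of b] unfolding flux_eq_def prof_def[abs_def]
  by (auto intro!: continuous_intros continuous_on_prim)

lemma continuous_on_rhs: "0 \<le> \<kappa> \<Longrightarrow> continuous_on {0..<1} (\<lambda>s. \<kappa> * nlin p M (prof \<kappa> b s))"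
  by (intro continuous_intros continuous_comp_nlin continuous_on_prof)

lemma lflux_eq_lflux:
  assumes \<kappa>: "0 \<le> \<kappa>"
  shows "lflux_eq \<kappa> b (lflux \<kappa> b)"
proof -
  have df: "\<kappa> * \<bar>dnlin p M x\<bar> \<le> \<kappa> * L" for x
    using \<kappa> abs_df_le by (intro mult_left_mono) auto
  have "\<exists>S. continuous_on {0..<1} S \<and> (\<forall>y\<in>{0..<1}. S y = avg m (\<lambda>s. \<kappa> * dnlin p M (prof \<kappa> b s) * (1 - prim S s)) y)"
  proof (rule volterra_exists[where L = "\<kappa> * L" and ?G0.0 = "\<kappa> * L"])
    show "\<bar>\<kappa> * dnlin p M (prof \<kappa> b s) * a - \<kappa> * dnlin p M (prof \<kappa> b s) * c\<bar> \<le> \<kappa> * L * \<bar>a - c\<bar>" for s a c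
      using mult_right_mono[OF df[of "prof \<kappa> b s"], of "\<bar>a - c\<bar>"] \<kappa>
      by (simp add: abs_mult flip: right_diff_distrib)
  qed (use \<kappa> df lipc_ge in \<open>auto intro!: continuous_intros continuous_comp_nlin continuous_on_prof simp: abs_mult\<close>)
  then show ?thesis unfolding lflux_def lflux_eq_def by (rule someI_ex)
qed

lemma
  assumes "0 \<le> \<kappa>"
  shows continuous_on_lflux: "continuous_on {0..<1} (lflux \<kappa> b)"
    and lflux: "0 \<le> y \<Longrightarrow> y < 1 \<Longrightarrow> lflux \<kappa> b y = avg m (\<lambda>s. \<kappa> * dnlin p M (prof \<kappa> b s) * lprof \<kappa> b s) y"
    and continuous_on_lprof: "continuous_on {0..<1} (lprof \<kappa> b)"
  using lflux_eq_lflux[OF assms, of b] unfolding lflux_eq_def lprof_def[abs_def]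
  by (auto intro!: continuous_intros continuous_on_prim)

lemma continuous_on_lrhs:
  "0 \<le> \<kappa> \<Longrightarrow> continuous_on {0..<1} (\<lambda>s. \<kappa> * dnlin p M (prof \<kappa> b s) * lprof \<kappa> b s)"
  by (intro continuous_intros continuous_comp_nlin continuous_on_prof continuous_on_lprof)

lemma prof_deriv:
  assumes "0 \<le> \<kappa>" "0 < y" "y < 1"
  shows "(prof \<kappa> b has_real_derivative - (flux \<kappa> b y / (1 - y))) (at y)"
  using prim_deriv_within[OF continuous_on_flux[OF assms(1)], of y b] assms
  unfolding prof_def[abs_def] by (auto intro!: derivative_eq_intros simp: at_within_interior_unit)

lemma lprof_deriv:
  assumes "0 \<le> \<kappa>" "0 < y" "y < 1"
  shows "(lprof \<kappa> b has_real_derivative - (lflux \<kappa> b y / (1 - y))) (at y)"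
  using prim_deriv_within[OF continuous_on_lflux[OF assms(1)], of y b] assms
  unfolding lprof_def[abs_def] by (auto intro!: derivative_eq_intros simp: at_within_interior_unit)

lemma prof_0: "prof \<kappa> b 0 = b"
  by (simp add: prof_def)

lemma lprof_0: "lprof \<kappa> b 0 = 1"
  by (simp add: lprof_def)

section \<open>Estimates uniform for \<open>\<kappa>\<close> in \<open>[0, K]\<close>\<close>

context
  fixes K :: real
begin

text \<open>The constant delivered by \<open>volterra_stability\<close> for a forcing
  \<open>K * L\<close>. It is both a Lipschitz constant of the flux in \<open>b\<close> and a bound
  for the linearised flux.\<close>

definition bnd :: real where
  "bnd = K * L * exp (K * L)"

lemma bnd_nonneg: "0 \<le> K \<Longrightarrow> 0 \<le> bnd"
  using lipc_ge by (simp add: bnd_def)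

lemma
  assumes \<kappa>: "0 \<le> \<kappa>" "\<kappa> \<le> K"
  shows scaled_lip: "\<bar>\<kappa> * nlin p M a - \<kappa> * nlin p M c\<bar> \<le> K * L * \<bar>a - c\<bar>"
    and scaled_df: "\<bar>\<kappa> * dnlin p M x\<bar> \<le> K * L"
proof -
  have "\<bar>\<kappa> * nlin p M a - \<kappa> * nlin p M c\<bar> = \<kappa> * \<bar>nlin p M a - nlin p M c\<bar>"
    using \<kappa> by (simp add: abs_mult flip: right_diff_distrib)
  also have "\<dots> \<le> K * (L * \<bar>a - c\<bar>)"
    using \<kappa> f_lipschitz by (intro mult_mono) auto
  finally show "\<bar>\<kappa> * nlin p M a - \<kappa> * nlin p M c\<bar> \<le> K * L * \<bar>a - c\<bar>" by (simp add: mult.assoc)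
  show "\<bar>\<kappa> * dnlin p M x\<bar> \<le> K * L"
    unfolding abs_mult using \<kappa> abs_df_le by (intro mult_mono) auto
qed

lemma avg_const_le: "0 \<le> c \<Longrightarrow> avg k (\<lambda>_. c) y \<le> c"
  by (simp add: avg_const divide_le_eq mult_le_cancel_left1)

lemma flux_lipschitz:
  assumes \<kappa>: "0 \<le> \<kappa>" "\<kappa> \<le> K" and y: "0 \<le> y" "y < 1"
  shows "\<bar>flux \<kappa> b y - flux \<kappa> c y\<bar> \<le> bnd * \<bar>b - c\<bar>"
proof -
  have K: "0 \<le> K * L" using \<kappa> lipc_ge by simp
  let ?G = "\<lambda>s. \<kappa> * nlin p M (prof \<kappa> b s) - \<kappa> * nlin p M (prof \<kappa> c s)"
  have "\<bar>flux \<kappa> b y - flux \<kappa> c y\<bar> \<le> (K * L * \<bar>b - c\<bar>) * exp (K * L)"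
  proof (rule volterra_stability[where D = "\<lambda>y. flux \<kappa> b y - flux \<kappa> c y" and G = ?G and m = m
        and \<rho> = "\<lambda>_. K * L * \<bar>b - c\<bar>", OF _ _ K y])
    fix s :: real assume s: "0 \<le> s" "s < 1"
    show "flux \<kappa> b s - flux \<kappa> c s = avg m ?G s"
      using s \<kappa> by (subst avg_diff) (auto intro: continuous_on_subinterval continuous_on_rhs simp: flux)
    have "\<bar>?G s\<bar> \<le> K * L * \<bar>prof \<kappa> b s - prof \<kappa> c s\<bar>" by (rule scaled_lip[OF \<kappa>])
    also have "\<dots> \<le> K * L * (\<bar>b - c\<bar> + \<bar>prim (\<lambda>y. flux \<kappa> b y - flux \<kappa> c y) s\<bar>)"
      using s \<kappa> K by (subst prim_diff) (auto simp: prof_def intro!: mult_left_mono continuous_on_flux)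
    finally show "\<bar>?G s\<bar> \<le> K * L * \<bar>b - c\<bar> + K * L * \<bar>prim (\<lambda>y. flux \<kappa> b y - flux \<kappa> c y) s\<bar>"
      by (simp add: distrib_left)
    show "avg m (\<lambda>_. K * L * \<bar>b - c\<bar>) s \<le> K * L * \<bar>b - c\<bar>" using K by (intro avg_const_le) simp
  qed (auto intro!: continuous_intros continuous_on_flux continuous_on_rhs \<kappa>)
  then show ?thesis by (simp add: bnd_def mult_ac)
qed

text \<open>Because \<open>nlin p M 1 = 0\<close>, the constant \<open>1\<close> leaves no forcing
  in the stability estimate, and the flux is bounded by \<open>0\<close>.\<close>

lemma flux_one:
  assumes \<kappa>: "0 \<le> \<kappa>" "\<kappa> \<le> K" and y: "0 \<le> y" "y < 1"
  shows "flux \<kappa> 1 y = 0" "prof \<kappa> 1 y = 1"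
proof -
  have K: "0 \<le> K * L" using \<kappa> lipc_ge by simp
  have *: "flux \<kappa> 1 s = 0" if s: "0 \<le> s" "s < 1" for s
  proof -
    have "\<bar>flux \<kappa> 1 s\<bar> \<le> 0 * exp (K * L)"
    proof (rule volterra_stability[where G = "\<lambda>s. \<kappa> * nlin p M (prof \<kappa> 1 s)" and m = m and \<rho> = "\<lambda>_. 0",
          OF _ _ K s])
      fix t :: real assume t: "0 \<le> t" "t < 1"
      have "\<bar>\<kappa> * nlin p M (prof \<kappa> 1 t) - \<kappa> * nlin p M 1\<bar> \<le> K * L * \<bar>prof \<kappa> 1 t - 1\<bar>"
        by (rule scaled_lip[OF \<kappa>])
      then show "\<bar>\<kappa> * nlin p M (prof \<kappa> 1 t)\<bar> \<le> 0 + K * L * \<bar>prim (flux \<kappa> 1) t\<bar>"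
        by (simp add: f_1 prof_def)
    qed (auto intro!: continuous_on_flux continuous_on_rhs \<kappa> flux simp: avg_const)
    then show ?thesis by simp
  qed
  show "flux \<kappa> 1 y = 0" by (rule *[OF y])
  have "prim (flux \<kappa> 1) y = integral {0..y} (\<lambda>_. 0)"
    unfolding prim_def using y by (intro integral_cong) (auto simp: *)
  then show "prof \<kappa> 1 y = 1" by (simp add: prof_def)
qed

lemma flux_bound:
  assumes \<kappa>: "0 \<le> \<kappa>" "\<kappa> \<le> K" and y: "0 \<le> y" "y < 1"
  shows "\<bar>flux \<kappa> b y\<bar> \<le> bnd * \<bar>b - 1\<bar>"
  using flux_lipschitz[OF assms, of b 1] flux_one(1)[OF assms] by simp

lemma prof_bound:
  assumes \<kappa>: "0 \<le> \<kappa>" "\<kappa> \<le> K" and y: "0 \<le> y" "y < 1"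
  shows "\<bar>prof \<kappa> b y - b\<bar> \<le> bnd * \<bar>b - 1\<bar> * ell y"
  using prim_le_ell[OF continuous_on_flux[OF \<kappa>(1)] y flux_bound[OF \<kappa>], of b] by (simp add: prof_def)

lemma lflux_bound:
  assumes \<kappa>: "0 \<le> \<kappa>" "\<kappa> \<le> K" and y: "0 \<le> y" "y < 1"
  shows "\<bar>lflux \<kappa> b y\<bar> \<le> bnd"
proof -
  have K: "0 \<le> K * L" using \<kappa> lipc_ge by simp
  have "\<bar>lflux \<kappa> b y\<bar> \<le> (K * L) * exp (K * L)"
  proof (rule volterra_stability[where G = "\<lambda>s. \<kappa> * dnlin p M (prof \<kappa> b s) * lprof \<kappa> b s" and m = m
        and \<rho> = "\<lambda>_. K * L", OF _ _ K y])
    fix s :: real assume s: "0 \<le> s" "s < 1"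
    have "\<bar>\<kappa> * dnlin p M (prof \<kappa> b s) * lprof \<kappa> b s\<bar> \<le> K * L * (1 + \<bar>prim (lflux \<kappa> b) s\<bar>)"
      unfolding abs_mult[of _ "lprof \<kappa> b s"] using scaled_df[OF \<kappa>] K
      by (intro mult_mono) (auto simp: lprof_def)
    then show "\<bar>\<kappa> * dnlin p M (prof \<kappa> b s) * lprof \<kappa> b s\<bar> \<le> K * L + K * L * \<bar>prim (lflux \<kappa> b) s\<bar>"
      by (simp add: distrib_left)
  qed (auto intro!: continuous_on_lflux continuous_on_lrhs \<kappa> lflux avg_const_le K)
  then show ?thesis by (simp add: bnd_def)
qed

lemma lprof_bound:
  assumes \<kappa>: "0 \<le> \<kappa>" "\<kappa> \<le> K" and y: "0 \<le> y" "y < 1"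
  shows "\<bar>lprof \<kappa> b y - 1\<bar> \<le> bnd * ell y"
  using prim_le_ell[OF continuous_on_lflux[OF \<kappa>(1)] y lflux_bound[OF \<kappa>], of b] by (simp add: lprof_def)

lemma rhs_bound:
  assumes \<kappa>: "0 \<le> \<kappa>" "\<kappa> \<le> K" and y: "0 \<le> y" "y < 1"
  shows "\<bar>nlin p M (prof \<kappa> b y)\<bar> \<le> L * (1 + bnd) * \<bar>b - 1\<bar> * (1 + ell y)"
proof -
  have "\<bar>nlin p M (prof \<kappa> b y) - nlin p M 1\<bar> \<le> L * \<bar>prof \<kappa> b y - 1\<bar>" by (rule f_lipschitz)
  also have "\<dots> \<le> L * (\<bar>b - 1\<bar> + bnd * \<bar>b - 1\<bar> * ell y)"
    using prof_bound[OF assms, of b] lipc_ge by (intro mult_left_mono) auto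
  also have "\<dots> = L * \<bar>b - 1\<bar> * (1 + bnd * ell y)" by (simp add: algebra_simps)
  also have "\<dots> \<le> L * \<bar>b - 1\<bar> * ((1 + bnd) * (1 + ell y))"
    using bnd_nonneg \<kappa> ell_nonneg[OF y] lipc_ge by (intro mult_left_mono) (auto simp: algebra_simps)
  finally show ?thesis by (simp add: f_1 mult_ac)
qed

lemma tendsto_defect:
  assumes \<kappa>: "0 \<le> \<kappa>" "\<kappa> \<le> K"
  shows "(flux \<kappa> b \<longlongrightarrow> defect \<kappa> b) (at_left 1)"
proof -
  have "\<exists>l. (flux \<kappa> b \<longlongrightarrow> l) (at_left 1)"
  proof (rule flux_limit[OF continuous_on_rhs[OF \<kappa>(1)]])
    fix y :: real assume y: "0 \<le> y" "y < 1"
    show "\<bar>\<kappa> * nlin p M (prof \<kappa> b y)\<bar> \<le> (\<kappa> * (L * (1 + bnd) * \<bar>b - 1\<bar>)) * (1 + ell y)"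
      using mult_left_mono[OF rhs_bound[OF \<kappa> y, of b] \<kappa>(1)] \<kappa> by (simp add: abs_mult mult_ac)
  qed (rule flux[OF \<kappa>(1)])
  then show ?thesis unfolding defect_def by (metis tendsto_Lim trivial_limit_at_left_real)
qed

lemma lrhs_bound:
  assumes \<kappa>: "0 \<le> \<kappa>" "\<kappa> \<le> K" and y: "0 \<le> y" "y < 1"
  shows "\<bar>\<kappa> * dnlin p M (prof \<kappa> b y) * lprof \<kappa> b y\<bar> \<le> (K * L * (1 + bnd)) * (1 + ell y)"
proof -
  have K: "0 \<le> K * L" "0 \<le> K" using \<kappa> lipc_ge by simp_all
  have "\<bar>lprof \<kappa> b y\<bar> \<le> 1 + bnd * ell y" using lprof_bound[OF \<kappa> y, of b] by linarith
  also have "\<dots> \<le> (1 + bnd) * (1 + ell y)"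
    using bnd_nonneg[OF K(2)] ell_nonneg[OF y] by (auto simp: algebra_simps)
  finally have "\<bar>\<kappa> * dnlin p M (prof \<kappa> b y) * lprof \<kappa> b y\<bar> \<le> K * L * ((1 + bnd) * (1 + ell y))"
    unfolding abs_mult[of _ "lprof \<kappa> b y"] using scaled_df[OF \<kappa>] K by (intro mult_mono) auto
  then show ?thesis by (simp add: mult.assoc)
qed

lemma tendsto_ldefect:
  assumes \<kappa>: "0 \<le> \<kappa>" "\<kappa> \<le> K"
  shows "(lflux \<kappa> b \<longlongrightarrow> ldefect \<kappa> b) (at_left 1)"
proof -
  have "\<exists>l. (lflux \<kappa> b \<longlongrightarrow> l) (at_left 1)"
    by (rule flux_limit[OF continuous_on_lrhs[OF \<kappa>(1)] lflux[OF \<kappa>(1)] lrhs_bound[OF \<kappa>]])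
  then show ?thesis unfolding ldefect_def by (metis tendsto_Lim trivial_limit_at_left_real)
qed

lemma defect_lipschitz_b:
  assumes \<kappa>: "0 \<le> \<kappa>" "\<kappa> \<le> K"
  shows "\<bar>defect \<kappa> b - defect \<kappa> c\<bar> \<le> bnd * \<bar>b - c\<bar>"
  by (rule abs_le_left_limit[OF tendsto_diff[OF tendsto_defect[OF \<kappa>] tendsto_defect[OF \<kappa>]]])
     (rule flux_lipschitz[OF \<kappa>])

text \<open>The right hand sides differ by a Lipschitz term in the profiles and by
  \<open>\<bar>\<kappa> - \<mu>\<bar>\<close> times a nonlinearity of size \<open>1 + ell\<close>;
  the factor \<open>2\<close> bounds the average of \<open>1 + ell\<close>.\<close>

lemma defect_lipschitz_k:
  assumes \<kappa>: "0 \<le> \<kappa>" "\<kappa> \<le> K" and \<mu>: "0 \<le> \<mu>" "\<mu> \<le> K"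
  shows "\<bar>defect \<kappa> b - defect \<mu> b\<bar> \<le> 2 * L * (1 + bnd) * exp (K * L) * \<bar>b - 1\<bar> * \<bar>\<kappa> - \<mu>\<bar>"
proof (rule abs_le_left_limit[OF tendsto_diff[OF tendsto_defect[OF \<kappa>] tendsto_defect[OF \<mu>]]])
  fix y :: real assume y: "0 \<le> y" "y < 1"
  have K: "0 \<le> K * L" "0 \<le> K" using \<kappa> lipc_ge by simp_all
  let ?G = "\<lambda>s. \<kappa> * nlin p M (prof \<kappa> b s) - \<mu> * nlin p M (prof \<mu> b s)"
  let ?c = "\<bar>\<kappa> - \<mu>\<bar> * (L * (1 + bnd) * \<bar>b - 1\<bar>)"
  have c: "0 \<le> ?c" using lipc_ge bnd_nonneg[OF K(2)] by simp
  have "\<bar>flux \<kappa> b y - flux \<mu> b y\<bar> \<le> (2 * ?c) * exp (K * L)"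
  proof (rule volterra_stability[where D = "\<lambda>y. flux \<kappa> b y - flux \<mu> b y" and G = ?G and m = m
        and \<rho> = "\<lambda>s. ?c * (1 + ell s)", OF _ _ K(1) y])
    fix s :: real assume s: "0 \<le> s" "s < 1"
    show "flux \<kappa> b s - flux \<mu> b s = avg m ?G s"
      using s \<kappa> \<mu> by (subst avg_diff) (auto intro: continuous_on_subinterval continuous_on_rhs simp: flux)
    have "\<bar>?G s\<bar> \<le> \<bar>\<kappa> * nlin p M (prof \<kappa> b s) - \<kappa> * nlin p M (prof \<mu> b s)\<bar> + \<bar>\<kappa> - \<mu>\<bar> * \<bar>nlin p M (prof \<mu> b s)\<bar>"
      unfolding abs_mult[symmetric] by (simp add: algebra_simps)
    also have "\<dots> \<le> K * L * \<bar>prof \<kappa> b s - prof \<mu> b s\<bar> + \<bar>\<kappa> - \<mu>\<bar> * (L * (1 + bnd) * \<bar>b - 1\<bar> * (1 + ell s))"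
      by (intro add_mono scaled_lip[OF \<kappa>] mult_left_mono rhs_bound[OF \<mu> s]) auto
    also have "\<bar>prof \<kappa> b s - prof \<mu> b s\<bar> = \<bar>prim (\<lambda>y. flux \<kappa> b y - flux \<mu> b y) s\<bar>"
      using s \<kappa> \<mu> by (subst prim_diff) (auto simp: prof_def continuous_on_flux)
    finally show "\<bar>?G s\<bar> \<le> ?c * (1 + ell s) + K * L * \<bar>prim (\<lambda>y. flux \<kappa> b y - flux \<mu> b y) s\<bar>"
      by (simp add: mult_ac)
    have "avg m (\<lambda>s. ?c * (1 + ell s)) s = ?c * (avg m (\<lambda>_. 1) s + avg m ell s)"
      unfolding avg_cmult using s
      by (subst avg_add) (auto intro!: continuous_on_subinterval[OF continuous_on_ell])
    also have "\<dots> \<le> ?c * (1 + 1)"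
      using c s by (intro mult_left_mono add_mono avg_ell_le avg_const_le) auto
    finally show "avg m (\<lambda>s. ?c * (1 + ell s)) s \<le> 2 * ?c" by simp
  qed (auto intro!: continuous_intros continuous_on_flux continuous_on_rhs continuous_on_ell \<kappa> \<mu>)
  then show "\<bar>flux \<kappa> b y - flux \<mu> b y\<bar> \<le> 2 * L * (1 + bnd) * exp (K * L) * \<bar>b - 1\<bar> * \<bar>\<kappa> - \<mu>\<bar>"
    by (simp add: mult_ac)
qed

text \<open>The remainder of the first order expansion solves a Volterra inequality whose forcing is
  the Taylor error of \<open>nlin\<close>. That error involves the profile increment and its square,
  hence \<open>ell\<close> and its square, whose averages are bounded. So \<open>\<delta>\<close>
  depends on neither \<open>\<kappa>\<close>, \<open>b\<close> nor \<open>y\<close>, and the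
  estimate passes to the limit \<open>y = 1\<close>.\<close>

lemma flux_differentiable:
  assumes K: "0 \<le> K" and e: "0 < e"
  shows "\<exists>\<delta>>0. \<forall>\<kappa> b c y. 0 \<le> \<kappa> \<longrightarrow> \<kappa> \<le> K \<longrightarrow> \<bar>c - b\<bar> < \<delta> \<longrightarrow> 0 \<le> y \<longrightarrow> y < 1 \<longrightarrow>
           \<bar>flux \<kappa> c y - flux \<kappa> b y - (c - b) * lflux \<kappa> b y\<bar> \<le> e * \<bar>c - b\<bar>"
proof -
  \<comment> \<open>After stability the total error is at most
    \<open>(e' * q + \<epsilon> * (C * q2)) * \<epsilon>\<close>, where
    \<open>\<epsilon> = \<bar>c - b\<bar>\<close>; \<open>e'\<close> and \<open>\<delta>\<close> are
    chosen to make each summand in the bracket at most \<open>e / 2\<close>. The \<open>4\<close> in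
    \<open>q2\<close> is \<open>2\<close> times the bound \<open>2\<close> for the average of the
    square of \<open>ell\<close>.\<close>
  define q where "q = K * (2 * (1 + bnd)) * exp (K * L)"
  define q2 where "q2 = K * (2 + 4 * bnd\<^sup>2) * exp (K * L)"
  have KL: "0 \<le> K * L" using K lipc_ge by simp
  note bn = bnd_nonneg[OF K]
  have q: "0 \<le> q" "0 \<le> q2" using K bn by (simp_all add: q_def q2_def)
  define e' where "e' = e / (2 * (q + 1))"
  have e': "0 < e'" using e q by (simp add: e'_def)
  obtain C where C: "0 \<le> C" "\<And>u k. \<bar>nlin p M (u + k) - nlin p M u - dnlin p M u * k\<bar> \<le> e' * \<bar>k\<bar> + C * k\<^sup>2"
    using f_taylor[OF e'] by blast
  define \<delta> where "\<delta> = e / (2 * (C * q2 + 1))"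
  have Cq: "0 \<le> C * q2" using C q by simp
  have \<delta>: "0 < \<delta>" using e Cq by (simp add: \<delta>_def)
  have "\<bar>flux \<kappa> c y - flux \<kappa> b y - (c - b) * lflux \<kappa> b y\<bar> \<le> e * \<bar>c - b\<bar>"
    if \<kappa>: "0 \<le> \<kappa>" "\<kappa> \<le> K" and d: "\<bar>c - b\<bar> < \<delta>" and y: "0 \<le> y" "y < 1" for \<kappa> b c y
  proof -
    define \<epsilon> where "\<epsilon> = \<bar>c - b\<bar>"
    let ?D = "\<lambda>y. flux \<kappa> c y - flux \<kappa> b y - (c - b) * lflux \<kappa> b y"
    let ?G = "\<lambda>s. (\<kappa> * nlin p M (prof \<kappa> c s) - \<kappa> * nlin p M (prof \<kappa> b s))
      - (c - b) * (\<kappa> * dnlin p M (prof \<kappa> b s) * lprof \<kappa> b s)"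
    let ?r = "\<lambda>s. (K * e' * \<epsilon>) * (1 + bnd * ell s) + (K * C * \<epsilon>\<^sup>2) * (2 + 2 * bnd\<^sup>2 * (ell s)\<^sup>2)"
    have cD: "continuous_on {0..<1} ?D"
      by (intro continuous_intros continuous_on_flux continuous_on_lflux \<kappa>)
    have "\<bar>?D y\<bar> \<le> (K * e' * \<epsilon> * (1 + bnd) + K * C * \<epsilon>\<^sup>2 * (2 + 2 * bnd\<^sup>2 * 2)) * exp (K * L)"
    proof (rule volterra_stability[where D = ?D and G = ?G and m = m and \<rho> = ?r, OF cD _ KL y])
      fix s :: real assume s: "0 \<le> s" "s < 1"
      have ci: "continuous_on {0..s} A" if "continuous_on {0..<1} A" for A :: "real \<Rightarrow> real"
        using continuous_on_subinterval[OF that s(2)] .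
      have c1: "continuous_on {0..s} (\<lambda>s. \<kappa> * nlin p M (prof \<kappa> x s))" for x
        by (intro ci continuous_on_rhs \<kappa>)
      have c2: "continuous_on {0..s} (\<lambda>s. (c - b) * (\<kappa> * dnlin p M (prof \<kappa> b s) * lprof \<kappa> b s))"
        by (intro ci continuous_on_mult continuous_on_const continuous_on_lrhs \<kappa>)
      show "?D s = avg m ?G s"
        unfolding avg_diff[OF continuous_on_diff[OF c1 c1] c2 s(1)] avg_diff[OF c1 c1 s(1)] avg_cmult[of m "c - b"]
        using s \<kappa> by (simp add: flux lflux)
      let ?k = "prof \<kappa> c s - prof \<kappa> b s"
      have pr: "prim ?D s = prim (flux \<kappa> c) s - prim (flux \<kappa> b) s - (c - b) * prim (lflux \<kappa> b) s"
        using s \<kappa> by (simp add: prim_diff prim_cmult continuous_on_flux continuous_on_lflux continuous_intros)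
      have k1: "\<bar>?k\<bar> \<le> \<epsilon> * (1 + bnd * ell s)"
      proof -
        have "?k = (c - b) - prim (\<lambda>y. flux \<kappa> c y - flux \<kappa> b y) s"
          using s \<kappa> by (subst prim_diff) (auto simp: prof_def continuous_on_flux)
        moreover have "\<bar>prim (\<lambda>y. flux \<kappa> c y - flux \<kappa> b y) s\<bar> \<le> (bnd * \<epsilon>) * ell s"
          unfolding \<epsilon>_def using s \<kappa> by (intro prim_le_ell flux_lipschitz continuous_intros continuous_on_flux)
        ultimately have "\<bar>?k\<bar> \<le> \<epsilon> + (bnd * \<epsilon>) * ell s" unfolding \<epsilon>_def by linarith
        then show ?thesis by (simp add: algebra_simps)
      qed
      have k2: "?k\<^sup>2 \<le> \<epsilon>\<^sup>2 * (2 + 2 * bnd\<^sup>2 * (ell s)\<^sup>2)"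
      proof -
        have "?k\<^sup>2 = \<bar>?k\<bar>\<^sup>2" by simp
        also have "\<dots> \<le> (\<epsilon> * (1 + bnd * ell s))\<^sup>2" using k1 by (intro power_mono) auto
        also have "\<dots> \<le> \<epsilon>\<^sup>2 * (2 + 2 * (bnd * ell s)\<^sup>2)"
          unfolding power_mult_distrib[of \<epsilon>]
        proof (intro mult_left_mono)
          have "0 \<le> (1 - bnd * ell s)\<^sup>2" by simp
          then show "(1 + bnd * ell s)\<^sup>2 \<le> 2 + 2 * (bnd * ell s)\<^sup>2"
            unfolding power2_sum power2_diff by simp
        qed simp
        finally show ?thesis by (simp add: power_mult_distrib mult_ac)
      qed
      have "?G s = \<kappa> * (nlin p M (prof \<kappa> b s + ?k) - nlin p M (prof \<kappa> b s) - dnlin p M (prof \<kappa> b s) * ?k)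
          + \<kappa> * dnlin p M (prof \<kappa> b s) * (?k - (c - b) * lprof \<kappa> b s)"
        by (simp add: algebra_simps)
      \<comment> \<open>The error of the linearised profile is \<open>- prim\<close> of the error
        \<open>?D\<close> of the flux, which closes the Gronwall loop for \<open>?D\<close>.\<close>
      also have "?k - (c - b) * lprof \<kappa> b s = - prim ?D s"
        unfolding pr prof_def lprof_def by (simp add: algebra_simps)
      finally have Geq: "?G s = \<kappa> * (nlin p M (prof \<kappa> b s + ?k) - nlin p M (prof \<kappa> b s) - dnlin p M (prof \<kappa> b s) * ?k)
          + \<kappa> * dnlin p M (prof \<kappa> b s) * (- prim ?D s)" .
      have "\<bar>?G s\<bar> \<le> \<bar>\<kappa> * (nlin p M (prof \<kappa> b s + ?k) - nlin p M (prof \<kappa> b s) - dnlin p M (prof \<kappa> b s) * ?k)\<bar>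
          + \<bar>\<kappa> * dnlin p M (prof \<kappa> b s)\<bar> * \<bar>prim ?D s\<bar>"
        unfolding Geq by (rule order_trans[OF abs_triangle_ineq]) (simp add: abs_mult)
      also have "\<dots> \<le> K * (e' * \<bar>?k\<bar> + C * ?k\<^sup>2) + K * L * \<bar>prim ?D s\<bar>"
        unfolding abs_mult[of \<kappa> "_ - _"] using \<kappa> K KL C e'
        by (intro add_mono mult_mono C(2) scaled_df) auto
      also have "K * (e' * \<bar>?k\<bar> + C * ?k\<^sup>2) \<le> K * (e' * (\<epsilon> * (1 + bnd * ell s)) + C * (\<epsilon>\<^sup>2 * (2 + 2 * bnd\<^sup>2 * (ell s)\<^sup>2)))"
        using K C e' k1 k2 by (intro mult_left_mono add_mono) auto
      finally show "\<bar>?G s\<bar> \<le> ?r s + K * L * \<bar>prim ?D s\<bar>"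
        by (simp add: algebra_simps)
      have ce: "continuous_on {0..s} ell" by (rule ci[OF continuous_on_ell])
      have "avg m ?r s = (K * e' * \<epsilon>) * (avg m (\<lambda>_. 1) s + bnd * avg m ell s)
          + (K * C * \<epsilon>\<^sup>2) * (avg m (\<lambda>_. 2) s + 2 * bnd\<^sup>2 * avg m (\<lambda>s. (ell s)\<^sup>2) s)"
        using s ce by (simp add: avg_add avg_cmult continuous_intros)
      also have "\<dots> \<le> (K * e' * \<epsilon>) * (1 + bnd * 1) + (K * C * \<epsilon>\<^sup>2) * (2 + 2 * bnd\<^sup>2 * 2)"
        using K C e' s bn
        by (intro add_mono mult_left_mono avg_ell_le avg_ell_sq_le avg_const_le) (auto simp: \<epsilon>_def)
      finally show "avg m ?r s \<le> K * e' * \<epsilon> * (1 + bnd) + K * C * \<epsilon>\<^sup>2 * (2 + 2 * bnd\<^sup>2 * 2)" by simp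
    qed (auto intro!: continuous_intros continuous_on_rhs continuous_on_lrhs continuous_on_ell \<kappa>
        continuous_comp_nlin continuous_on_prof continuous_on_lprof)
    also have "\<dots> \<le> (e' * q + \<epsilon> * (C * q2)) * \<epsilon>"
    proof -
      have "K * e' * \<epsilon> * (1 + bnd) \<le> K * e' * \<epsilon> * (2 * (1 + bnd))"
        using K e' bn by (intro mult_left_mono) (auto simp: \<epsilon>_def)
      then have "(K * e' * \<epsilon> * (1 + bnd) + K * C * \<epsilon>\<^sup>2 * (2 + 2 * bnd\<^sup>2 * 2)) * exp (K * L)
          \<le> (K * e' * \<epsilon> * (2 * (1 + bnd)) + K * C * \<epsilon>\<^sup>2 * (2 + 2 * bnd\<^sup>2 * 2)) * exp (K * L)"
        by (intro mult_right_mono) auto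
      then show ?thesis unfolding q_def q2_def by (simp add: algebra_simps power2_eq_square)
    qed
    also have "\<dots> \<le> (e / 2 + e / 2) * \<epsilon>"
    proof (intro mult_right_mono add_mono)
      show "e' * q \<le> e / 2" using e q by (simp add: e'_def field_simps)
      have "\<epsilon> * (C * q2) \<le> \<delta> * (C * q2)" using d Cq by (intro mult_right_mono) (auto simp: \<epsilon>_def)
      also have "\<dots> \<le> e / 2" using e Cq by (simp add: \<delta>_def divide_simps)
      finally show "\<epsilon> * (C * q2) \<le> e / 2" .
    qed (simp add: \<epsilon>_def)
    finally show ?thesis by (simp add: \<epsilon>_def)
  qed
  then show ?thesis using \<delta> by blast
qed

lemma defect_differentiable:
  assumes K: "0 \<le> K" and e: "0 < e"
  shows "\<exists>\<delta>>0. \<forall>\<kappa> b c. 0 \<le> \<kappa> \<longrightarrow> \<kappa> \<le> K \<longrightarrow> \<bar>c - b\<bar> < \<delta> \<longrightarrow>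
           \<bar>defect \<kappa> c - defect \<kappa> b - (c - b) * ldefect \<kappa> b\<bar> \<le> e * \<bar>c - b\<bar>"
proof -
  obtain \<delta> where \<delta>: "\<delta> > 0" "\<And>\<kappa> b c y. 0 \<le> \<kappa> \<Longrightarrow> \<kappa> \<le> K \<Longrightarrow> \<bar>c - b\<bar> < \<delta> \<Longrightarrow> 0 \<le> y \<Longrightarrow> y < 1 \<Longrightarrow>
           \<bar>flux \<kappa> c y - flux \<kappa> b y - (c - b) * lflux \<kappa> b y\<bar> \<le> e * \<bar>c - b\<bar>"
    using flux_differentiable[OF assms] by blast
  have "\<bar>defect \<kappa> c - defect \<kappa> b - (c - b) * ldefect \<kappa> b\<bar> \<le> e * \<bar>c - b\<bar>"
    if \<kappa>: "0 \<le> \<kappa>" "\<kappa> \<le> K" and d: "\<bar>c - b\<bar> < \<delta>" for \<kappa> b c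
    by (rule abs_le_left_limit[OF tendsto_diff[OF tendsto_diff[OF tendsto_defect[OF \<kappa>] tendsto_defect[OF \<kappa>]]
          tendsto_mult[OF tendsto_const tendsto_ldefect[OF \<kappa>]]]])
       (rule \<delta>(2)[OF \<kappa> d])
  then show ?thesis using \<delta>(1) by blast
qed

end

end

section \<open>Behaviour near the constant solution\<close>

text \<open>Differentiating the equation gives an equation for \<open>R / (1 - y)\<close> whose zeroth order
  coefficient changes sign exactly at the first eigenvalue; \<open>\<Psi>\<close> is the associated flux.\<close>

definition Psi :: "nat \<Rightarrow> (real \<Rightarrow> real) \<Rightarrow> (real \<Rightarrow> real) \<Rightarrow> real \<Rightarrow> real" where
  "Psi m G R y = y ^ Suc m * ((1 - y) * G y - (real (Suc m) - (real (Suc m) + 1) * y) * R y)"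

text \<open>Substituting \<open>y R' = G - (m + 1) R\<close> cancels every term containing
  \<open>G\<close> itself. When \<open>G\<close> depends on \<open>y\<close> through a profile with
  flux \<open>R\<close>, the term \<open>(1 - y) * G'\<close> is a multiple of \<open>R\<close> as
  well.\<close>

lemma Psi_deriv:
  assumes G: "continuous_on {0..<1} G" and R: "\<And>y. 0 \<le> y \<Longrightarrow> y < 1 \<Longrightarrow> R y = avg m G y"
    and y: "0 < y" "y < 1" and G': "(G has_real_derivative G') (at y)"
  shows "(Psi m G R has_real_derivative y ^ Suc m * ((1 - y) * G' + (real (Suc m) + 1) * R y)) (at y)"
proof -
  let ?N = "real (Suc m)"
  have "(Psi m G R has_real_derivative
      ?N * y ^ m * ((1 - y) * G y - (?N - (?N + 1) * y) * R y)
      + y ^ Suc m * (- G y + (1 - y) * G' + (?N + 1) * R y - (?N - (?N + 1) * y) * ((G y - ?N * R y) / y))) (at y)"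
    unfolding Psi_def[abs_def]
    by (rule derivative_eq_intros G' flux_deriv'[OF G R y] refl | simp del: of_nat_Suc power_Suc)+
      (simp add: algebra_simps del: of_nat_Suc)
  moreover have "?N * y ^ m * ((1 - y) * G y - (?N - (?N + 1) * y) * R y)
      + y ^ Suc m * (- G y + (1 - y) * G' + (?N + 1) * R y - (?N - (?N + 1) * y) * ((G y - ?N * R y) / y))
      = y ^ Suc m * ((1 - y) * G' + (?N + 1) * R y)"
    using y by (simp add: field_simps del: of_nat_Suc)
  ultimately show ?thesis by simp
qed

lemma continuous_on_Psi:
  assumes "continuous_on A G" "continuous_on A R"
  shows "continuous_on A (Psi m G R)"
  unfolding Psi_def[abs_def] by (intro continuous_intros assms)

lemma Psi_0: "Psi m G R 0 = 0"
  by (simp add: Psi_def)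

text \<open>At \<open>y = 1\<close> the coefficient of \<open>R\<close> becomes \<open>+1\<close>,
  and \<open>(1 - y) * G\<close> vanishes in spite of the logarithm. Since \<open>Psi\<close> starts
  from \<open>0\<close>, the defect can be computed by integrating the derivative of
  \<open>Psi\<close>.\<close>

lemma Psi_tendsto:
  assumes R: "(R \<longlongrightarrow> c) (at_left 1)"
    and G: "\<And>y. 0 \<le> y \<Longrightarrow> y < 1 \<Longrightarrow> \<bar>G y\<bar> \<le> K * (1 + ell y)"
  shows "(Psi m G R \<longlongrightarrow> c) (at_left 1)"
proof -
  have "((\<lambda>y. (1 - y) * G y) \<longlongrightarrow> 0) (at_left 1)"
  proof (rule Lim_null_comparison)
    show "\<forall>\<^sub>F y in at_left 1. norm ((1 - y) * G y) \<le> K * ((1 - y) + (1 - y) * ell y)"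
      using eventually_left_one[OF zero_less_one]
    proof eventually_elim
      case (elim y)
      have "norm ((1 - y) * G y) \<le> (1 - y) * (K * (1 + ell y))"
        unfolding real_norm_def abs_mult using elim G[of y] by (intro mult_mono) auto
      then show ?case by (simp add: algebra_simps)
    qed
    have "((\<lambda>y. K * ((1 - y) + (1 - y) * ell y)) \<longlongrightarrow> K * ((1 - 1) + 0)) (at_left 1)"
      by (intro tendsto_intros tendsto_one_minus_ell)
    then show "((\<lambda>y. K * ((1 - y) + (1 - y) * ell y)) \<longlongrightarrow> 0) (at_left 1)" by simp
  qed
  then have "(Psi m G R \<longlongrightarrow> 1 ^ Suc m * (0 - (real (Suc m) - (real (Suc m) + 1) * 1) * c)) (at_left 1)"
    unfolding Psi_def[abs_def] by (intro tendsto_intros R)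
  then show ?thesis by simp
qed

lemma quot_deriv:
  assumes G: "continuous_on {0..<1} G" and R: "\<And>y. 0 \<le> y \<Longrightarrow> y < 1 \<Longrightarrow> R y = avg m G y"
    and y: "0 < y" "y < 1"
  shows "((\<lambda>y. R y / (1 - y)) has_real_derivative Psi m G R y / (y ^ Suc (Suc m) * (1 - y)\<^sup>2)) (at y)"
proof -
  let ?N = "real (Suc m)"
  have "((\<lambda>y. R y / (1 - y)) has_real_derivative ((G y - ?N * R y) / y * (1 - y) + R y) / ((1 - y) * (1 - y))) (at y)"
    by (rule derivative_eq_intros flux_deriv'[OF G R y] refl | use y in \<open>simp del: of_nat_Suc power_Suc\<close>)+
  moreover have "((G y - ?N * R y) / y * (1 - y) + R y) / ((1 - y) * (1 - y)) = Psi m G R y / (y ^ Suc (Suc m) * (1 - y)\<^sup>2)"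
    using y by (simp add: Psi_def power2_eq_square divide_simps del: of_nat_Suc) (simp add: algebra_simps del: of_nat_Suc)
  ultimately show ?thesis by simp
qed

lemma power_prim_deriv: "((\<lambda>y. y ^ Suc k / real (Suc k)) has_real_derivative x ^ k) (at x within A)"
proof -
  have "((\<lambda>y. y ^ Suc k / real (Suc k)) has_real_derivative real (Suc k) * x ^ k / real (Suc k)) (at x within A)"
    by (auto intro!: derivative_eq_intros simp del: power_Suc of_nat_Suc)
  then show ?thesis by (simp del: power_Suc of_nat_Suc)
qed

text \<open>The primitive of \<open>(1 + ell)^2\<close> that vanishes at \<open>0\<close>. Its limit
  \<open>5 = 1 + 2 + 2\<close> at \<open>1\<close> is the total integral: \<open>ell\<close> and its
  square integrate to \<open>1\<close> and \<open>2\<close>.\<close>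

lemma ell_sq_tail_deriv:
  assumes "y < 1"
  shows "((\<lambda>y. 5 - (1 - y) * ((ell y)\<^sup>2 + 4 * ell y + 5)) has_real_derivative (1 + ell y)\<^sup>2) (at y within A)"
proof -
  have "((\<lambda>y. 5 - (1 - y) * ((ell y)\<^sup>2 + 4 * ell y + 5)) has_real_derivative
      ((ell y)\<^sup>2 + 4 * ell y + 5) - (1 - y) * (2 * ell y * (1 / (1 - y)) + 4 * (1 / (1 - y)))) (at y within A)"
    by (rule derivative_eq_intros ell_deriv[OF assms] refl | simp)+
  moreover have "x * (2 * ell y * (1 / x) + 4 * (1 / x)) = 2 * ell y + 4" if "x \<noteq> 0" for x
    using that by (simp add: field_simps)
  from this[of "1 - y"] have "(1 - y) * (2 * ell y * (1 / (1 - y)) + 4 * (1 / (1 - y))) = 2 * ell y + 4"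
    using assms by simp
  ultimately show ?thesis by (simp add: power2_eq_square algebra_simps)
qed

context shooting
begin

abbreviation "N \<equiv> real (Suc m)"

text \<open>With \<open>\<lambda> = 4 * \<kappa>\<close> and \<open>p - 1 = q - 2\<close>, this is
  the value at which \<open>\<lambda> * (q - 2)\<close> equals \<open>4 * (n + 1)\<close>, the first
  nonzero eigenvalue.\<close>

definition \<kappa>1 :: real where "\<kappa>1 = (N + 1) / (p - 1)"

lemma \<kappa>1_pos: "0 < \<kappa>1"
  using p by (simp add: \<kappa>1_def)

lemma \<kappa>1_eq: "\<kappa>1 * (p - 1) = N + 1"
  using p by (simp add: \<kappa>1_def)

lemma rhs_deriv:
  assumes "0 \<le> \<kappa>" "0 < y" "y < 1"
  shows "((\<lambda>y. \<kappa> * nlin p M (prof \<kappa> b y)) has_real_derivative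
     \<kappa> * (dnlin p M (prof \<kappa> b y) * - (flux \<kappa> b y / (1 - y)))) (at y)"
  by (rule DERIV_cmult DERIV_chain2[OF f_deriv prof_deriv[OF assms]])+

lemma flux_Psi_deriv:
  assumes "0 \<le> \<kappa>" and y: "0 < y" "y < 1"
  shows "(Psi m (\<lambda>s. \<kappa> * nlin p M (prof \<kappa> b s)) (flux \<kappa> b) has_real_derivative
     y ^ Suc m * (flux \<kappa> b y * (N + 1 - \<kappa> * dnlin p M (prof \<kappa> b y)))) (at y)"
proof -
  have eq: "(1 - y) * (\<kappa> * (dnlin p M (prof \<kappa> b y) * - (flux \<kappa> b y / (1 - y)))) + (N + 1) * flux \<kappa> b y
      = flux \<kappa> b y * (N + 1 - \<kappa> * dnlin p M (prof \<kappa> b y))"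
    using y by (simp add: field_simps)
  show ?thesis
    using Psi_deriv[OF continuous_on_rhs[OF assms(1)] flux[OF assms(1)] y rhs_deriv[OF assms, of b]]
    unfolding eq .
qed

section \<open>Linearisation at the constant \<open>1\<close>\<close>

lemma lrhs_one:
  assumes "0 \<le> \<kappa>" "0 \<le> y" "y < 1"
  shows "\<kappa> * dnlin p M (prof \<kappa> 1 y) * lprof \<kappa> 1 y = \<kappa> * (p - 1) * lprof \<kappa> 1 y"
  using assms flux_one(2)[of \<kappa> \<kappa> y] by (simp add: df_1)

lemma lflux_one:
  assumes \<kappa>: "0 \<le> \<kappa>" and y: "0 \<le> y" "y < 1"
  shows "lflux \<kappa> 1 y = avg m (\<lambda>s. \<kappa> * (p - 1) * lprof \<kappa> 1 s) y"
  unfolding lflux[OF assms] by (rule avg_cong) (use y in \<open>auto simp: lrhs_one \<kappa>\<close>)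

lemma continuous_on_lrhs_one: "0 \<le> \<kappa> \<Longrightarrow> continuous_on {0..<1} (\<lambda>s. \<kappa> * (p - 1) * lprof \<kappa> 1 s)"
  by (intro continuous_intros continuous_on_lprof)

abbreviation "Psi1 \<kappa> \<equiv> Psi m (\<lambda>s. \<kappa> * (p - 1) * lprof \<kappa> 1 s) (lflux \<kappa> 1)"

lemma Psi1_deriv:
  assumes "0 \<le> \<kappa>" and y: "0 < y" "y < 1"
  shows "(Psi1 \<kappa> has_real_derivative y ^ Suc m * ((N + 1 - \<kappa> * (p - 1)) * lflux \<kappa> 1 y)) (at y)"
proof -
  have eq: "(1 - y) * (\<kappa> * (p - 1) * - (lflux \<kappa> 1 y / (1 - y))) + (N + 1) * lflux \<kappa> 1 y
      = (N + 1 - \<kappa> * (p - 1)) * lflux \<kappa> 1 y"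
    using y by (simp add: field_simps)
  show ?thesis
    using Psi_deriv[OF continuous_on_lrhs_one[OF assms(1)] lflux_one[OF assms(1)] y DERIV_cmult[OF lprof_deriv[OF assms]]]
    unfolding eq .
qed

lemma continuous_on_Psi1: "0 \<le> \<kappa> \<Longrightarrow> continuous_on {0..<1} (Psi1 \<kappa>)"
  by (intro continuous_on_Psi continuous_on_lrhs_one continuous_on_lflux)

lemma lflux_one_0: "0 \<le> \<kappa> \<Longrightarrow> lflux \<kappa> 1 0 = \<kappa> * (p - 1) / N"
  using lflux_one[of \<kappa> 0] by (simp add: avg_at_0 lprof_0 del: of_nat_Suc)

text \<open>While the linearised flux is nonnegative, \<open>Psi1\<close> increases from
  \<open>0\<close>, and then so does the quotient of the flux by \<open>1 - y\<close>. That quotient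
  starts from a positive value, so a first point with nonpositive flux cannot exist, and the
  monotonicity holds on all of \<open>{0..<1}\<close>.\<close>

lemma lflux_one_ge:
  assumes \<kappa>: "0 < \<kappa>" "\<kappa> \<le> \<kappa>1" and y: "0 \<le> y" "y < 1"
  shows "\<kappa> * (p - 1) / N * (1 - y) \<le> lflux \<kappa> 1 y"
proof -
  let ?S = "lflux \<kappa> 1" and ?k = "\<kappa> * (p - 1)"
  have \<kappa>0: "0 \<le> \<kappa>" using \<kappa> by simp
  have k: "0 < ?k" "?k \<le> N + 1"
    using \<kappa> p mult_right_mono[OF \<kappa>(2), of "p - 1"] by (simp_all add: \<kappa>1_eq)
  have cS: "continuous_on {0..<1} ?S" by (rule continuous_on_lflux[OF \<kappa>0])
  have mono: "?k / N \<le> ?S z / (1 - z)"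
    if z: "0 \<le> z" "z < 1" and pos: "\<And>s. 0 \<le> s \<Longrightarrow> s < z \<Longrightarrow> 0 \<le> ?S s" for z
  proof -
    have Pnn: "0 \<le> Psi1 \<kappa> s" if s: "0 \<le> s" "s \<le> z" for s
    proof -
      have "Psi1 \<kappa> 0 \<le> Psi1 \<kappa> s"
      proof (rule DERIV_nonneg_imp_increasing_open[OF s(1)])
        fix x assume x: "0 < x" "x < s"
        have "0 \<le> x ^ Suc m * ((N + 1 - ?k) * ?S x)"
          using x s k pos[of x] by (intro mult_nonneg_nonneg) auto
        then show "\<exists>d. (Psi1 \<kappa> has_real_derivative d) (at x) \<and> 0 \<le> d"
          using Psi1_deriv[OF \<kappa>0, of x] x s z by auto
      qed (rule continuous_on_subinterval[OF continuous_on_Psi1[OF \<kappa>0]], use s z in simp)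
      then show ?thesis by (simp add: Psi_0)
    qed
    have "?S 0 / (1 - 0) \<le> ?S z / (1 - z)"
    proof (rule DERIV_nonneg_imp_increasing_open[OF z(1)])
      fix x assume x: "0 < x" "x < z"
      have "0 \<le> Psi1 \<kappa> x / (x ^ Suc (Suc m) * (1 - x)\<^sup>2)"
        using x Pnn[of x] by (intro divide_nonneg_nonneg mult_nonneg_nonneg) auto
      then show "\<exists>d. ((\<lambda>y. ?S y / (1 - y)) has_real_derivative d) (at x) \<and> 0 \<le> d"
        using quot_deriv[OF continuous_on_lrhs_one[OF \<kappa>0] lflux_one[OF \<kappa>0], of x] x z by auto
    qed (rule continuous_on_subinterval[OF continuous_on_quot[OF cS] z(2)])
    then show ?thesis using lflux_one_0[OF \<kappa>0] by simp
  qed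
  have pos: "0 < ?S z" if z: "0 \<le> z" "z < 1" for z
  proof (rule ccontr)
    assume neg: "\<not> 0 < ?S z"
    define A where "A = {s\<in>{0..z}. ?S s \<le> 0}"
    have "closed A" unfolding A_def
      by (rule continuous_on_closed_Collect_le[OF continuous_on_subinterval[OF cS z(2)] continuous_on_const]) simp
    moreover have "A \<subseteq> {0..z}" by (auto simp: A_def)
    ultimately have cA: "compact A" by (meson bounded_closed_interval bounded_subset compact_eq_bounded_closed)
    have "A \<noteq> {}" using neg z by (auto simp: A_def)
    from compact_attains_inf[OF cA this] obtain s where s: "s \<in> A" "\<And>t. t \<in> A \<Longrightarrow> s \<le> t"
      by blast
    have s': "0 \<le> s" "s \<le> z" "?S s \<le> 0" using s by (auto simp: A_def)
    have "0 \<le> ?S t" if t: "0 \<le> t" "t < s" for t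
    proof (rule ccontr)
      assume "\<not> 0 \<le> ?S t"
      then have "t \<in> A" using t s' by (simp add: A_def)
      then show False using s(2)[of t] t by simp
    qed
    then have "?k / N \<le> ?S s / (1 - s)" using s' z by (intro mono) auto
    moreover have "0 < ?k / N" using k by simp
    ultimately have "0 < ?S s / (1 - s)" by linarith
    then show False using s' z by (simp add: zero_less_divide_iff)
  qed
  have "?k / N \<le> ?S y / (1 - y)" using pos y by (intro mono) (auto intro: less_imp_le)
  then show ?thesis using y by (simp add: field_simps)
qed

text \<open>\<open>Psi1\<close> is integrated with the lower bound \<open>lflux_one_ge\<close>;
  \<open>1 / (N + 1) - 1 / (N + 2)\<close> is the integral of \<open>y ^ Suc m * (1 - y)\<close>.
  The explicit form gives positivity uniformly for \<open>\<kappa>\<close> in a compact subinterval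
  below \<open>\<kappa>1\<close>.\<close>

lemma ldefect_one_ge:
  assumes \<kappa>: "0 < \<kappa>" "\<kappa> \<le> \<kappa>1"
  shows "(N + 1 - \<kappa> * (p - 1)) * (\<kappa> * (p - 1) / N) * (1 / (N + 1) - 1 / (N + 2)) \<le> ldefect \<kappa> 1"
proof -
  let ?k = "\<kappa> * (p - 1)"
  let ?A = "(N + 1 - ?k) * (?k / N)"
  let ?q = "\<lambda>y. ?A * (y ^ Suc (Suc m) / real (Suc (Suc m)) - y ^ Suc (Suc (Suc m)) / real (Suc (Suc (Suc m))))"
  have \<kappa>0: "0 \<le> \<kappa>" using \<kappa> by simp
  have k: "0 < ?k" "?k \<le> N + 1"
    using \<kappa> p mult_right_mono[OF \<kappa>(2), of "p - 1"] by (simp_all add: \<kappa>1_eq)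
  have le: "?q y \<le> Psi1 \<kappa> y" if y: "0 \<le> y" "y < 1" for y
  proof -
    have "Psi1 \<kappa> 0 - ?q 0 \<le> Psi1 \<kappa> y - ?q y"
    proof (rule DERIV_nonneg_imp_increasing_open[OF y(1)])
      fix x assume x: "0 < x" "x < y"
      have "(?q has_real_derivative ?A * (x ^ Suc m - x ^ Suc (Suc m))) (at x)"
        by (intro DERIV_cmult DERIV_diff power_prim_deriv)
      also have "?A * (x ^ Suc m - x ^ Suc (Suc m)) = x ^ Suc m * ((N + 1 - ?k) * (?k / N * (1 - x)))"
      proof -
        have "a * b * (X - x * X) = X * (a * (b * (1 - x)))" for a b X :: real
          by (simp add: algebra_simps)
        then show ?thesis unfolding power_Suc[of x "Suc m"] .
      qed
      finally have q: "(?q has_real_derivative x ^ Suc m * ((N + 1 - ?k) * (?k / N * (1 - x)))) (at x)" .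
      have "x ^ Suc m * ((N + 1 - ?k) * (?k / N * (1 - x))) \<le> x ^ Suc m * ((N + 1 - ?k) * lflux \<kappa> 1 x)"
        using x y k by (intro mult_left_mono lflux_one_ge \<kappa>) auto
      then have "0 \<le> x ^ Suc m * ((N + 1 - ?k) * lflux \<kappa> 1 x) - x ^ Suc m * ((N + 1 - ?k) * (?k / N * (1 - x)))"
        by (simp only: diff_ge_0_iff_ge)
      moreover have "(Psi1 \<kappa> has_real_derivative x ^ Suc m * ((N + 1 - ?k) * lflux \<kappa> 1 x)) (at x)"
        using x y by (intro Psi1_deriv \<kappa>0) auto
      ultimately show "\<exists>d. ((\<lambda>y. Psi1 \<kappa> y - ?q y) has_real_derivative d) (at x) \<and> 0 \<le> d"
        using DERIV_diff[OF _ q] by blast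
    next
      show "continuous_on {0..y} (\<lambda>y. Psi1 \<kappa> y - ?q y)"
        by (intro continuous_intros continuous_on_subinterval[OF continuous_on_Psi1[OF \<kappa>0] y(2)]) auto
    qed
    then show ?thesis by (simp add: Psi_0)
  qed
  have P: "(Psi1 \<kappa> \<longlongrightarrow> ldefect \<kappa> 1) (at_left 1)"
  proof (rule Psi_tendsto[OF tendsto_ldefect[OF \<kappa>0 order_refl]])
    fix y :: real assume "0 \<le> y" "y < 1"
    then show "\<bar>\<kappa> * (p - 1) * lprof \<kappa> 1 y\<bar> \<le> (\<kappa> * L * (1 + bnd \<kappa>)) * (1 + ell y)"
      using lrhs_bound[OF \<kappa>0 order_refl, of y 1] by (simp add: lrhs_one \<kappa>0)
  qed
  have "(?q \<longlongrightarrow> ?A * (1 ^ Suc (Suc m) / real (Suc (Suc m)) - 1 ^ Suc (Suc (Suc m)) / real (Suc (Suc (Suc m))))) (at_left 1)"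
    by (intro tendsto_intros) auto
  moreover have "\<forall>\<^sub>F y in at_left 1. ?q y \<le> Psi1 \<kappa> y"
    using eventually_left_one[OF zero_less_one] by eventually_elim (rule le; simp)
  ultimately have "?A * (1 ^ Suc (Suc m) / real (Suc (Suc m)) - 1 ^ Suc (Suc (Suc m)) / real (Suc (Suc (Suc m)))) \<le> ldefect \<kappa> 1"
    by (intro tendsto_le[OF _ P]) auto
  then show ?thesis by simp
qed

text \<open>At \<open>\<kappa>1\<close> the derivative of \<open>Psi1\<close> vanishes identically,
  so the quotient of the flux by \<open>1 - y\<close> is constant. The corresponding profile is the
  affine first eigenfunction.\<close>

lemma lflux_kappa1:
  assumes y: "0 \<le> y" "y < 1"
  shows "lflux \<kappa>1 1 y = (N + 1) / N * (1 - y)"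
proof -
  note k0 = less_imp_le[OF \<kappa>1_pos]
  have P: "Psi1 \<kappa>1 s = 0" if s: "0 \<le> s" "s < 1" for s
  proof -
    have "Psi1 \<kappa>1 s = Psi1 \<kappa>1 0"
    proof (cases "s = 0")
      case False
      show ?thesis
      proof (rule DERIV_isconst_end[where f = "Psi1 \<kappa>1"])
        fix x assume "0 < x" "x < s"
        then show "(Psi1 \<kappa>1 has_real_derivative 0) (at x)"
          using Psi1_deriv[OF k0, of x] s by (simp add: \<kappa>1_eq)
      qed (use s False continuous_on_subinterval[OF continuous_on_Psi1[OF k0] s(2)] in auto)
    qed simp
    then show ?thesis by (simp add: Psi_0)
  qed
  have "lflux \<kappa>1 1 y / (1 - y) = lflux \<kappa>1 1 0 / (1 - 0)"
  proof (cases "y = 0")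
    case False
    show ?thesis
    proof (rule DERIV_isconst_end[where f = "\<lambda>y. lflux \<kappa>1 1 y / (1 - y)"])
      fix x assume "0 < x" "x < y"
      then show "((\<lambda>y. lflux \<kappa>1 1 y / (1 - y)) has_real_derivative 0) (at x)"
        using quot_deriv[OF continuous_on_lrhs_one[OF k0] lflux_one[OF k0], of x] y P[of x] by simp
    qed (use y False continuous_on_subinterval[OF continuous_on_quot[OF continuous_on_lflux[OF k0]] y(2)] in auto)
  qed simp
  then have "lflux \<kappa>1 1 y / (1 - y) = (N + 1) / N"
    using lflux_one_0[OF k0] unfolding \<kappa>1_eq by simp
  then show ?thesis using y by (simp add: divide_eq_eq del: of_nat_Suc)
qed

lemma lprof_kappa1:
  assumes y: "0 \<le> y" "y < 1"
  shows "lprof \<kappa>1 1 y = 1 - (N + 1) / N * y"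
proof -
  have "prim (lflux \<kappa>1 1) y = integral {0..y} (\<lambda>_. (N + 1) / N)"
    unfolding prim_def by (rule integral_cong) (use y in \<open>auto simp: lflux_kappa1\<close>)
  then show ?thesis using y by (simp add: lprof_def)
qed

text \<open>With \<open>\<rho> = (N + 1) / N\<close> and \<open>v = 1 - \<rho> * y\<close> this is
  the integral of \<open>y^N (1 - y) v\<close>. Testing the eigenvalue equation of \<open>v\<close>
  with \<open>v^2\<close> shows that it is a positive multiple of the integral of
  \<open>y^(N-1) v^3\<close>.\<close>

lemma third_moment_pos:
  assumes "1 \<le> m"
  shows "0 < 1 / (N + 1) - (1 + (N + 1) / N) / (N + 2) + (N + 1) / N / (N + 3)"
proof -
  have id: "1 / (x + 1) - (1 + (x + 1) / x) / (x + 2) + (x + 1) / x / (x + 3) = (x - 1) / (x * (x + 1) * (x + 2) * (x + 3))"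
    if "0 < x" for x :: real
    using that by (simp add: divide_simps) (simp add: algebra_simps)
  have "0 < (N - 1) / (N * (N + 1) * (N + 2) * (N + 3))"
    using assms by (intro divide_pos_pos mult_pos_pos) auto
  then show ?thesis by (subst id) auto
qed

text \<open>At the first eigenvalue the expansion of the defect starts with a negative multiple of the
  third moment of the eigenfunction, which does not vanish because the two ends differ.\<close>

lemma defect_neg:
  assumes m: "1 \<le> m" and d0: "0 < d0"
  shows "\<exists>b. 1 < b \<and> b < 1 + d0 \<and> defect \<kappa>1 b < 0"
proof -
  note k0 = less_imp_le[OF \<kappa>1_pos]
  define B where "B = bnd \<kappa>1"
  define \<rho> where "\<rho> = (N + 1) / N"
  \<comment> \<open>To leading order the defect is \<open>- A * \<epsilon>^2\<close>:
    \<open>A\<close> integrates \<open>p * (N + 1) * y ^ Suc m\<close> times the eigenfunction flux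
    \<open>\<rho> * (1 - y)\<close> times the eigenfunction \<open>1 - \<rho> * y\<close>.\<close>
  define A where "A = p * (N + 1) * \<rho> * (1 / (N + 1) - (1 + \<rho>) / (N + 2) + \<rho> / (N + 3))"
  define c2 where "c2 = \<kappa>1 * B * (1 + B)\<^sup>2"
  define c1 where "c1 = p * (N + 1) * (3 + B) + c2"
  have B: "0 \<le> B" using bnd_nonneg[OF k0] by (simp add: B_def)
  have \<rho>: "0 < \<rho>" "\<rho> \<le> 2" by (auto simp: \<rho>_def field_simps)
  have A: "0 < A"
    unfolding A_def using \<rho> p third_moment_pos[OF m] by (intro mult_pos_pos) (auto simp: \<rho>_def)
  have c2: "0 \<le> c2" using k0 B by (simp add: c2_def)
  have c1: "0 \<le> c1" using c2 p B by (simp add: c1_def)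
  define e where "e = A / (20 * (c1 + 1))"
  have e: "0 < e" using A c1 by (simp add: e_def)
  obtain C where C: "0 \<le> C"
    "\<And>k. \<bar>dnlin p M (1 + k) - (p - 1) - p * (p - 1) * k\<bar> \<le> e * \<bar>k\<bar> + C * k\<^sup>2"
    using df_taylor_1[OF e] by blast
  obtain \<delta> where \<delta>: "\<delta> > 0" "\<And>\<kappa> b c y. 0 \<le> \<kappa> \<Longrightarrow> \<kappa> \<le> \<kappa>1 \<Longrightarrow> \<bar>c - b\<bar> < \<delta> \<Longrightarrow> 0 \<le> y \<Longrightarrow> y < 1 \<Longrightarrow>
           \<bar>flux \<kappa> c y - flux \<kappa> b y - (c - b) * lflux \<kappa> b y\<bar> \<le> e * \<bar>c - b\<bar>"
    using flux_differentiable[OF k0 e] by blast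
  have Cc: "0 \<le> C * c2" using C c2 by simp
  define \<epsilon> where "\<epsilon> = min (\<delta> / 2) (min (d0 / 2) (A / (20 * (C * c2 + 1))))"
  have \<epsilon>: "0 < \<epsilon>" "\<epsilon> < \<delta>" "\<epsilon> < d0" "\<epsilon> \<le> A / (20 * (C * c2 + 1))"
    using \<delta>(1) d0 A Cc by (auto simp: \<epsilon>_def min_less_iff_disj)
  \<comment> \<open>\<open>E\<close> is the coefficient of the error \<open>(1 + ell)^2\<close>,
    whose integral over \<open>{0..<1}\<close> is \<open>5\<close>. The factors \<open>20\<close> in
    \<open>e\<close> and \<open>\<epsilon>\<close> give \<open>5 * E \<le> A / 2\<close>.\<close>
  define E where "E = e * c1 + C * \<epsilon> * c2"
  have E0: "0 \<le> E" using e c1 C \<epsilon> c2 by (simp add: E_def)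
  have E: "5 * E < A"
  proof -
    have "e * c1 \<le> A / 20" using A c1 by (simp add: e_def field_simps)
    moreover have "C * \<epsilon> * c2 \<le> A / 20"
    proof -
      have "\<epsilon> * (C * c2) \<le> A / (20 * (C * c2 + 1)) * (C * c2)" using \<epsilon> Cc by (intro mult_right_mono) auto
      also have "\<dots> \<le> A / 20" using A Cc by (simp add: field_simps)
      finally show ?thesis by (simp add: mult_ac)
    qed
    ultimately show ?thesis using A by (simp add: E_def)
  qed
  define b where "b = 1 + \<epsilon>"
  let ?R = "flux \<kappa>1 b" and ?U = "prof \<kappa>1 b"
  let ?P = "Psi m (\<lambda>s. \<kappa>1 * nlin p M (?U s)) ?R"
  \<comment> \<open>At \<open>\<kappa>1\<close> both factors on the left are of first order in
    \<open>\<epsilon>\<close>: the flux vanishes for the constant \<open>1\<close>, and so does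
    \<open>N + 1 - \<kappa>1 * (p - 1)\<close>. First order expansions of flux and profile therefore
    determine the product to second order.\<close>
  have key: "?R y * (N + 1 - \<kappa>1 * dnlin p M (?U y))
      \<le> \<epsilon>\<^sup>2 * (- (p * (N + 1) * ((\<rho> * (1 - y)) * (1 - \<rho> * y))) + E * (1 + ell y)\<^sup>2)"
    if y: "0 \<le> y" "y < 1" for y
  proof -
    define k where "k = ?U y - 1"
    define S0 where "S0 = \<rho> * (1 - y)"
    define v0 where "v0 = 1 - \<rho> * y"
    define l where "l = ell y"
    define r where "r = dnlin p M (1 + k) - (p - 1) - p * (p - 1) * k"
    have l: "0 \<le> l" using ell_nonneg[OF y] by (simp add: l_def)
    have t1: "\<bar>?R s - \<epsilon> * lflux \<kappa>1 1 s\<bar> \<le> e * \<epsilon>" if "0 \<le> s" "s < 1" for s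
      using \<delta>(2)[OF k0 order_refl, of b 1 s] that \<epsilon> flux_one(1)[OF k0 order_refl, of s] by (simp add: b_def)
    have R1: "\<bar>?R y - \<epsilon> * S0\<bar> \<le> e * \<epsilon>"
      using t1[OF y] lflux_kappa1[OF y] by (simp add: S0_def \<rho>_def)
    have R2: "\<bar>?R y\<bar> \<le> B * \<epsilon>" using flux_bound[OF k0 order_refl y, of b] \<epsilon> by (simp add: b_def B_def)
    have kb: "\<bar>k\<bar> \<le> \<epsilon> * (1 + B * l)"
    proof -
      have "\<bar>?U y - b\<bar> \<le> B * \<epsilon> * l"
        using prof_bound[OF k0 order_refl y, of b] \<epsilon> by (simp add: b_def B_def l_def)
      then show ?thesis using \<epsilon> by (simp add: k_def b_def algebra_simps)
    qed
    have kv: "\<bar>k - \<epsilon> * v0\<bar> \<le> e * \<epsilon> * l"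
    proof -
      have "prim (\<lambda>s. ?R s - \<epsilon> * lflux \<kappa>1 1 s) y = prim ?R y - \<epsilon> * prim (lflux \<kappa>1 1) y"
        unfolding prim_cmult[symmetric]
        by (rule prim_diff[OF _ _ y(2)]) (intro continuous_intros continuous_on_flux continuous_on_lflux k0)+
      moreover have "prim (lflux \<kappa>1 1) y = \<rho> * y"
        using lprof_kappa1[OF y] unfolding lprof_def \<rho>_def by linarith
      ultimately have "k - \<epsilon> * v0 = - prim (\<lambda>s. ?R s - \<epsilon> * lflux \<kappa>1 1 s) y"
        by (simp add: k_def v0_def prof_def b_def algebra_simps)
      moreover have "\<bar>prim (\<lambda>s. ?R s - \<epsilon> * lflux \<kappa>1 1 s) y\<bar> \<le> e * \<epsilon> * ell y"
        by (rule prim_le_ell[OF _ y t1]) (intro continuous_intros continuous_on_flux continuous_on_lflux k0)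
      ultimately show ?thesis by (simp add: l_def)
    qed
    have S0: "\<bar>S0\<bar> \<le> 2"
    proof -
      have "\<rho> * (1 - y) \<le> 2 * 1" using \<rho> y by (intro mult_mono) auto
      then show ?thesis using \<rho> y by (simp add: S0_def)
    qed
    have w: "1 + B * l \<le> (1 + B) * (1 + l)\<^sup>2" "(1 + B * l)\<^sup>2 \<le> (1 + B)\<^sup>2 * (1 + l)\<^sup>2"
      "1 + B * l + 2 * l \<le> (3 + B) * (1 + l)\<^sup>2"
    proof -
      have 1: "1 + B * l \<le> (1 + B) * (1 + l)" using B l by (simp add: algebra_simps)
      then show "(1 + B * l)\<^sup>2 \<le> (1 + B)\<^sup>2 * (1 + l)\<^sup>2"
        unfolding power_mult_distrib[symmetric] using B l by (intro power_mono) auto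
      have 2: "1 + l \<le> (1 + l)\<^sup>2" using l by (simp add: power2_eq_square algebra_simps)
      have "(1 + B) * (1 + l) \<le> (1 + B) * (1 + l)\<^sup>2" using 2 B by (intro mult_left_mono) auto
      with 1 show "1 + B * l \<le> (1 + B) * (1 + l)\<^sup>2" by linarith
      have "(3 + B) * (1 + l) \<le> (3 + B) * (1 + l)\<^sup>2" using 2 B by (intro mult_left_mono) auto
      moreover have "1 + B * l + 2 * l \<le> (3 + B) * (1 + l)" using B l by (simp add: algebra_simps)
      ultimately show "1 + B * l + 2 * l \<le> (3 + B) * (1 + l)\<^sup>2" by linarith
    qed
    have main: "\<bar>?R y * k - \<epsilon>\<^sup>2 * (S0 * v0)\<bar> \<le> \<epsilon>\<^sup>2 * (e * ((3 + B) * (1 + l)\<^sup>2))"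
    proof -
      have "?R y * k - \<epsilon>\<^sup>2 * (S0 * v0) = (?R y - \<epsilon> * S0) * k + \<epsilon> * S0 * (k - \<epsilon> * v0)"
        by (simp add: algebra_simps power2_eq_square)
      also have "\<bar>\<dots>\<bar> \<le> \<bar>?R y - \<epsilon> * S0\<bar> * \<bar>k\<bar> + \<epsilon> * \<bar>S0\<bar> * \<bar>k - \<epsilon> * v0\<bar>"
        using \<epsilon> by (intro order_trans[OF abs_triangle_ineq]) (simp add: abs_mult)
      also have "\<dots> \<le> (e * \<epsilon>) * (\<epsilon> * (1 + B * l)) + \<epsilon> * 2 * (e * \<epsilon> * l)"
        using R1 kb kv S0 \<epsilon> e B l by (intro add_mono mult_mono) auto
      also have "\<dots> = \<epsilon>\<^sup>2 * (e * (1 + B * l + 2 * l))" by (simp add: algebra_simps power2_eq_square)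
      also have "\<dots> \<le> \<epsilon>\<^sup>2 * (e * ((3 + B) * (1 + l)\<^sup>2))"
        using w(3) e by (intro mult_left_mono) auto
      finally show ?thesis .
    qed
    have rest: "\<bar>\<kappa>1 * (?R y * r)\<bar> \<le> \<epsilon>\<^sup>2 * ((e + C * \<epsilon>) * (c2 * (1 + l)\<^sup>2))"
    proof -
      have "\<bar>r\<bar> \<le> e * \<bar>k\<bar> + C * \<bar>k\<bar>\<^sup>2" using C(2)[of k] by (simp add: r_def)
      also have "\<dots> \<le> e * (\<epsilon> * (1 + B * l)) + C * (\<epsilon> * (1 + B * l))\<^sup>2"
        using kb e C by (intro add_mono mult_left_mono power_mono) auto
      also have "\<dots> = \<epsilon> * (e * (1 + B * l) + C * \<epsilon> * (1 + B * l)\<^sup>2)"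
        by (simp add: power_mult_distrib power2_eq_square algebra_simps)
      also have "\<dots> \<le> \<epsilon> * (e * ((1 + B)\<^sup>2 * (1 + l)\<^sup>2) + C * \<epsilon> * ((1 + B)\<^sup>2 * (1 + l)\<^sup>2))"
      proof (intro mult_left_mono add_mono)
        have "(1 + B) * (1 + l)\<^sup>2 \<le> (1 + B)\<^sup>2 * (1 + l)\<^sup>2"
          using B l by (intro mult_right_mono) (auto simp: power2_eq_square algebra_simps)
        then show "1 + B * l \<le> (1 + B)\<^sup>2 * (1 + l)\<^sup>2" using w(1) by linarith
      qed (use w(2) e \<epsilon> C in auto)
      finally have "\<bar>r\<bar> \<le> \<epsilon> * ((e + C * \<epsilon>) * ((1 + B)\<^sup>2 * (1 + l)\<^sup>2))" by (simp add: algebra_simps)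
      then have "\<kappa>1 * (\<bar>?R y\<bar> * \<bar>r\<bar>) \<le> \<kappa>1 * ((B * \<epsilon>) * (\<epsilon> * ((e + C * \<epsilon>) * ((1 + B)\<^sup>2 * (1 + l)\<^sup>2))))"
        using R2 k0 B \<epsilon> by (intro mult_left_mono mult_mono) auto
      also have "\<dots> = \<epsilon>\<^sup>2 * ((e + C * \<epsilon>) * (c2 * (1 + l)\<^sup>2))"
        by (simp add: c2_def power2_eq_square mult_ac)
      finally show ?thesis using k0 by (simp add: abs_mult)
    qed
    have kp: "\<kappa>1 * (p * (p - 1) * k) = p * (N + 1) * k"
      unfolding \<kappa>1_eq[symmetric] by (simp add: mult_ac)
    have dn: "dnlin p M (?U y) = (p - 1) + p * (p - 1) * k + r" by (simp add: r_def k_def)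
    have "N + 1 - \<kappa>1 * dnlin p M (?U y) = (N + 1) - \<kappa>1 * (p - 1) - \<kappa>1 * (p * (p - 1) * k) - \<kappa>1 * r"
      unfolding dn by (simp add: distrib_left)
    then have "?R y * (N + 1 - \<kappa>1 * dnlin p M (?U y)) = ?R y * (- (p * (N + 1) * k) - \<kappa>1 * r)"
      unfolding kp \<kappa>1_eq by simp
    also have "\<dots> = - (p * (N + 1) * (?R y * k)) - \<kappa>1 * (?R y * r)"
      by (simp only: right_diff_distrib mult_minus_right mult_ac)
    also have "\<dots> \<le> - (p * (N + 1) * (\<epsilon>\<^sup>2 * (S0 * v0) - \<epsilon>\<^sup>2 * (e * ((3 + B) * (1 + l)\<^sup>2))))
        + \<epsilon>\<^sup>2 * ((e + C * \<epsilon>) * (c2 * (1 + l)\<^sup>2))"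
    proof -
      have "\<epsilon>\<^sup>2 * (S0 * v0) - \<epsilon>\<^sup>2 * (e * ((3 + B) * (1 + l)\<^sup>2)) \<le> ?R y * k" using main by linarith
      then have "p * (N + 1) * (\<epsilon>\<^sup>2 * (S0 * v0) - \<epsilon>\<^sup>2 * (e * ((3 + B) * (1 + l)\<^sup>2))) \<le> p * (N + 1) * (?R y * k)"
        using p by (intro mult_left_mono) auto
      then show ?thesis using rest by linarith
    qed
    also have "\<dots> = \<epsilon>\<^sup>2 * (- (p * (N + 1) * (S0 * v0)) + E * (1 + l)\<^sup>2)"
    proof -
      have "- (a * (\<epsilon>\<^sup>2 * s - \<epsilon>\<^sup>2 * (e * ((3 + B) * w)))) + \<epsilon>\<^sup>2 * ((e + C * \<epsilon>) * (c2 * w))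
          = \<epsilon>\<^sup>2 * (- (a * s) + (e * (a * (3 + B) + c2) + C * \<epsilon> * c2) * w)" for a s w
        by (simp add: algebra_simps)
      then show ?thesis unfolding E_def c1_def .
    qed
    finally show ?thesis by (simp add: S0_def v0_def l_def)
  qed
  \<comment> \<open>A primitive of the bound \<open>key\<close> multiplied by
    \<open>y ^ Suc m\<close>; in the error term this weight is estimated by
    \<open>1\<close>.\<close>
  let ?q = "\<lambda>y. \<epsilon>\<^sup>2 * (- (p * (N + 1) * \<rho> * (y ^ Suc (Suc m) / real (Suc (Suc m))
      - (1 + \<rho>) * (y ^ Suc (Suc (Suc m)) / real (Suc (Suc (Suc m))))
      + \<rho> * (y ^ Suc (Suc (Suc (Suc m))) / real (Suc (Suc (Suc (Suc m)))))))
      + E * (5 - (1 - y) * ((ell y)\<^sup>2 + 4 * ell y + 5)))"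
  have qd: "(?q has_real_derivative \<epsilon>\<^sup>2 * (- (p * (N + 1) * \<rho> * (x ^ Suc m - (1 + \<rho>) * x ^ Suc (Suc m) + \<rho> * x ^ Suc (Suc (Suc m))))
      + E * (1 + ell x)\<^sup>2)) (at x within T)" if "x < 1" for x T
    by (intro DERIV_cmult DERIV_add DERIV_minus DERIV_diff power_prim_deriv ell_sq_tail_deriv that)
  have cq: "continuous_on {0..y} ?q" if "y < 1" for y
    unfolding continuous_on_eq_continuous_within using DERIV_continuous[OF qd] that by auto
  have le: "?P y \<le> ?q y" if y: "0 \<le> y" "y < 1" for y
  proof -
    have "?P y - ?q y \<le> ?P 0 - ?q 0"
    proof (rule DERIV_nonpos_imp_decreasing_open[OF y(1)])
      fix x assume x: "0 < x" "x < y"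
      let ?d = "x ^ Suc m * (?R x * (N + 1 - \<kappa>1 * dnlin p M (?U x)))"
      let ?d' = "\<epsilon>\<^sup>2 * (- (p * (N + 1) * \<rho> * (x ^ Suc m - (1 + \<rho>) * x ^ Suc (Suc m) + \<rho> * x ^ Suc (Suc (Suc m))))
        + E * (1 + ell x)\<^sup>2)"
      have X: "0 \<le> x ^ Suc m" "x ^ Suc m \<le> 1" using x y power_le_one[of x "Suc m"] by auto
      have "?d \<le> x ^ Suc m * (\<epsilon>\<^sup>2 * (- (p * (N + 1) * ((\<rho> * (1 - x)) * (1 - \<rho> * x))) + E * (1 + ell x)\<^sup>2))"
        using x y X by (intro mult_left_mono key) auto
      also have "\<dots> = \<epsilon>\<^sup>2 * (- (p * (N + 1) * \<rho> * (x ^ Suc m - (1 + \<rho>) * (x * x ^ Suc m) + \<rho> * (x * (x * x ^ Suc m)))) + x ^ Suc m * (E * (1 + ell x)\<^sup>2))"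
      proof -
        have "X * (\<epsilon>\<^sup>2 * (- (a * ((\<rho> * (1 - x)) * (1 - \<rho> * x))) + w))
          = \<epsilon>\<^sup>2 * (- (a * \<rho> * (X - (1 + \<rho>) * (x * X) + \<rho> * (x * (x * X)))) + X * w)" for X a w
          by (simp add: algebra_simps)
        then show ?thesis .
      qed
      also have "\<dots> \<le> ?d'"
      proof -
        have "x ^ Suc m * (E * (1 + ell x)\<^sup>2) \<le> 1 * (E * (1 + ell x)\<^sup>2)"
          using X E0 by (intro mult_right_mono) auto
        then show ?thesis unfolding power_Suc[of x "Suc m"] power_Suc[of x "Suc (Suc m)"]
          by (intro mult_left_mono add_left_mono) auto
      qed
      finally have "?d - ?d' \<le> 0" by (simp only: diff_le_0_iff_le)
      moreover have "(?P has_real_derivative ?d) (at x)"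
        using x y by (intro flux_Psi_deriv k0) auto
      moreover have "(?q has_real_derivative ?d') (at x)" using x y by (intro qd) auto
      ultimately show "\<exists>d. ((\<lambda>y. ?P y - ?q y) has_real_derivative d) (at x) \<and> d \<le> 0"
        using DERIV_diff by blast
    next
      show "continuous_on {0..y} (\<lambda>y. ?P y - ?q y)"
        by (intro continuous_on_diff cq y continuous_on_subinterval[OF continuous_on_Psi y(2)]
            continuous_on_rhs continuous_on_flux k0)
    qed
    then show ?thesis by (simp add: Psi_0)
  qed
  have P: "(?P \<longlongrightarrow> defect \<kappa>1 b) (at_left 1)"
  proof (rule Psi_tendsto[OF tendsto_defect[OF k0 order_refl]])
    fix y :: real assume y: "0 \<le> y" "y < 1"
    show "\<bar>\<kappa>1 * nlin p M (prof \<kappa>1 b y)\<bar> \<le> (\<kappa>1 * (L * (1 + bnd \<kappa>1) * \<bar>b - 1\<bar>)) * (1 + ell y)"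
      using mult_left_mono[OF rhs_bound[OF k0 order_refl y, of b] k0] k0 by (simp add: abs_mult mult_ac)
  qed
  \<comment> \<open>Dropping the nonnegative tail of the error term leaves a polynomial, whose limit
    at \<open>1\<close> is immediate.\<close>
  let ?q2 = "\<lambda>y. \<epsilon>\<^sup>2 * (- (p * (N + 1) * \<rho> * (y ^ Suc (Suc m) / real (Suc (Suc m))
      - (1 + \<rho>) * (y ^ Suc (Suc (Suc m)) / real (Suc (Suc (Suc m))))
      + \<rho> * (y ^ Suc (Suc (Suc (Suc m))) / real (Suc (Suc (Suc (Suc m))))))) + E * 5)"
  have "(?q2 \<longlongrightarrow> ?q2 1) (at_left 1)" by (intro tendsto_intros) auto
  moreover have "\<forall>\<^sub>F y in at_left 1. ?P y \<le> ?q2 y"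
    using eventually_left_one[OF zero_less_one]
  proof eventually_elim
    case (elim y)
    have "0 \<le> (1 - y) * ((ell y)\<^sup>2 + 4 * ell y + 5)"
      using elim ell_nonneg[of y] by (intro mult_nonneg_nonneg add_nonneg_nonneg) auto
    then have "?q y \<le> ?q2 y"
      using E0 by (intro mult_left_mono add_left_mono) auto
    then show ?case using le[of y] elim by linarith
  qed
  ultimately have "defect \<kappa>1 b \<le> ?q2 1" by (intro tendsto_le[OF _ _ P]) auto
  also have "?q2 1 = \<epsilon>\<^sup>2 * (5 * E - A)"
    unfolding A_def by (simp add: algebra_simps)
  also have "\<dots> < 0" using E \<epsilon> by (intro mult_pos_neg) auto
  finally have "defect \<kappa>1 b < 0" .
  then show ?thesis using \<epsilon> by (intro exI[of _ b]) (auto simp: b_def)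
qed

end

section \<open>Regularity at the singular orbit when the defect vanishes\<close>

text \<open>When the limit at \<open>1\<close> is \<open>0\<close>, the variation of the flux from
  \<open>y\<close> up to \<open>1\<close> bounds the flux itself, by the tail integral of
  \<open>1 + ell\<close>.\<close>

lemma flux_tail_bound:
  assumes G: "continuous_on {0..<1} G" and R: "\<And>y. 0 \<le> y \<Longrightarrow> y < 1 \<Longrightarrow> R y = avg m G y"
    and le: "\<And>y. 0 \<le> y \<Longrightarrow> y < 1 \<Longrightarrow> \<bar>G y\<bar> \<le> K * (1 + ell y)"
    and lim: "(R \<longlongrightarrow> 0) (at_left 1)" and y: "0 \<le> y" "y < 1"
  shows "\<bar>y ^ Suc m * R y\<bar> \<le> K * ltail y"
proof -
  have "((\<lambda>b. \<bar>b ^ Suc m * R b - y ^ Suc m * R y\<bar>) \<longlongrightarrow> \<bar>1 ^ Suc m * 0 - y ^ Suc m * R y\<bar>) (at_left 1)"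
    by (intro tendsto_intros lim)
  moreover have "((\<lambda>b. K * (ltail y - ltail b)) \<longlongrightarrow> K * (ltail y - 0)) (at_left 1)"
    by (intro tendsto_intros tendsto_ltail)
  moreover have "\<forall>\<^sub>F b in at_left 1. \<bar>b ^ Suc m * R b - y ^ Suc m * R y\<bar> \<le> K * (ltail y - ltail b)"
    using eventually_left_one[OF y(2)]
    by eventually_elim (rule flux_variation[OF G R le]; use y in simp)
  ultimately have "\<bar>1 ^ Suc m * 0 - y ^ Suc m * R y\<bar> \<le> K * (ltail y - 0)"
    by (intro tendsto_le[of "at_left (1::real)"]) auto
  then show ?thesis by simp
qed

text \<open>A flux of size \<open>ltail\<close> leaves, after division by \<open>1 - y\<close>, a
  derivative with only logarithmic growth. This is integrable, so the profile converges.\<close>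

lemma profile_limit:
  assumes G: "continuous_on {0..<1} G" and R: "\<And>y. 0 \<le> y \<Longrightarrow> y < 1 \<Longrightarrow> R y = avg m G y"
    and le: "\<And>y. 0 \<le> y \<Longrightarrow> y < 1 \<Longrightarrow> \<bar>G y\<bar> \<le> K * (1 + ell y)"
    and lim: "(R \<longlongrightarrow> 0) (at_left 1)"
    and u: "continuous_on {0..<1} u" "\<And>y. 0 < y \<Longrightarrow> y < 1 \<Longrightarrow> (u has_real_derivative - (R y / (1 - y))) (at y)"
  shows "\<exists>a. (u \<longlongrightarrow> a) (at_left 1)"
proof -
  have K: "0 \<le> K" using le[of 0] by simp
  \<comment> \<open>\<open>2 ^ Suc m\<close> removes the weight \<open>y ^ Suc m\<close> for
    \<open>y \<ge> 1 / 2\<close>; the other \<open>2\<close> comes from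
    \<open>ell y + 2 \<le> 2 * (1 + ell y)\<close>.\<close>
  let ?C = "2 ^ Suc m * 2 * K"
  have bd: "\<bar>R y / (1 - y)\<bar> \<le> ?C * (1 + ell y)" if y: "1 / 2 \<le> y" "y < 1" for y
  proof -
    have "(1 / 2) ^ Suc m \<le> y ^ Suc m" using y by (intro power_mono) auto
    then have "(1 / 2) ^ Suc m * \<bar>R y\<bar> \<le> y ^ Suc m * \<bar>R y\<bar>" by (intro mult_right_mono) auto
    also have "\<dots> \<le> K * ltail y"
      using flux_tail_bound[OF G R le lim, of y] y by (simp add: abs_mult)
    finally have "\<bar>R y\<bar> \<le> 2 ^ Suc m * (K * ltail y)"
      by (simp add: power_one_over field_simps)
    then have "\<bar>R y\<bar> / (1 - y) \<le> 2 ^ Suc m * (K * ltail y) / (1 - y)"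
      using y by (intro divide_right_mono) auto
    also have "\<dots> = 2 ^ Suc m * K * (ell y + 2)" using y by (simp add: ltail_def)
    also have "\<dots> \<le> 2 ^ Suc m * K * (2 * (1 + ell y))"
      using K ell_nonneg[of y] y by (intro mult_left_mono) auto
    finally show ?thesis using y by (simp add: abs_div algebra_simps)
  qed
  show ?thesis
  proof (rule left_limit_exists[where ?a0.0 = "1/2" and K = ?C])
    fix a b :: real assume ab: "1 / 2 \<le> a" "a \<le> b" "b < 1"
    show "\<bar>u b - u a\<bar> \<le> ?C * (ltail a - ltail b)"
    proof (rule log_bounded_deriv)
      show "continuous_on {a..b} u" using ab by (intro continuous_on_subset[OF u(1)]) auto
      fix y assume y: "a < y" "y < b"
      show "(u has_real_derivative - (R y / (1 - y))) (at y)" using y ab by (intro u(2)) auto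
      show "\<bar>- (R y / (1 - y))\<bar> \<le> ?C * (1 + ell y)" using bd[of y] y ab by simp
    qed (use ab in auto)
  qed (use K in auto)
qed

lemma continuous_on_extend_left:
  fixes u :: "real \<Rightarrow> real"
  assumes u: "continuous_on {0..<1} u" and a: "(u \<longlongrightarrow> a) (at_left 1)"
  shows "continuous_on {0..1} (\<lambda>y. if y < 1 then u y else a)"
  unfolding continuous_on_eq_continuous_within
proof
  fix y :: real assume y: "y \<in> {0..1}"
  let ?U = "\<lambda>y. if y < 1 then u y else a"
  show "continuous (at y within {0..1}) ?U"
  proof (cases "y < 1")
    case True
    have "(u \<longlongrightarrow> u y) (at y within {0..<1})" using u y True by (auto simp: continuous_on_def)
    moreover have "at y within {0..<1} = at y within {0..1}"
      by (rule at_within_nhd[of _ "{..<1}"]) (use y True in auto)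
    ultimately have "(u \<longlongrightarrow> ?U y) (at y within {0..1})" using True by simp
    moreover have "\<forall>\<^sub>F x in at y within {0..1}. x < 1"
      using True by (intro order_tendstoD[OF tendsto_ident_at])
    then have "\<forall>\<^sub>F x in at y within {0..1}. u x = ?U x" by eventually_elim simp
    ultimately show ?thesis unfolding continuous_within by (rule Lim_transform_eventually)
  next
    case False
    then have y1: "y = 1" using y by simp
    have "\<forall>\<^sub>F x in at_left 1. u x = ?U x"
      using eventually_left_one[OF zero_less_one] by eventually_elim simp
    then have "(?U \<longlongrightarrow> a) (at_left 1)" by (rule Lim_transform_eventually[OF a])
    then show ?thesis unfolding continuous_within y1 by (simp add: at_within_Icc_at_left)
  qed
qed

section \<open>Derivatives of the profile up to both ends\<close>

lemma deriv_chain_within: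
  fixes f g :: "real \<Rightarrow> real"
  assumes "(f has_real_derivative Da) (at (g x) within T)" "(g has_real_derivative Db) (at x within S)" "g ` S \<subseteq> T"
  shows "((\<lambda>x. f (g x)) has_real_derivative Da * Db) (at x within S)"
  using DERIV_image_chain[OF has_field_derivative_subset[OF assms(1,3)] assms(2)] by (simp add: o_def)

lemma avg_has_derivative:
  assumes H: "\<And>y. 0 \<le> y \<Longrightarrow> y \<le> 1 \<Longrightarrow> (H has_real_derivative H' y) (at y within {0..1})"
    and c: "continuous_on {0..1} H'" and y: "0 \<le> y" "y \<le> 1"
  shows "(avg m H has_real_derivative avg (Suc m) H' y) (at y within {0..1})"
proof -
  have mem: "x * t \<in> {0..1}" if "x \<in> {0..1}" "t \<in> cbox 0 1" for x t :: real
    using that by (auto intro: mult_le_one)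
  have cH: "continuous_on {0..1} H"
    unfolding continuous_on_eq_continuous_within using DERIV_continuous[OF H] by auto
  have "((\<lambda>x. integral (cbox 0 1) (\<lambda>\<sigma>. \<sigma> ^ m * H (x * \<sigma>))) has_real_derivative
      integral (cbox 0 1) (\<lambda>\<sigma>. \<sigma> ^ m * (H' (y * \<sigma>) * \<sigma>))) (at y within {0..1})"
  proof (rule leibniz_rule_field_derivative[where f = "\<lambda>x \<sigma>. \<sigma> ^ m * H (x * \<sigma>)"
        and fx = "\<lambda>x \<sigma>. \<sigma> ^ m * (H' (x * \<sigma>) * \<sigma>)"])
    fix x t :: real assume x: "x \<in> {0..1}" "t \<in> cbox 0 1"
    have "((\<lambda>x. H (x * t)) has_real_derivative H' (x * t) * t) (at x within {0..1})"
    proof (rule deriv_chain_within[where f = H and g = "\<lambda>x. x * t"])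
      show "(H has_real_derivative H' (x * t)) (at (x * t) within {0..1})"
        using mem[OF x] by (intro H) auto
      show "((\<lambda>x. x * t) has_real_derivative t) (at x within {0..1})"
        by (auto intro!: derivative_eq_intros)
      show "(\<lambda>x. x * t) ` {0..1} \<subseteq> {0..1}" using mem x by auto
    qed
    then show "((\<lambda>x. t ^ m * H (x * t)) has_real_derivative t ^ m * (H' (x * t) * t)) (at x within {0..1})"
      by (rule DERIV_cmult)
  next
    fix x :: real assume x: "x \<in> {0..1}"
    show "(\<lambda>\<sigma>. \<sigma> ^ m * H (x * \<sigma>)) integrable_on cbox 0 1"
      by (intro integrable_continuous continuous_intros continuous_on_compose2[OF cH]) (use mem[OF x] in auto)
  next
    show "continuous_on ({0..1} \<times> cbox 0 1) (\<lambda>(x, t). t ^ m * (H' (x * t) * t))"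
      unfolding split_beta
      by (intro continuous_intros continuous_on_compose2[OF c]) (use mem in auto)
  qed (use y in auto)
  moreover have "(\<lambda>\<sigma>. \<sigma> ^ m * (H' (y * \<sigma>) * \<sigma>)) = (\<lambda>\<sigma>. \<sigma> ^ Suc m * H' (y * \<sigma>))"
    by (simp add: fun_eq_iff)
  ultimately show ?thesis unfolding avg_def[abs_def] by simp
qed

lemma continuous_on_glue:
  fixes A B :: "real \<Rightarrow> real"
  assumes "continuous_on {0..<1} A" "continuous_on {0<..1} B" "A (1 / 2) = B (1 / 2)"
  shows "continuous_on {0..1} (\<lambda>y. if y \<le> 1 / 2 then A y else B y)"
proof (rule continuous_on_cases_le)
  show "continuous_on {t \<in> {0..1}. t \<le> 1 / 2} A" by (rule continuous_on_subset[OF assms(1)]) auto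
  show "continuous_on {t \<in> {0..1}. 1 / 2 \<le> t} B" by (rule continuous_on_subset[OF assms(2)]) auto
  show "A t = B t" if "t = 1 / 2" for t using assms(3) unfolding that .
qed (rule continuous_on_id)

text \<open>The derivative of the profile; the second formula integrates the equation from the end
  \<open>y = 1\<close> and is used where the first one degenerates.\<close>

definition regV :: "nat \<Rightarrow> (real \<Rightarrow> real) \<Rightarrow> real \<Rightarrow> real" where
  "regV m H y = (if y \<le> 1 / 2 then - (avg m H y / (1 - y))
     else avg 0 (\<lambda>x. (1 - x) ^ m * H (1 - x)) (1 - y) / y ^ Suc m)"

context
  fixes m :: nat and H R u :: "real \<Rightarrow> real"
  assumes H: "continuous_on {0..1} H"
    and R: "\<And>y. 0 \<le> y \<Longrightarrow> y < 1 \<Longrightarrow> R y = avg m H y"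
    and lim: "(R \<longlongrightarrow> 0) (at_left 1)"
begin

abbreviation (input) "G2 \<equiv> \<lambda>x. (1 - x) ^ m * H (1 - x)"

lemma H_sub: "continuous_on {0..<1} H"
  by (rule continuous_on_subset[OF H]) auto

lemma continuous_on_reflect: "continuous_on {0..1} G2"
  by (intro continuous_intros continuous_on_compose2[OF H]) auto

text \<open>The flux equation integrated backwards from \<open>y = 1\<close>, where the flux
  vanishes. After reflection the integral is again \<open>y\<close> times an average, and the
  resulting factor \<open>1 - y\<close> cancels the pole in
  \<open>U' = - R / (1 - y)\<close>.\<close>

lemma reflected_flux:
  assumes y: "0 < y" "y < 1"
  shows "y ^ Suc m * R y = - ((1 - y) * avg 0 G2 (1 - y))"
proof -
  let ?I = "\<lambda>y. integral {0..1 - y} G2"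
  have I: "(1 - z) * avg 0 G2 (1 - z) = ?I z" if "0 \<le> z" "z \<le> 1" for z
    using power_times_avg[of "1 - z" G2 0] that continuous_on_subset[OF continuous_on_reflect, of "{0..1 - z}"] by auto
  let ?D = "\<lambda>y. y ^ Suc m * R y + ?I y"
  have Id: "(?I has_real_derivative - (z ^ m * H z)) (at z within {0..1})" if "0 \<le> z" "z \<le> 1" for z
  proof -
    have "((\<lambda>x. integral {0..x} G2) has_real_derivative G2 (1 - z)) (at (1 - z) within {0..1})"
      using that by (intro integral_has_real_derivative continuous_on_reflect) auto
    moreover have "((\<lambda>z. 1 - z) has_real_derivative - 1) (at z within {0..1})"
      by (auto intro!: derivative_eq_intros)
    ultimately show ?thesis
      using deriv_chain_within[where g = "\<lambda>z. 1 - z" and x = z and S = "{0..1}" and T = "{0..1}"] by fastforce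
  qed
  have Dd: "(?D has_real_derivative 0) (at z)" if z: "0 < z" "z < 1" for z
  proof -
    have "at z within {0..1} = at z" using z by (intro at_within_interior) (simp add: interior_atLeastAtMost_real)
    then show ?thesis
      using DERIV_add[OF flux_deriv[OF H_sub R z] , of ?I "- (z ^ m * H z)"] Id[of z] z by simp
  qed
  have eq: "?D z = ?D y" if z: "y < z" "z < 1" for z
  proof (rule DERIV_isconst_end[where f = ?D])
    show "continuous_on {y..z} ?D"
      using Dd y z by (intro continuous_at_imp_continuous_on ballI DERIV_isCont[OF Dd]) auto
    show "(?D has_real_derivative 0) (at x)" if "y < x" "x < z" for x using Dd that y z by auto
  qed (use z in auto)
  have "continuous_on {0..1} ?I"
    unfolding continuous_on_eq_continuous_within using DERIV_continuous[OF Id] by auto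
  then have "(?I \<longlongrightarrow> ?I 1) (at 1 within {0..1})"
    unfolding continuous_on_def by (rule bspec) simp
  then have "(?I \<longlongrightarrow> 0) (at_left 1)"
    by (simp add: at_within_Icc_at_left)
  then have "(?D \<longlongrightarrow> 1 ^ Suc m * 0 + 0) (at_left 1)"
    by (intro tendsto_intros lim)
  moreover have "(?D \<longlongrightarrow> ?D y) (at_left 1)"
    by (rule tendsto_eventually) (use eventually_left_one[OF y(2)] eq in \<open>auto elim!: eventually_mono\<close>)
  ultimately have "?D y = 1 ^ Suc m * 0 + 0"
    by (intro tendsto_unique[of "at_left (1::real)"]) auto
  then show ?thesis using I[of y] y by simp
qed

lemma regV_left: "0 \<le> y \<Longrightarrow> y < 1 \<Longrightarrow> regV m H y = - (avg m H y / (1 - y))"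
proof (cases "y \<le> 1 / 2")
  case False
  assume y: "0 \<le> y" "y < 1"
  then have "avg 0 G2 (1 - y) / y ^ Suc m = - (avg m H y / (1 - y))"
    using reflected_flux[of y] False by (simp add: R field_simps)
  then show ?thesis using False by (simp add: regV_def)
qed (simp add: regV_def)

lemma regV_right: "0 < y \<Longrightarrow> y \<le> 1 \<Longrightarrow> regV m H y = avg 0 G2 (1 - y) / y ^ Suc m"
proof (cases "y \<le> 1 / 2")
  case True
  assume y: "0 < y"
  then have "avg 0 G2 (1 - y) / y ^ Suc m = - (avg m H y / (1 - y))"
    using reflected_flux[of y] True by (simp add: R field_simps)
  then show ?thesis using True by (simp add: regV_def)
qed (simp add: regV_def)

lemma continuous_on_regV: "continuous_on {0..1} (regV m H)"
  unfolding regV_def[abs_def]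
proof (rule continuous_on_glue)
  show "continuous_on {0..<1} (\<lambda>y. - (avg m H y / (1 - y)))"
    by (intro continuous_intros continuous_on_avg H_sub) auto
  have "continuous_on {0..1} (avg 0 G2)"
    by (rule continuous_on_avg_param[OF continuous_on_reflect]) (auto intro: mult_le_one)
  then have "continuous_on {0<..1} (\<lambda>y. avg 0 G2 (1 - y))"
    by (rule continuous_on_compose2) (auto intro!: continuous_intros)
  then show "continuous_on {0<..1} (\<lambda>y. avg 0 G2 (1 - y) / y ^ Suc m)"
    by (intro continuous_on_divide continuous_on_power continuous_on_id) auto
  show "- (avg m H (1 / 2) / (1 - 1 / 2)) = avg 0 G2 (1 - 1 / 2) / (1 / 2) ^ Suc m"
    using regV_left[of "1 / 2"] regV_right[of "1 / 2"] by simp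
qed

text \<open>\<open>regV\<close> is continuous on the closed interval and equals the derivative
  inside, so \<open>u\<close> is its integral; the one-sided derivatives at the ends follow from the
  fundamental theorem.\<close>

lemma profile_deriv:
  assumes u: "continuous_on {0..1} u"
    and u': "\<And>y. 0 < y \<Longrightarrow> y < 1 \<Longrightarrow> (u has_real_derivative - (R y / (1 - y))) (at y)"
    and y: "0 \<le> y" "y \<le> 1"
  shows "(u has_real_derivative regV m H y) (at y within {0..1})"
proof -
  have eq: "u z = u 0 + integral {0..z} (regV m H)" if z: "z \<in> {0..1}" for z
  proof -
    have "(regV m H has_integral u z - u 0) {0..z}"
    proof (rule fundamental_theorem_of_calculus_interior)
      show "continuous_on {0..z} u" using z by (intro continuous_on_subset[OF u]) auto
      fix x assume x: "x \<in> {0<..<z}"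
      then show "(u has_vector_derivative regV m H x) (at x)"
        using u'[of x] z regV_left[of x] by (simp add: R has_real_derivative_iff_has_vector_derivative)
    qed (use z in auto)
    then show ?thesis by (simp add: integral_unique)
  qed
  have "((\<lambda>z. u 0 + integral {0..z} (regV m H)) has_real_derivative 0 + regV m H y) (at y within {0..1})"
    by (intro DERIV_add DERIV_const integral_has_real_derivative continuous_on_regV) (use y in auto)
  then have "((\<lambda>z. u 0 + integral {0..z} (regV m H)) has_real_derivative regV m H y) (at y within {0..1})"
    by simp
  then show ?thesis
    by (rule has_field_derivative_transform_within[OF _ zero_less_one]) (use y in \<open>auto simp: eq[symmetric]\<close>)
qed

text \<open>Each formula for \<open>regV\<close> is differentiated on the side where it is regular.
  The equation is verified in the open interval through \<open>Psi\<close> and extends to the ends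
  by continuity; there the second order term drops out and it becomes the boundary
  condition.\<close>

lemma regV_deriv:
  assumes H': "\<And>y. 0 \<le> y \<Longrightarrow> y \<le> 1 \<Longrightarrow> (H has_real_derivative H' y) (at y within {0..1})"
    and c: "continuous_on {0..1} H'"
  shows "\<exists>V'. continuous_on {0..1} V' \<and> (\<forall>y\<in>{0..1}. (regV m H has_real_derivative V' y) (at y within {0..1})) \<and>
     (\<forall>y\<in>{0..1}. y * (1 - y) * V' y + (real (Suc m) - (real (Suc m) + 1) * y) * regV m H y + H y = 0)"
proof -
  let ?N = "real (Suc m)"
  define G2' where "G2' x = - (real m * (1 - x) ^ (m - 1) * H (1 - x) + (1 - x) ^ m * H' (1 - x))" for x
  have cG2': "continuous_on {0..1} G2'"
    unfolding G2'_def[abs_def]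
    by (intro continuous_intros continuous_on_compose2[OF H] continuous_on_compose2[OF c]) auto
  have dG2: "(G2 has_real_derivative G2' x) (at x within {0..1})" if x: "0 \<le> x" "x \<le> 1" for x
  proof -
    have "((\<lambda>x. H (1 - x)) has_real_derivative H' (1 - x) * (- 1)) (at x within {0..1})"
      by (rule deriv_chain_within[where f = H and g = "\<lambda>x. 1 - x", OF H']) (use x in \<open>auto intro!: derivative_eq_intros\<close>)
    then show ?thesis
      by (auto intro!: derivative_eq_intros simp: G2'_def algebra_simps)
  qed
  define D1 where "D1 y = - ((avg (Suc m) H' y * (1 - y) + avg m H y) / ((1 - y) * (1 - y)))" for y
  define D2 where "D2 y = ((avg 1 G2' (1 - y) * (- 1)) * y ^ Suc m - avg 0 G2 (1 - y) * (?N * y ^ m)) / (y ^ Suc m * y ^ Suc m)" for y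
  have d1: "(regV m H has_real_derivative D1 y) (at y within {0..1})" if y: "0 \<le> y" "y < 1" for y
  proof (rule has_field_derivative_transform_within)
    show "((\<lambda>y. - (avg m H y / (1 - y))) has_real_derivative D1 y) (at y within {0..1})"
      unfolding D1_def using y
      by (auto intro!: derivative_eq_intros avg_has_derivative[OF H' c])
    show "0 < 1 - y" using y by simp
    show "- (avg m H x / (1 - x)) = regV m H x" if "x \<in> {0..1}" "dist x y < 1 - y" for x
      using that regV_left[of x] by (auto simp: dist_real_def)
  qed (use y in auto)
  have d2: "(regV m H has_real_derivative D2 y) (at y within {0..1})" if y: "0 < y" "y \<le> 1" for y
  proof (rule has_field_derivative_transform_within)
    have "((\<lambda>y. avg 0 G2 (1 - y)) has_real_derivative avg 1 G2' (1 - y) * (- 1)) (at y within {0..1})"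
      using y by (intro deriv_chain_within[where f = "avg 0 G2" and g = "\<lambda>x. 1 - x" and T = "{0..1}"])
        (auto intro!: derivative_eq_intros avg_has_derivative[OF dG2 cG2', where m = 0, simplified])
    then show "((\<lambda>y. avg 0 G2 (1 - y) / y ^ Suc m) has_real_derivative D2 y) (at y within {0..1})"
      unfolding D2_def using y
      by (intro DERIV_divide) (auto intro!: derivative_eq_intros simp del: power_Suc of_nat_Suc)
    show "0 < y" by fact
    show "avg 0 G2 (1 - x) / x ^ Suc m = regV m H x" if "x \<in> {0..1}" "dist x y < y" for x
      using that regV_right[of x] by (auto simp: dist_real_def)
  qed (use y in auto)
  have int: "at y within {0..1} = at y" if "0 < y" "y < 1" for y :: real
    using that by (intro at_within_interior) (simp add: interior_atLeastAtMost_real)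
  have D12: "D1 y = D2 y" if y: "0 < y" "y < 1" for y
    using d1[of y] d2[of y] y int[OF y] by (auto intro: DERIV_unique)
  \<comment> \<open>Both expressions are derivatives of the same function \<open>regV\<close> on the
    open interval, so they match at the gluing point \<open>1 / 2\<close>.\<close>
  define V' where "V' y = (if y \<le> 1 / 2 then D1 y else D2 y)" for y
  have cV: "continuous_on {0..1} V'"
    unfolding V'_def[abs_def]
  proof (rule continuous_on_glue)
    have "continuous_on {0..<1} H'" by (rule continuous_on_subset[OF c]) auto
    then show "continuous_on {0..<1} D1"
      unfolding D1_def[abs_def] by (intro continuous_intros continuous_on_avg H_sub) auto
    have "continuous_on {0..1} (avg 0 G2)"
      by (rule continuous_on_avg_param[OF continuous_on_reflect]) (auto intro: mult_le_one)
    then have c1: "continuous_on {0<..1} (\<lambda>y. avg 0 G2 (1 - y))"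
      by (rule continuous_on_compose2) (auto intro!: continuous_intros)
    have "continuous_on {0..1} (avg 1 G2')"
      by (rule continuous_on_avg_param[OF cG2']) (auto intro: mult_le_one)
    then have c2: "continuous_on {0<..1} (\<lambda>y. avg 1 G2' (1 - y))"
      by (rule continuous_on_compose2) (auto intro!: continuous_intros)
    show "continuous_on {0<..1} D2"
      unfolding D2_def[abs_def] by (intro continuous_intros c1 c2) auto
    show "D1 (1 / 2) = D2 (1 / 2)" by (intro D12) auto
  qed
  have dV: "(regV m H has_real_derivative V' y) (at y within {0..1})" if "y \<in> {0..1}" for y
    using d1[of y] d2[of y] that by (auto simp: V'_def)
  let ?Z = "\<lambda>y. y * (1 - y) * V' y + (?N - (?N + 1) * y) * regV m H y + H y"
  have ode: "?Z y = 0" if y: "y \<in> {0<..<1}" for y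
  proof -
    have y': "0 < y" "y < 1" using y by auto
    have "((\<lambda>y. R y / (1 - y)) has_real_derivative Psi m H R y / (y ^ Suc (Suc m) * (1 - y)\<^sup>2)) (at y)"
      by (rule quot_deriv[OF H_sub R y'])
    then have "((\<lambda>y. - (R y / (1 - y))) has_real_derivative - (Psi m H R y / (y ^ Suc (Suc m) * (1 - y)\<^sup>2))) (at y)"
      by (rule DERIV_minus)
    moreover have "\<forall>\<^sub>F x in nhds y. x \<in> {0<..<1}"
      using y by (intro eventually_nhds_in_open) auto
    then have "\<forall>\<^sub>F x in nhds y. - (R x / (1 - x)) = regV m H x"
      by eventually_elim (simp add: regV_left R)
    ultimately have "(regV m H has_real_derivative - (Psi m H R y / (y ^ Suc (Suc m) * (1 - y)\<^sup>2))) (at y)"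
      by (subst (asm) DERIV_cong_ev[OF refl _ refl]) auto
    then have V': "V' y = - (Psi m H R y / (y ^ Suc (Suc m) * (1 - y)\<^sup>2))"
      using dV[of y] y int[OF y'] by (auto intro: DERIV_unique)
    have "y * (1 - y) * V' y = - ((1 - y) * H y - (?N - (?N + 1) * y) * R y) / (1 - y)"
      unfolding V' Psi_def using y' by (simp add: power2_eq_square minus_divide_left del: of_nat_Suc)
    also have "\<dots> = - H y + (?N - (?N + 1) * y) * (R y / (1 - y))"
    proof -
      have "- (x * h - a * r) / x = - h + a * (r / x)" if "x \<noteq> 0" for x h a r :: real
        using that by (simp add: field_simps)
      then show ?thesis using y' by simp
    qed
    finally show ?thesis using y' by (simp add: regV_left R)
  qed
  have "?Z y = 0" if "y \<in> {0..1}" for y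
  proof (rule continuous_constant_on_closure[of "{0<..<1}" ?Z])
    show "continuous_on (closure {0<..<1}) ?Z"
      by (simp only: closure_greaterThanLessThan zero_less_one) (intro continuous_intros cV continuous_on_regV H)
  qed (use that ode in auto)
  then show ?thesis using cV dV by blast
qed

end

section \<open>Classical solutions from vanishing defects\<close>

context shooting
begin

text \<open>The equation is required at the end points too, where it reads as the regularity
  condition linking \<open>V\<close> to \<open>U\<close>.\<close>

definition regsol :: "real \<Rightarrow> real \<Rightarrow> (real \<Rightarrow> real) \<Rightarrow> (real \<Rightarrow> real) \<Rightarrow> (real \<Rightarrow> real) \<Rightarrow> bool" where
  "regsol \<kappa> b U V W \<longleftrightarrow> continuous_on {0..1} U \<and> continuous_on {0..1} V \<and> continuous_on {0..1} W \<and> U 0 = b \<and>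
     (\<forall>y\<in>{0..1}. (U has_real_derivative V y) (at y within {0..1})) \<and>
     (\<forall>y\<in>{0..1}. (V has_real_derivative W y) (at y within {0..1})) \<and>
     (\<forall>y\<in>{0..1}. y * (1 - y) * W y + (N - (N + 1) * y) * V y + \<kappa> * nlin p M (U y) = 0)"

lemma regsol_exists:
  assumes \<kappa>: "0 \<le> \<kappa>" and defect: "defect \<kappa> b = 0"
  shows "\<exists>U V W. regsol \<kappa> b U V W \<and> (\<forall>y\<in>{0..<1}. U y = prof \<kappa> b y)"
proof -
  let ?G = "\<lambda>y. \<kappa> * nlin p M (prof \<kappa> b y)"
  have lim: "(flux \<kappa> b \<longlongrightarrow> 0) (at_left 1)" using tendsto_defect[OF \<kappa> order_refl, of b] defect by simp
  have "\<exists>a. (prof \<kappa> b \<longlongrightarrow> a) (at_left 1)"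
  proof (rule profile_limit[OF continuous_on_rhs[OF \<kappa>, of b] flux[OF \<kappa>] _ lim continuous_on_prof[OF \<kappa>] prof_deriv[OF \<kappa>]])
    fix y :: real assume y: "0 \<le> y" "y < 1"
    show "\<bar>?G y\<bar> \<le> (\<kappa> * (L * (1 + bnd \<kappa>) * \<bar>b - 1\<bar>)) * (1 + ell y)"
      using mult_left_mono[OF rhs_bound[OF \<kappa> order_refl y, of b] \<kappa>] \<kappa> by (simp add: abs_mult mult_ac)
  qed
  then obtain a where a: "(prof \<kappa> b \<longlongrightarrow> a) (at_left 1)" by blast
  define U where "U y = (if y < 1 then prof \<kappa> b y else a)" for y
  have U: "U y = prof \<kappa> b y" if "y < 1" for y using that by (simp add: U_def)
  have cU: "continuous_on {0..1} U"
    unfolding U_def[abs_def] by (rule continuous_on_extend_left[OF continuous_on_prof[OF \<kappa>] a])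
  let ?H = "\<lambda>y. \<kappa> * nlin p M (U y)"
  have cH: "continuous_on {0..1} ?H" by (intro continuous_intros continuous_comp_nlin cU)
  have R: "flux \<kappa> b y = avg m ?H y" if "0 \<le> y" "y < 1" for y
    unfolding flux[OF \<kappa> that] using that by (intro avg_cong) (auto simp: U)
  have U': "(U has_real_derivative - (flux \<kappa> b y / (1 - y))) (at y)" if y: "0 < y" "y < 1" for y
  proof -
    have "\<forall>\<^sub>F x in nhds y. x \<in> {..<1}" using y by (intro eventually_nhds_in_open) auto
    then have "\<forall>\<^sub>F x in nhds y. prof \<kappa> b x = U x" by eventually_elim (simp add: U)
    then show ?thesis using prof_deriv[OF \<kappa> y, of b] by (simp add: DERIV_cong_ev[OF refl _ refl])
  qed
  let ?V = "regV m ?H"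
  have dU: "(U has_real_derivative ?V y) (at y within {0..1})" if "0 \<le> y" "y \<le> 1" for y
    by (rule profile_deriv[OF cH R lim cU U' that])
  have cV: "continuous_on {0..1} ?V" by (rule continuous_on_regV[OF cH R lim])
  have "\<exists>V'. continuous_on {0..1} V' \<and> (\<forall>y\<in>{0..1}. (?V has_real_derivative V' y) (at y within {0..1})) \<and>
     (\<forall>y\<in>{0..1}. y * (1 - y) * V' y + (N - (N + 1) * y) * ?V y + ?H y = 0)"
  proof (rule regV_deriv[OF cH R lim])
    fix y :: real assume "0 \<le> y" "y \<le> 1"
    then show "(?H has_real_derivative \<kappa> * (dnlin p M (U y) * ?V y)) (at y within {0..1})"
      by (intro DERIV_cmult DERIV_chain'[OF dU f_deriv])
  next
    show "continuous_on {0..1} (\<lambda>y. \<kappa> * (dnlin p M (U y) * ?V y))"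
      by (intro continuous_intros continuous_comp_nlin cU cV)
  qed
  then obtain W where W: "continuous_on {0..1} W" "\<forall>y\<in>{0..1}. (?V has_real_derivative W y) (at y within {0..1})"
     "\<forall>y\<in>{0..1}. y * (1 - y) * W y + (N - (N + 1) * y) * ?V y + ?H y = 0" by blast
  have "regsol \<kappa> b U ?V W"
    unfolding regsol_def using cU cV W dU by (auto simp: U prof_0)
  then show ?thesis using U by (intro exI conjI) auto
qed

text \<open>A C^2 solution needs a C^1 right hand side. The strict bounds on \<open>U\<close> keep
  \<open>dnlin\<close> where it is differentiable: it has a corner at \<open>M\<close>, and for
  \<open>p \<le> 2\<close> it is not differentiable at \<open>0\<close>.\<close>

lemma lregsol_exists:
  assumes \<kappa>: "0 \<le> \<kappa>" and sol: "regsol \<kappa> b U V W" and eq: "\<forall>y\<in>{0..<1}. U y = prof \<kappa> b y"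
    and pos: "\<And>y. 0 \<le> y \<Longrightarrow> y \<le> 1 \<Longrightarrow> 0 < U y \<and> U y < M"
    and defect: "ldefect \<kappa> b = 0"
  shows "\<exists>v v1 v2. continuous_on {0..1} v2 \<and> v 0 = 1 \<and>
     (\<forall>y\<in>{0..1}. (v has_real_derivative v1 y) (at y within {0..1})) \<and>
     (\<forall>y\<in>{0..1}. (v1 has_real_derivative v2 y) (at y within {0..1})) \<and>
     (\<forall>y\<in>{0..1}. y * (1 - y) * v2 y + (N - (N + 1) * y) * v1 y + \<kappa> * dnlin p M (U y) * v y = 0)"
proof -
  have lim: "(lflux \<kappa> b \<longlongrightarrow> 0) (at_left 1)" using tendsto_ldefect[OF \<kappa> order_refl, of b] defect by simp
  have cU: "continuous_on {0..1} U" and cV: "continuous_on {0..1} V"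
    and dU: "\<And>y. 0 \<le> y \<Longrightarrow> y \<le> 1 \<Longrightarrow> (U has_real_derivative V y) (at y within {0..1})"
    using sol by (auto simp: regsol_def)
  have "\<exists>a. (lprof \<kappa> b \<longlongrightarrow> a) (at_left 1)"
    by (rule profile_limit[OF continuous_on_lrhs[OF \<kappa>, of b] lflux[OF \<kappa>] lrhs_bound[OF \<kappa> order_refl] lim
          continuous_on_lprof[OF \<kappa>] lprof_deriv[OF \<kappa>]])
  then obtain a where a: "(lprof \<kappa> b \<longlongrightarrow> a) (at_left 1)" by blast
  define v where "v y = (if y < 1 then lprof \<kappa> b y else a)" for y
  have v: "v y = lprof \<kappa> b y" if "y < 1" for y using that by (simp add: v_def)
  have cv: "continuous_on {0..1} v"
    unfolding v_def[abs_def] by (rule continuous_on_extend_left[OF continuous_on_lprof[OF \<kappa>] a])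
  let ?H = "\<lambda>y. \<kappa> * dnlin p M (U y) * v y"
  have cH: "continuous_on {0..1} ?H" by (intro continuous_intros continuous_comp_nlin cU cv)
  have R: "lflux \<kappa> b y = avg m ?H y" if "0 \<le> y" "y < 1" for y
    unfolding lflux[OF \<kappa> that] using that eq by (intro avg_cong) (auto simp: v)
  have v': "(v has_real_derivative - (lflux \<kappa> b y / (1 - y))) (at y)" if y: "0 < y" "y < 1" for y
  proof -
    have "\<forall>\<^sub>F x in nhds y. x \<in> {..<1}" using y by (intro eventually_nhds_in_open) auto
    then have "\<forall>\<^sub>F x in nhds y. lprof \<kappa> b x = v x" by eventually_elim (simp add: v)
    then show ?thesis using lprof_deriv[OF \<kappa> y, of b] by (simp add: DERIV_cong_ev[OF refl _ refl])
  qed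
  let ?v1 = "regV m ?H"
  have dv: "(v has_real_derivative ?v1 y) (at y within {0..1})" if "0 \<le> y" "y \<le> 1" for y
    by (rule profile_deriv[OF cH R lim cv v' that])
  have cv1: "continuous_on {0..1} ?v1" by (rule continuous_on_regV[OF cH R lim])
  let ?H' = "\<lambda>y. \<kappa> * (p * ((p - 1) * U y powr (p - 2))) * V y * v y + \<kappa> * dnlin p M (U y) * ?v1 y"
  have "\<exists>V'. continuous_on {0..1} V' \<and> (\<forall>y\<in>{0..1}. (?v1 has_real_derivative V' y) (at y within {0..1})) \<and>
     (\<forall>y\<in>{0..1}. y * (1 - y) * V' y + (N - (N + 1) * y) * ?v1 y + ?H y = 0)"
  proof (rule regV_deriv[OF cH R lim])
    fix y :: real assume y: "0 \<le> y" "y \<le> 1"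
    have d: "(dnlin p M has_real_derivative p * ((p - 1) * U y powr (p - 2))) (at (U y))"
    proof -
      have "((\<lambda>u. p * u powr (p - 1) - 1) has_real_derivative p * ((p - 1) * U y powr (p - 1 - 1))) (at (U y))"
        using pos[OF y] by (auto intro!: derivative_eq_intros)
      moreover have "\<forall>\<^sub>F u in nhds (U y). u \<in> {0<..<M}"
        using pos[OF y] by (intro eventually_nhds_in_open) auto
      then have "\<forall>\<^sub>F u in nhds (U y). p * u powr (p - 1) - 1 = dnlin p M u"
        by eventually_elim (simp add: df_powr)
      ultimately show ?thesis by (simp add: DERIV_cong_ev[OF refl _ refl])
    qed
    show "(?H has_real_derivative ?H' y) (at y within {0..1})"
      by (rule derivative_eq_intros DERIV_chain'[OF dU d] dv refl y | simp)+
  next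
    show "continuous_on {0..1} ?H'"
      by (intro continuous_intros continuous_comp_nlin cU cV cv cv1) (use pos in force)
  qed
  then obtain v2 where v2: "continuous_on {0..1} v2" "\<forall>y\<in>{0..1}. (?v1 has_real_derivative v2 y) (at y within {0..1})"
     "\<forall>y\<in>{0..1}. y * (1 - y) * v2 y + (N - (N + 1) * y) * ?v1 y + ?H y = 0" by blast
  show ?thesis
    by (rule exI[where x = v], rule exI[where x = ?v1], rule exI[where x = v2])
       (use v2 dv v[of 0] lprof_0[of \<kappa> b] in \<open>simp del: of_nat_Suc\<close>)
qed

end

section \<open>A priori estimates\<close>

lemma deriv_compare:
  fixes \<phi> \<psi> :: "real \<Rightarrow> real"
  assumes "a \<le> b" "continuous_on {a..b} \<phi>" "continuous_on {a..b} \<psi>"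
    and d: "\<And>x. a < x \<Longrightarrow> x < b \<Longrightarrow> (\<phi> has_real_derivative \<phi>' x) (at x)"
      "\<And>x. a < x \<Longrightarrow> x < b \<Longrightarrow> (\<psi> has_real_derivative \<psi>' x) (at x)"
    and le: "\<And>x. a < x \<Longrightarrow> x < b \<Longrightarrow> \<phi>' x \<le> \<psi>' x"
  shows "\<phi> b - \<phi> a \<le> \<psi> b - \<psi> a"
proof -
  have "\<psi> a - \<phi> a \<le> \<psi> b - \<phi> b"
  proof (rule DERIV_nonneg_imp_increasing_open[OF assms(1)])
    fix x assume "a < x" "x < b"
    then show "\<exists>y. ((\<lambda>x. \<psi> x - \<phi> x) has_real_derivative y) (at x) \<and> 0 \<le> y"
      using DERIV_diff[OF d(2) d(1)] le by (meson diff_ge_0_iff_ge)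
  qed (intro continuous_intros assms)
  then show ?thesis by simp
qed

lemma deriv_compare_linear:
  fixes \<phi> :: "real \<Rightarrow> real"
  assumes "a \<le> b" "continuous_on {a..b} \<phi>"
    and d: "\<And>x. a < x \<Longrightarrow> x < b \<Longrightarrow> (\<phi> has_real_derivative \<phi>' x) (at x)"
    and le: "\<And>x. a < x \<Longrightarrow> x < b \<Longrightarrow> \<phi>' x \<le> c"
  shows "\<phi> b - \<phi> a \<le> c * (b - a)"
  using deriv_compare[OF assms(1,2), of "\<lambda>x. c * x" \<phi>' "\<lambda>_. c"] d le
  by (auto intro!: continuous_intros derivative_eq_intros simp: right_diff_distrib)

lemma deriv_compare_power:
  fixes \<phi> :: "real \<Rightarrow> real"
  assumes "a \<le> b" "continuous_on {a..b} \<phi>"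
    and d: "\<And>x. a < x \<Longrightarrow> x < b \<Longrightarrow> (\<phi> has_real_derivative \<phi>' x) (at x)"
    and le: "\<And>x. a < x \<Longrightarrow> x < b \<Longrightarrow> \<phi>' x \<le> c * x ^ m"
  shows "\<phi> b - \<phi> a \<le> c * (b ^ Suc m / real (Suc m)) - c * (a ^ Suc m / real (Suc m))"
  by (rule deriv_compare[OF assms(1,2) _ d DERIV_cmult[OF power_prim_deriv] le])
     (auto intro!: continuous_intros)

context shooting
begin

context
  fixes \<kappa> b :: real and U V W :: "real \<Rightarrow> real"
  assumes m: "1 \<le> m" and \<kappa>: "0 < \<kappa>" and b: "1 \<le> b" and sol: "regsol \<kappa> b U V W"
begin

lemma reg_cont: "A \<subseteq> {0..1} \<Longrightarrow> continuous_on A U" "A \<subseteq> {0..1} \<Longrightarrow> continuous_on A V"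
  using sol by (auto simp: regsol_def intro: continuous_on_subset)

lemma reg_U0: "U 0 = b"
  using sol by (simp add: regsol_def)

lemma interior_unit: "0 < y \<Longrightarrow> y < 1 \<Longrightarrow> at y within {0..1} = at (y::real)"
  by (intro at_within_interior) (simp add: interior_atLeastAtMost_real)

lemma reg_deriv:
  assumes "0 < y" "y < 1"
  shows "(U has_real_derivative V y) (at y)" "(V has_real_derivative W y) (at y)"
  using sol assms interior_unit[OF assms] by (auto simp: regsol_def dest!: bspec[of _ _ y])

lemma reg_ode: "0 \<le> y \<Longrightarrow> y \<le> 1 \<Longrightarrow> y * (1 - y) * W y + (N - (N + 1) * y) * V y + \<kappa> * nlin p M (U y) = 0"
  using sol by (simp add: regsol_def)

text \<open>The weighted flux \<open>- y ^ Suc m * R y\<close>. For a regular solution it vanishes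
  at both ends, which says that \<open>y ^ m * nlin p M (U y)\<close> has integral zero.\<close>

definition P :: "real \<Rightarrow> real" where
  "P y = (1 - y) * y ^ Suc m * V y"

lemma P_ends: "P 0 = 0" "P 1 = 0"
  by (simp_all add: P_def)

lemma P_cont: "A \<subseteq> {0..1} \<Longrightarrow> continuous_on A P"
  unfolding P_def[abs_def] by (intro continuous_intros reg_cont)

lemma P_deriv:
  assumes y: "0 < y" "y < 1"
  shows "(P has_real_derivative - (\<kappa> * y ^ m * nlin p M (U y))) (at y)"
proof -
  have "(P has_real_derivative (- 1 * y ^ Suc m + (1 - y) * (N * y ^ m)) * V y + (1 - y) * y ^ Suc m * W y) (at y)"
    unfolding P_def[abs_def]
    by (rule derivative_eq_intros reg_deriv(2)[OF y] refl | simp del: of_nat_Suc power_Suc)+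
  moreover have "(- 1 * y ^ Suc m + (1 - y) * (N * y ^ m)) * V y + (1 - y) * y ^ Suc m * W y
      = y ^ m * (y * (1 - y) * W y + (N - (N + 1) * y) * V y)"
    by (simp add: algebra_simps)
  moreover have "y * (1 - y) * W y + (N - (N + 1) * y) * V y = - (\<kappa> * nlin p M (U y))"
    using reg_ode[of y] y by linarith
  ultimately show ?thesis by (simp add: mult_ac)
qed

lemma V_eq: "0 < y \<Longrightarrow> y < 1 \<Longrightarrow> V y = P y / ((1 - y) * y ^ Suc m)"
  by (simp add: P_def)

lemma V_le_P:
  assumes y: "0 < y" "y < 1" and "\<bar>P y\<bar> \<le> c"
  shows "\<bar>V y\<bar> \<le> c / ((1 - y) * y ^ Suc m)"
proof -
  have "0 < (1 - y) * y ^ Suc m" using y by (intro mult_pos_pos zero_less_power) auto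
  then show ?thesis unfolding V_eq[OF y] abs_divide using assms(3) by (simp add: divide_right_mono)
qed

text \<open>Integrating from the nearer end produces the factor that cancels the degenerate weight
  in \<open>V = P / ((1 - y) * y ^ Suc m)\<close>: a power of \<open>y\<close> from the left, a
  factor \<open>1 - y\<close> in \<open>P_right\<close>.\<close>

lemma P_left:
  assumes y: "0 \<le> y" "y \<le> 1" and f: "\<And>s. 0 < s \<Longrightarrow> s < y \<Longrightarrow> \<bar>nlin p M (U s)\<bar> \<le> c"
  shows "\<bar>P y\<bar> \<le> \<kappa> * c * y ^ Suc m / N"
proof -
  have c: "continuous_on {0..y} P" "continuous_on {0..y} (\<lambda>y. - P y)"
    using y by (auto intro!: continuous_intros P_cont)
  have le: "\<bar>\<kappa> * s ^ m * nlin p M (U s)\<bar> \<le> \<kappa> * c * s ^ m" if "0 < s" "s < y" for s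
    using mult_left_mono[OF f[OF that], of "\<kappa> * s ^ m"] \<kappa> that by (simp add: abs_mult mult_ac)
  have "P y - P 0 \<le> \<kappa> * c * (y ^ Suc m / N) - \<kappa> * c * (0 ^ Suc m / N)"
    by (rule deriv_compare_power[OF y(1) c(1) P_deriv]) (use y le in \<open>auto simp: abs_le_iff\<close>)
  moreover have "- P y - - P 0 \<le> \<kappa> * c * (y ^ Suc m / N) - \<kappa> * c * (0 ^ Suc m / N)"
    by (rule deriv_compare_power[OF y(1) c(2) DERIV_minus[OF P_deriv]]) (use y le in \<open>auto simp: abs_le_iff\<close>)
  ultimately show ?thesis by (simp add: P_ends abs_le_iff)
qed

lemma P_right:
  assumes y: "0 \<le> y" "y \<le> 1" and f: "\<And>s. y < s \<Longrightarrow> s < 1 \<Longrightarrow> \<bar>nlin p M (U s)\<bar> \<le> c"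
  shows "\<bar>P y\<bar> \<le> \<kappa> * c * (1 - y)"
proof -
  have c: "continuous_on {y..1} P" "continuous_on {y..1} (\<lambda>y. - P y)"
    using y by (auto intro!: continuous_intros P_cont)
  have le: "\<bar>\<kappa> * s ^ m * nlin p M (U s)\<bar> \<le> \<kappa> * c" if "y < s" "s < 1" for s
  proof -
    have "s ^ m * \<bar>nlin p M (U s)\<bar> \<le> 1 * c"
      using f[OF that] that y by (intro mult_mono) (auto simp: power_le_one)
    then show ?thesis using \<kappa> that y by (simp add: abs_mult mult.assoc)
  qed
  have "P 1 - P y \<le> \<kappa> * c * (1 - y)"
    by (rule deriv_compare_linear[OF y(2) c(1) P_deriv]) (use y le in \<open>auto simp: abs_le_iff\<close>)
  moreover have "- P 1 - - P y \<le> \<kappa> * c * (1 - y)"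
    by (rule deriv_compare_linear[OF y(2) c(2) DERIV_minus[OF P_deriv]]) (use y le in \<open>auto simp: abs_le_iff\<close>)
  ultimately show ?thesis by (simp add: P_ends abs_le_iff)
qed

text \<open>A quantitative strong maximum principle. If the minimum \<open>u0\<close> were
  nonpositive, \<open>P\<close> would vanish at the first point \<open>z\<close> where it is
  attained, and just left of \<open>z\<close> the excess \<open>S\<close> of \<open>U\<close> over
  \<open>u0\<close> would satisfy \<open>S \<le> S / 2\<close>. Then \<open>U = u0\<close> already
  before \<open>z\<close>. The interior case and \<open>z = 1\<close> are treated alike.\<close>

lemma reg_pos:
  assumes y: "0 \<le> y" "y \<le> 1"
  shows "0 < U y"
proof (rule ccontr)
  assume neg: "\<not> 0 < U y"
  obtain t0 where t0: "t0 \<in> {0..1}" "\<And>t. t \<in> {0..1} \<Longrightarrow> U t0 \<le> U t"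
    using continuous_attains_inf[of "{0..1}" U] reg_cont(1)[of "{0..1}"] by auto
  define u0 where "u0 = U t0"
  have u0: "u0 \<le> 0" using t0(2)[of y] y neg by (simp add: u0_def)
  define A where "A = {t\<in>{0..1}. U t \<le> u0}"
  have "closed A" unfolding A_def
    by (rule continuous_on_closed_Collect_le[OF reg_cont(1) continuous_on_const]) auto
  moreover have "A \<subseteq> {0..1}" by (auto simp: A_def)
  ultimately have cA: "compact A" by (meson bounded_closed_interval bounded_subset compact_eq_bounded_closed)
  have "A \<noteq> {}" using t0 by (auto simp: A_def u0_def)
  from compact_attains_inf[OF cA this] obtain z where z: "z \<in> A" "\<And>t. t \<in> A \<Longrightarrow> z \<le> t" by blast
  have z1: "0 \<le> z" "z \<le> 1" "U z = u0" using z(1) t0(2)[of z] by (auto simp: A_def u0_def)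
  have z0: "0 < z" using z1 u0 b reg_U0 by (cases "z = 0") auto
  have Pz: "P z = 0"
  proof (cases "z = 1")
    case False
    have "V z = 0"
    proof (rule DERIV_local_min)
      show "(U has_real_derivative V z) (at z)" using z0 z1 False by (intro reg_deriv) auto
      show "0 < min z (1 - z)" using z0 z1 False by simp
      show "\<forall>t. \<bar>z - t\<bar> < min z (1 - z) \<longrightarrow> U z \<le> U t"
        using t0(2) z1(3) by (auto simp: u0_def abs_less_iff)
    qed
    then show ?thesis by (simp add: P_def)
  qed (simp add: P_ends)
  \<comment> \<open>\<open>c * S\<close> will bound \<open>- V\<close> on \<open>[z / 2, z]\<close>.
    The interval \<open>[y1, z]\<close> is short enough that the resulting decrease of
    \<open>U\<close> is at most \<open>S / 2\<close>.\<close>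
  define c where "c = \<kappa> * (2 / z) ^ Suc m"
  have c: "0 < c" using \<kappa> z0 by (simp add: c_def)
  define y1 where "y1 = max (z / 2) (z - 1 / (2 * (c + 1)))"
  have y1: "z / 2 \<le> y1" "y1 < z" "(z - y1) * c \<le> 1 / 2"
  proof -
    show "z / 2 \<le> y1" "y1 < z" using z0 c by (auto simp: y1_def)
    have "z - y1 \<le> 1 / (2 * (c + 1))" by (simp add: y1_def)
    then have "(z - y1) * c \<le> 1 / (2 * (c + 1)) * c" using c by (intro mult_right_mono) auto
    also have "\<dots> \<le> 1 / 2" using c by (simp add: field_simps)
    finally show "(z - y1) * c \<le> 1 / 2" .
  qed
  obtain t where t: "t \<in> {y1..z}" "\<And>s. s \<in> {y1..z} \<Longrightarrow> U s \<le> U t"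
    using continuous_attains_sup[of "{y1..z}" U] reg_cont(1)[of "{y1..z}"] y1 z0 z1 by auto
  define S where "S = U t - u0"
  have S0: "0 \<le> S" using t0(2)[of t] t y1 z0 z1 by (auto simp: S_def u0_def)
  have "S \<le> S / 2"
  proof (cases "t = z")
    case False
    then have tz: "t < z" using t by simp
    have t_pos: "0 < t" using t y1 z0 by auto
    have dd: "(U has_real_derivative V s) (at s)" if "t < s" "s < z" for s
      using that t_pos z1 by (intro reg_deriv) auto
    obtain l x where x: "t < x" "x < z" "(U has_real_derivative l) (at x)" "U z - U t = (z - t) * l"
      using MVT[OF tz reg_cont(1)] dd t_pos z1 by (auto simp: real_differentiable_def)
    have "l = V x" using DERIV_unique[OF x(3) dd[OF x(1,2)]] .
    with x have x: "t < x" "x < z" "U z - U t = (z - t) * V x" by auto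
    have x': "0 < x" "x < 1" "z / 2 \<le> x" using x t_pos z1 t y1 by auto
    have "P z - P x \<le> \<kappa> * S * (z - x)"
    proof (rule deriv_compare_linear)
      show "continuous_on {x..z} P" using x' z1 by (intro P_cont) auto
      fix s assume s: "x < s" "s < z"
      then show "(P has_real_derivative - (\<kappa> * s ^ m * nlin p M (U s))) (at s)"
        using x' z1 by (intro P_deriv) auto
      have "- nlin p M (U s) \<le> U s" using f_ge_minus[of "U s"] by simp
      also have "U s \<le> U t" using s x t(1) by (intro t(2)) auto
      also have "U t \<le> S" using u0 by (simp add: S_def)
      finally have "s ^ m * (- nlin p M (U s)) \<le> s ^ m * S" using s x' by (intro mult_left_mono) auto
      also have "\<dots> \<le> 1 * S" using s x' z1 S0 by (intro mult_right_mono) (auto simp: power_le_one)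
      finally show "- (\<kappa> * s ^ m * nlin p M (U s)) \<le> \<kappa> * S"
        using mult_left_mono[of "s ^ m * (- nlin p M (U s))" S \<kappa>] \<kappa> by (simp add: mult_ac)
    qed (use x in simp)
    then have Px: "- P x \<le> \<kappa> * S * (z - x)" using Pz by simp
    have "- V x = (- P x) / ((1 - x) * x ^ Suc m)" using x' by (simp add: V_eq)
    also have "\<dots> \<le> \<kappa> * S * (1 - x) / ((1 - x) * x ^ Suc m)"
    proof (intro divide_right_mono)
      \<comment> \<open>Replacing \<open>z - x\<close> by \<open>1 - x\<close> cancels the
        degenerate factor in the denominator, so the bound does not deteriorate when
        \<open>z\<close> is close to \<open>1\<close>.\<close>
      have "\<kappa> * S * (z - x) \<le> \<kappa> * S * (1 - x)" using z1 \<kappa> S0 by (intro mult_left_mono) auto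
      then show "- P x \<le> \<kappa> * S * (1 - x)" using Px by linarith
    qed (use x' in simp)
    also have "\<dots> = \<kappa> * S * (1 / x) ^ Suc m" using x' by (simp add: power_one_over divide_simps)
    also have "\<dots> \<le> \<kappa> * S * (2 / z) ^ Suc m"
      using x' z0 \<kappa> S0 by (intro mult_left_mono power_mono) (auto simp: field_simps)
    finally have "- V x \<le> c * S" by (simp add: c_def mult_ac)
    have "S = (z - t) * (- V x)" using x(3) z1 by (simp add: S_def)
    also have "\<dots> \<le> (z - t) * (c * S)" using tz \<open>- V x \<le> c * S\<close> by (intro mult_left_mono) auto
    also have "\<dots> \<le> (z - y1) * (c * S)" using t c S0 by (intro mult_right_mono) auto
    also have "\<dots> \<le> (1 / 2) * S"
      using mult_right_mono[OF y1(3) S0] by (simp add: mult.assoc)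
    finally show ?thesis by simp
  qed (simp add: S_def z1)
  then have "S = 0" using S0 by simp
  then have "U y1 \<le> u0" using t(2)[of y1] y1 by (simp add: S_def)
  then have "y1 \<in> A" using y1 z0 z1 by (auto simp: A_def)
  then show False using z(2)[of y1] y1 by simp
qed

section \<open>Energy monotonicity and bounds on the maximum\<close>

definition En :: "real \<Rightarrow> real" where
  "En y = 2 * y * (1 - y) * (V y)\<^sup>2 + 4 * \<kappa> * Nlin p M (U y)"

lemma cont_F: "A \<subseteq> {0..1} \<Longrightarrow> continuous_on A (\<lambda>y. Nlin p M (U y))"
  by (rule continuous_on_compose2[where t = UNIV, OF _ reg_cont(1)])
     (auto intro!: continuous_at_imp_continuous_on DERIV_isCont F_deriv)

lemma En_cont: "A \<subseteq> {0..1} \<Longrightarrow> continuous_on A En"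
  unfolding En_def[abs_def] by (intro continuous_intros reg_cont cont_F)

lemma En_deriv:
  assumes y: "0 < y" "y < 1"
  shows "(En has_real_derivative - ((4 * N - 2 - 4 * N * y) * (V y)\<^sup>2)) (at y)"
proof -
  have "(En has_real_derivative (2 - 4 * y) * (V y)\<^sup>2 + 2 * y * (1 - y) * (2 * V y * W y) + 4 * \<kappa> * (nlin p M (U y) * V y)) (at y)"
    unfolding En_def[abs_def]
    by (rule derivative_eq_intros reg_deriv[OF y] DERIV_chain2[OF F_deriv reg_deriv(1)[OF y]] refl | simp)+
  moreover have "(2 - 4 * y) * (V y)\<^sup>2 + 2 * y * (1 - y) * (2 * V y * W y) + 4 * \<kappa> * (nlin p M (U y) * V y)
     = V y * ((2 - 4 * y) * V y + 4 * (y * (1 - y) * W y + \<kappa> * nlin p M (U y)))"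
    by (simp add: algebra_simps power2_eq_square)
  moreover have "y * (1 - y) * W y + \<kappa> * nlin p M (U y) = - ((N - (N + 1) * y) * V y)"
    using reg_ode[of y] y by linarith
  moreover have "V y * ((2 - 4 * y) * V y + 4 * (- ((N - (N + 1) * y) * V y))) = - ((4 * N - 2 - 4 * N * y) * (V y)\<^sup>2)"
    by (simp add: algebra_simps power2_eq_square)
  ultimately show ?thesis by simp
qed

text \<open>The zero of \<open>4 * N - 2 - 4 * N * y\<close>: the energy decreases before it and
  increases after it, so values of \<open>U\<close> are controlled by \<open>U 0\<close> on the left
  and by \<open>U 1\<close> on the right.\<close>

definition ystar :: real where
  "ystar = 1 - 1 / (2 * N)"

lemma ystar: "3 / 4 \<le> ystar" "ystar < 1"
  using m by (simp_all add: ystar_def field_simps)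

lemma reg_le_left:
  assumes y: "0 \<le> y" "y \<le> ystar"
  shows "U y \<le> b"
proof (rule ccontr)
  assume "\<not> U y \<le> b"
  then have "Nlin p M b < Nlin p M (U y)" using b by (intro F_strict) auto
  moreover have "En y \<le> En 0"
  proof (rule DERIV_nonpos_imp_decreasing_open[OF y(1)])
    fix x assume x: "0 < x" "x < y"
    have "x \<le> 1 - 1 / (2 * N)" using x y by (simp add: ystar_def)
    then have "N * x \<le> N * (1 - 1 / (2 * N))" by (intro mult_left_mono) auto
    also have "\<dots> = N - 1 / 2" by (simp add: field_simps)
    finally have "N * x \<le> N - 1 / 2" .
    moreover have "0 \<le> 4 * n - 2 - 4 * n * x" if "n * x \<le> n - 1 / 2" for n using that by simp
    ultimately have "0 \<le> 4 * N - 2 - 4 * N * x" by blast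
    then show "\<exists>d. (En has_real_derivative d) (at x) \<and> d \<le> 0"
      using En_deriv[of x] x y ystar by (intro exI conjI) auto
  qed (use y ystar in \<open>auto intro!: En_cont\<close>)
  moreover have "4 * \<kappa> * Nlin p M (U y) \<le> En y" using y ystar by (simp add: En_def)
  ultimately have "4 * \<kappa> * Nlin p M (U y) \<le> 4 * \<kappa> * Nlin p M b" by (simp add: En_def reg_U0)
  then show False using \<open>Nlin p M b < Nlin p M (U y)\<close> \<kappa> by simp
qed

text \<open>Large enough for two purposes: the potential is nonnegative at \<open>U0\<close>, and
  \<open>tpow p M u \<ge> 2 * u\<close> for \<open>u \<ge> U0\<close>, since
  \<open>p + 1 \<ge> 2\<close>.\<close>

definition U0 :: real where
  "U0 = (p + 1) powr (1 / (p - 1))"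

lemma U0: "1 \<le> U0" "U0 powr (p - 1) = p + 1"
  using p by (simp_all add: U0_def powr_powr ge_one_powr_ge_zero)

context
  assumes MU0: "U0 \<le> M"
begin

lemma F_U0: "0 \<le> Nlin p M U0"
proof -
  have "U0 powr (p + 1) = U0 powr (p - 1) * U0 powr 2"
    by (simp add: powr_add[symmetric] add.commute)
  also have "\<dots> = (p + 1) * U0\<^sup>2" using U0 by (simp add: powr_numeral)
  finally show ?thesis using U0 MU0 p by (simp add: F_powr)
qed

lemma F_le_0: "0 < u \<Longrightarrow> u \<le> 1 \<Longrightarrow> Nlin p M u \<le> 0"
proof -
  assume u: "0 < u" "u \<le> 1"
  have "u powr (p + 1) \<le> u powr 2" using u p by (intro powr_mono') auto
  then have "u powr (p + 1) / (p + 1) \<le> u\<^sup>2 / 2"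
    using u p by (intro frac_le) (auto simp: powr_numeral)
  then show ?thesis using u M by (simp add: F_powr)
qed

text \<open>At \<open>y = 1\<close> the energy is pure potential, which dominates the potential
  before. The potential is increasing only above \<open>1\<close>; if \<open>U 1 < 1\<close> it is
  nonpositive there, and \<open>U0\<close> serves as the comparison value.\<close>

lemma reg_le_right:
  assumes y: "ystar \<le> y" "y \<le> 1"
  shows "U y \<le> max (U 1) U0"
proof (rule ccontr)
  assume n: "\<not> U y \<le> max (U 1) U0"
  have lt: "Nlin p M (U 1) < Nlin p M (U y)"
  proof (cases "1 \<le> U 1")
    case True
    then show ?thesis using n by (intro F_strict) auto
  next
    case False
    then have "Nlin p M (U 1) \<le> 0" using reg_pos[of 1] by (intro F_le_0) auto
    also have "0 \<le> Nlin p M U0" by (rule F_U0)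
    also have "\<dots> < Nlin p M (U y)" using n U0 by (intro F_strict) auto
    finally show ?thesis .
  qed
  have "En y \<le> En 1"
  proof (rule DERIV_nonneg_imp_increasing_open[OF y(2)])
    fix x assume x: "y < x" "x < 1"
    have "1 - 1 / (2 * N) \<le> x" using x y by (simp add: ystar_def)
    then have "N * (1 - 1 / (2 * N)) \<le> N * x" by (intro mult_left_mono) auto
    moreover have "N * (1 - 1 / (2 * N)) = N - 1 / 2" by (simp add: field_simps)
    ultimately have "N - 1 / 2 \<le> N * x" by (simp only:)
    moreover have "4 * n - 2 - 4 * n * x \<le> 0" if "n - 1 / 2 \<le> n * x" for n using that by simp
    ultimately have "4 * N - 2 - 4 * N * x \<le> 0" by blast
    then have "0 \<le> - ((4 * N - 2 - 4 * N * x) * (V x)\<^sup>2)" by (simp add: mult_nonpos_nonneg)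
    then show "\<exists>d. (En has_real_derivative d) (at x) \<and> 0 \<le> d"
      using En_deriv[of x] x y ystar by (intro exI conjI) auto
  qed (use y ystar in \<open>auto intro!: En_cont\<close>)
  moreover have "4 * \<kappa> * Nlin p M (U y) \<le> En y" using y ystar by (simp add: En_def)
  ultimately have "4 * \<kappa> * Nlin p M (U y) \<le> 4 * \<kappa> * Nlin p M (U 1)" by (simp add: En_def)
  then show False using lt \<kappa> by simp
qed

text \<open>Balance of the flux: since \<open>nlin\<close> is at least \<open>-1\<close> on positive
  arguments and \<open>P\<close> vanishes at both ends, the positive contribution near
  \<open>y = 1\<close> is bounded. With \<open>a = U 1\<close> and \<open>c = tpow p M a\<close>,
  the solution stays above \<open>a / 2\<close> over a length of order \<open>a / c\<close>, where
  the nonlinearity is at least of order \<open>c\<close>; the product is of order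
  \<open>a\<close>.\<close>

lemma reg_end_bound:
  assumes K: "\<kappa> \<le> K" "1 \<le> K"
  shows "U 1 \<le> max (2 * U0) (2 ^ (m + 2) * K * (2 ^ (m + 2) * 2 powr p))"
proof (cases "U 1 \<le> 2 * U0")
  case False
  define a where "a = U 1"
  define c where "c = tpow p M a"
  have a: "2 * U0 < a" "1 < a" using False U0 by (auto simp: a_def)
  have h2: "2 * u \<le> tpow p M u" if "U0 \<le> u" for u
    using that U0 MU0 p by (intro h_ge_linear[of 2 U0]) auto
  have c: "2 * a \<le> c" using h2[of a] a by (simp add: c_def)
  have le_a: "U y \<le> a" if "ystar \<le> y" "y \<le> 1" for y
    using reg_le_right[OF that] a U0 by (simp add: a_def)
  have f_le: "\<bar>nlin p M (U y)\<bar> \<le> c" if y: "ystar \<le> y" "y \<le> 1" for y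
  proof -
    have pos: "0 < U y" using y ystar by (intro reg_pos) auto
    have "nlin p M (U y) \<le> tpow p M (U y)" using pos by (simp add: nlin_def)
    also have "\<dots> \<le> c" unfolding c_def by (rule h_mono[OF le_a[OF y]])
    finally have "nlin p M (U y) \<le> c" .
    moreover have "- 1 \<le> nlin p M (U y)" using pos by (intro f_ge) simp
    ultimately show ?thesis using c a by linarith
  qed
  have V_le: "\<bar>V y\<bar> \<le> K * 2 ^ Suc m * c" if y: "ystar \<le> y" "y < 1" for y
  proof -
    have y': "0 < y" "1 / 2 \<le> y" using y ystar by auto
    have "\<bar>P y\<bar> \<le> \<kappa> * c * (1 - y)"
      by (rule P_right) (use y y' f_le in auto)
    then have "\<bar>V y\<bar> \<le> \<kappa> * c * (1 - y) / ((1 - y) * y ^ Suc m)"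
      using y y' by (intro V_le_P) auto
    also have "\<dots> = \<kappa> * c * (1 / y) ^ Suc m" using y y' by (simp add: power_one_over divide_simps)
    also have "\<dots> \<le> \<kappa> * c * 2 ^ Suc m"
      using y y' \<kappa> c a by (intro mult_left_mono power_mono) (auto simp: field_simps)
    also have "\<dots> \<le> K * c * 2 ^ Suc m" using K c a by (intro mult_right_mono) auto
    finally show ?thesis by (simp add: mult_ac)
  qed
  \<comment> \<open>The slope is at most \<open>K * 2 ^ Suc m * c\<close>, so over the length
    \<open>d\<close> the solution loses at most \<open>a / 2\<close>.\<close>
  define d where "d = a / (2 ^ (m + 2) * K * c)"
  have d0: "0 < d" using a c K by (simp add: d_def)
  have d1: "d \<le> 1 / (2 * N)"
  proof -
    have "d \<le> a / (2 ^ (m + 2) * 1 * (2 * a))"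
      unfolding d_def using a c K by (intro divide_left_mono mult_mono mult_pos_pos) auto
    also have "\<dots> = 1 / 2 ^ (m + 3)" using a by (simp add: field_simps power_add)
    also have "\<dots> \<le> 1 / (2 * N)"
    proof (intro divide_left_mono)
      have "N \<le> 2 ^ Suc m" using of_nat_less_two_power[of "Suc m", where 'a = real] by linarith
      then show "2 * N \<le> 2 ^ (m + 3)" by (simp add: power_add)
    qed auto
    finally show ?thesis .
  qed
  have near: "ystar \<le> y" if "1 - d \<le> y" for y
    using that d1 by (simp add: ystar_def)
  have half: "a / 2 \<le> U y" if y: "1 - d \<le> y" "y < 1" for y
  proof -
    have "U 1 - U y \<le> K * 2 ^ Suc m * c * (1 - y)"
    proof (rule deriv_compare_linear)
      have "0 < y" using near[OF y(1)] ystar by simp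
      then show "continuous_on {y..1} U" by (intro reg_cont) auto
      fix x assume x: "y < x" "x < 1"
      show "(U has_real_derivative V x) (at x)" using x \<open>0 < y\<close> by (intro reg_deriv) auto
      show "V x \<le> K * 2 ^ Suc m * c" using V_le[of x] near[of x] x y by (simp add: abs_le_iff)
    qed (use y in simp)
    also have "\<dots> \<le> K * 2 ^ Suc m * c * d" using y K c a by (intro mult_left_mono) auto
    also have "\<dots> = a / 2" using K c a by (simp add: d_def field_simps)
    finally show ?thesis by (simp add: a_def)
  qed
  have d1': "0 \<le> 1 - d" "1 / 2 \<le> 1 - d" using near[of "1 - d"] ystar by auto
  \<comment> \<open>Away from the end only the lower bound \<open>-1\<close> for the nonlinearity is
    used.\<close>
  have "P (1 - d) - P 0 \<le> \<kappa> * (1 - d - 0)"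
  proof (rule deriv_compare_linear[OF d1'(1)])
    show "continuous_on {0..1 - d} P" using d0 by (intro P_cont) auto
    fix s assume s: "0 < s" "s < 1 - d"
    then show "(P has_real_derivative - (\<kappa> * s ^ m * nlin p M (U s))) (at s)"
      using d0 by (intro P_deriv) auto
    have "- nlin p M (U s) \<le> 1" using f_ge[of "U s"] reg_pos[of s] s d0 by simp
    then have "s ^ m * (- nlin p M (U s)) \<le> s ^ m * 1" using s by (intro mult_left_mono) auto
    also have "\<dots> \<le> 1" using s d0 by (simp add: power_le_one)
    finally show "- (\<kappa> * s ^ m * nlin p M (U s)) \<le> \<kappa>"
      using mult_left_mono[of "s ^ m * (- nlin p M (U s))" 1 \<kappa>] \<kappa> by (simp add: mult_ac)
  qed
  moreover have "P 1 - P (1 - d) \<le> - (\<kappa> * ((1 / 2) ^ m * (2 powr (- p) * c / 2))) * (1 - (1 - d))"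
  proof (rule deriv_compare_linear)
    show "continuous_on {1 - d..1} P" using d1' by (intro P_cont) auto
    fix s assume s: "1 - d < s" "s < 1"
    then show "(P has_real_derivative - (\<kappa> * s ^ m * nlin p M (U s))) (at s)"
      using d1' by (intro P_deriv) auto
    have us: "a / 2 \<le> U s" using s by (intro half) auto
    have "2 powr (- p) * c \<le> tpow p M (a / 2)" unfolding c_def using a by (intro h_half) simp
    also have "\<dots> \<le> tpow p M (U s)" by (rule h_mono[OF us])
    finally have "2 powr (- p) * c / 2 \<le> tpow p M (U s) / 2" by simp
    also have "\<dots> \<le> nlin p M (U s)" using h2[of "U s"] us a by (simp add: nlin_def)
    finally have "(1 / 2) ^ m * (2 powr (- p) * c / 2) \<le> s ^ m * nlin p M (U s)"
      using s d1' c a by (intro mult_mono power_mono) auto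
    then show "- (\<kappa> * s ^ m * nlin p M (U s)) \<le> - (\<kappa> * ((1 / 2) ^ m * (2 powr (- p) * c / 2)))"
      using \<kappa> by (simp add: mult.assoc)
  qed (use d0 in simp)
  ultimately have "0 \<le> \<kappa> * (1 - d) - \<kappa> * ((1 / 2) ^ m * (2 powr (- p) * c / 2)) * d"
    using P_ends by simp
  also have "\<dots> = \<kappa> * (1 - d - (1 / 2) ^ m * (2 powr (- p) * c / 2) * d)" by (simp add: algebra_simps)
  finally have "0 \<le> 1 - d - (1 / 2) ^ m * (2 powr (- p) * c / 2) * d"
    using \<kappa> by (simp add: zero_le_mult_iff)
  then have "(1 / 2) ^ m * (2 powr (- p) * c / 2) * d \<le> 1" using d0 by simp
  \<comment> \<open>The factor \<open>c\<close> cancels against the one in \<open>d\<close>; with it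
    the dependence on \<open>M\<close> disappears.\<close>
  moreover have "(1 / 2) ^ m * (2 powr (- p) * c / 2) * d = a / (2 ^ (m + 2) * K * (2 ^ Suc m * 2 powr p))"
    using K c a by (simp add: d_def powr_minus power_one_over field_simps)
  ultimately have "a \<le> 2 ^ (m + 2) * K * (2 ^ Suc m * 2 powr p)"
    using K by (simp add: divide_le_eq mult_ac)
  also have "\<dots> \<le> 2 ^ (m + 2) * K * (2 ^ (m + 2) * 2 powr p)"
    using K by (intro mult_left_mono mult_right_mono) auto
  finally show ?thesis by (simp add: a_def)
qed simp

section \<open>Pohozaev identity and the bound on the starting value\<close>

definition Poh :: "real \<Rightarrow> real" where
  "Poh y = y ^ Suc m * En y + 2 * real m * (P y * U y)"

text \<open>The coefficient \<open>2 * real m\<close> in \<open>Poh\<close> is chosen so that the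
  terms \<open>y ^ Suc m * (V y)^2\<close> cancel; what remains of the gradient is nonnegative, and
  the rest is a pure function of \<open>U\<close>.\<close>

lemma Poh_deriv:
  assumes y: "0 < y" "y < 1"
  shows "(Poh has_real_derivative 2 * y ^ Suc (Suc m) * (V y)\<^sup>2
     + \<kappa> * y ^ m * (4 * N * Nlin p M (U y) - 2 * real m * (U y * nlin p M (U y)))) (at y)"
proof -
  have "(Poh has_real_derivative (N * y ^ m) * En y + y ^ Suc m * - ((4 * N - 2 - 4 * N * y) * (V y)\<^sup>2)
     + 2 * real m * (- (\<kappa> * y ^ m * nlin p M (U y)) * U y + P y * V y)) (at y)"
    unfolding Poh_def[abs_def]
    by (rule derivative_eq_intros En_deriv[OF y] P_deriv[OF y] reg_deriv(1)[OF y] refl | simp del: of_nat_Suc power_Suc)+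
  moreover have "(N * y ^ m) * En y + y ^ Suc m * - ((4 * N - 2 - 4 * N * y) * (V y)\<^sup>2)
     + 2 * real m * (- (\<kappa> * y ^ m * nlin p M (U y)) * U y + P y * V y)
     = 2 * y ^ Suc (Suc m) * (V y)\<^sup>2
     + \<kappa> * y ^ m * (4 * N * Nlin p M (U y) - 2 * real m * (U y * nlin p M (U y)))"
    by (simp add: En_def P_def algebra_simps power2_eq_square)
  ultimately show ?thesis by simp
qed

lemma Poh_cont: "A \<subseteq> {0..1} \<Longrightarrow> continuous_on A Poh"
  unfolding Poh_def[abs_def] by (intro continuous_intros reg_cont P_cont En_cont)

text \<open>Subcriticality makes the coefficient \<open>\<delta>\<close> of
  \<open>U powr (p + 1)\<close> in the Pohozaev identity positive, so concentration at
  \<open>y = 0\<close> must be paid for by the end value, which \<open>A\<close> bounds. A start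
  from \<open>b\<close> keeps \<open>U \<ge> b / 2\<close> on a length of order
  \<open>b powr (1 - p)\<close>, and this contributes \<open>b powr (p + 1 - (p - 1) * N)\<close>
  with a positive exponent.\<close>

lemma reg_start_bound:
  assumes K: "\<kappa> \<le> K" "1 \<le> K" and UM: "\<And>y. 0 \<le> y \<Longrightarrow> y \<le> 1 \<Longrightarrow> U y \<le> M"
    and A: "U 1 \<le> A" and \<delta>: "\<delta> = N / (p + 1) - real m / 2" "0 < \<delta>"
  shows "b \<le> (N * (A powr (p + 1) + (1 / \<delta>) powr (2 / (p - 1))) * (2 / \<delta>) * 2 powr (p + 1) * (4 * K) ^ Suc m)
           powr (1 / (p + 1 - (p - 1) * N))"
proof -
  define C where "C = (1 / \<delta>) powr (2 / (p - 1)) / 2"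
  have C0: "0 \<le> C" by (simp add: C_def)
  \<comment> \<open>The quadratic term is absorbed in half of the leading power when
    \<open>u powr (p - 1) \<ge> 1 / \<delta>\<close>; otherwise \<open>u\<close> is bounded and
    \<open>C\<close> covers it.\<close>
  have alg: "\<delta> / 2 * u powr (p + 1) - C \<le> \<delta> * u powr (p + 1) - u\<^sup>2 / 2" if u: "0 < u" for u
  proof (cases "1 / \<delta> \<le> u powr (p - 1)")
    case True
    have "u\<^sup>2 = u powr 2" using u by (simp add: powr_numeral)
    also have "\<dots> \<le> \<delta> * u powr (p - 1) * u powr 2"
      using True \<delta>(2) u by (intro mult_le_cancel_right1[THEN iffD2] impI) (auto simp: field_simps)
    also have "\<dots> = \<delta> * u powr (p + 1)" by (simp add: mult.assoc powr_add[symmetric] add.commute)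
    finally show ?thesis using C0 by simp
  next
    case False
    have "u = (u powr (p - 1)) powr (1 / (p - 1))" using u p by (simp add: powr_powr)
    also have "\<dots> \<le> (1 / \<delta>) powr (1 / (p - 1))" using False p by (intro powr_mono2) auto
    finally have "u powr 2 \<le> ((1 / \<delta>) powr (1 / (p - 1))) powr 2" using u by (intro powr_mono2) auto
    also have "\<dots> = 2 * C" by (simp add: C_def powr_powr)
    finally have "u\<^sup>2 / 2 \<le> C" using u by (simp add: powr_numeral)
    moreover have "0 \<le> \<delta> / 2 * u powr (p + 1)" using \<delta>(2) by simp
    ultimately show ?thesis by simp
  qed
  have poh: "4 * \<kappa> * y ^ m * (\<delta> / 2 * U y powr (p + 1) - C) \<le> 2 * y ^ Suc (Suc m) * (V y)\<^sup>2
     + \<kappa> * y ^ m * (4 * N * Nlin p M (U y) - 2 * real m * (U y * nlin p M (U y)))" if y: "0 < y" "y < 1" for y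
  proof -
    have u: "0 < U y" "U y \<le> M" using y by (auto intro!: reg_pos UM)
    have uu: "U y * U y powr p = U y powr (p + 1)" using u by (simp add: powr_add)
    have F: "Nlin p M (U y) = U y powr (p + 1) / (p + 1) - (U y)\<^sup>2 / 2" using u by (simp add: F_powr)
    have f: "U y * nlin p M (U y) = U y powr (p + 1) - (U y)\<^sup>2"
      using u by (simp add: f_powr right_diff_distrib uu power2_eq_square)
    have eq: "4 * N * Nlin p M (U y) - 2 * real m * (U y * nlin p M (U y)) = 4 * (\<delta> * U y powr (p + 1) - (U y)\<^sup>2 / 2)"
      unfolding F f \<delta>(1) by (simp add: algebra_simps add_divide_distrib)
    have "4 * \<kappa> * y ^ m * (\<delta> / 2 * U y powr (p + 1) - C) \<le> 4 * \<kappa> * y ^ m * (\<delta> * U y powr (p + 1) - (U y)\<^sup>2 / 2)"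
      using y \<kappa> by (intro mult_left_mono alg u) auto
    also have "\<dots> = \<kappa> * y ^ m * (4 * (\<delta> * U y powr (p + 1) - (U y)\<^sup>2 / 2))" by (simp only: mult_ac)
    finally have "4 * \<kappa> * y ^ m * (\<delta> / 2 * U y powr (p + 1) - C) \<le> \<kappa> * y ^ m * (4 * (\<delta> * U y powr (p + 1) - (U y)\<^sup>2 / 2))" .
    moreover have "0 \<le> 2 * y ^ Suc (Suc m) * (V y)\<^sup>2" using y by simp
    ultimately show ?thesis unfolding eq by linarith
  qed
  \<comment> \<open>On \<open>[0, d]\<close> the slope of \<open>U\<close> is at most
    \<open>2 * K * b powr p\<close> in absolute value, so \<open>d\<close> is the length over which
    half of \<open>b\<close> could be lost.\<close>
  define d where "d = 1 / (4 * K * b powr (p - 1))"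
  have bp: "1 \<le> b powr (p - 1)" using b p by (simp add: ge_one_powr_ge_zero)
  have KB: "1 \<le> K * b powr (p - 1)" using K bp mult_mono[of 1 K 1 "b powr (p - 1)"] by simp
  have d: "0 < d" "d \<le> 1 / 4" using KB K bp by (auto simp: d_def field_simps)
  have half: "b / 2 \<le> U y" if y: "0 \<le> y" "y \<le> d" for y
  proof -
    have ub: "0 < U s" "U s \<le> b" if "0 \<le> s" "s \<le> d" for s
      using that d ystar by (auto intro!: reg_pos reg_le_left)
    have f: "\<bar>nlin p M (U s)\<bar> \<le> b powr p" if s: "0 \<le> s" "s \<le> d" for s
    proof -
      have "U s \<le> M" using s d by (intro UM) auto
      then have eq: "nlin p M (U s) = U s powr p - U s" using ub[OF s] by (simp add: f_powr)
      have "U s powr p \<le> b powr p" using ub[OF s] p by (intro powr_mono2) auto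
      moreover have "- 1 \<le> nlin p M (U s)" using ub[OF s] by (intro f_ge) simp
      moreover have "1 \<le> b powr p" using b p by (simp add: ge_one_powr_ge_zero)
      ultimately show ?thesis using eq ub[OF s] by (simp add: abs_le_iff)
    qed
    have V: "\<bar>V s\<bar> \<le> 2 * K * b powr p" if s: "0 < s" "s < d" for s
    proof -
      have "\<bar>P s\<bar> \<le> \<kappa> * b powr p * s ^ Suc m / N"
        by (rule P_left) (use s d f in auto)
      also have "\<dots> \<le> \<kappa> * b powr p * s ^ Suc m / 1"
        using \<kappa> s by (intro divide_left_mono) auto
      finally have "\<bar>V s\<bar> \<le> \<kappa> * b powr p * s ^ Suc m / ((1 - s) * s ^ Suc m)"
        using s d by (intro V_le_P) auto
      also have "\<dots> = \<kappa> * b powr p * (1 / (1 - s))" using s by simp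
      also have "\<dots> \<le> K * b powr p * 2"
        using s d K \<kappa> by (intro mult_mono) (auto simp: field_simps)
      finally show ?thesis by (simp add: mult_ac)
    qed
    have "- U y - - U 0 \<le> 2 * K * b powr p * (y - 0)"
    proof (rule deriv_compare_linear[OF y(1)])
      show "continuous_on {0..y} (\<lambda>y. - U y)" using y d by (intro continuous_intros reg_cont) auto
      fix s assume s: "0 < s" "s < y"
      show "((\<lambda>y. - U y) has_real_derivative - V s) (at s)"
        using s y d by (intro DERIV_minus reg_deriv) auto
      show "- V s \<le> 2 * K * b powr p" using V[of s] s y by (simp add: abs_le_iff)
    qed
    also have "\<dots> \<le> 2 * K * b powr p * d" using y K by (intro mult_left_mono) auto
    also have "\<dots> = b / 2"
    proof -
      have "b powr p = b powr (p - 1) * b" using b by (simp add: powr_diff)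
      then show ?thesis using K bp by (simp add: d_def)
    qed
    finally show ?thesis by (simp add: reg_U0)
  qed
  \<comment> \<open>The identity is integrated over \<open>[0, d]\<close> with
    \<open>U \<ge> b / 2\<close>, and over \<open>[d, 1]\<close> with only the lower bound
    \<open>- C\<close>.\<close>
  let ?c = "4 * \<kappa> * (\<delta> / 2 * (b / 2) powr (p + 1) - C)"
  have "?c * (d ^ Suc m / N) - ?c * (0 ^ Suc m / N) \<le> Poh d - Poh 0"
  proof (rule deriv_compare[where \<phi> = "\<lambda>y. ?c * (y ^ Suc m / N)", OF _ _ _ DERIV_cmult[OF power_prim_deriv] Poh_deriv])
    show "continuous_on {0..d} Poh" using d by (intro Poh_cont) auto
    fix y assume y: "0 < y" "y < d"
    have "(b / 2) powr (p + 1) \<le> U y powr (p + 1)" using half[of y] y b p by (intro powr_mono2) auto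
    then have "?c * y ^ m \<le> 4 * \<kappa> * (\<delta> / 2 * U y powr (p + 1) - C) * y ^ m"
      using \<kappa> \<delta>(2) y by (intro mult_right_mono mult_left_mono diff_right_mono) auto
    then show "?c * y ^ m \<le> 2 * y ^ Suc (Suc m) * (V y)\<^sup>2
     + \<kappa> * y ^ m * (4 * N * Nlin p M (U y) - 2 * real m * (U y * nlin p M (U y)))"
      using poh[of y] y d by (simp add: mult_ac)
  qed (use d in \<open>auto intro!: continuous_intros\<close>)
  moreover have "- Poh 1 - - Poh d \<le> 4 * \<kappa> * C * (1 - d)"
  proof (rule deriv_compare_linear[OF _ _ DERIV_minus[OF Poh_deriv]])
    show "continuous_on {d..1} (\<lambda>y. - Poh y)" using d by (intro continuous_intros Poh_cont) auto
    fix y assume y: "d < y" "y < 1"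
    have "- (4 * \<kappa> * C) \<le> 4 * \<kappa> * y ^ m * (- C)"
      using y d \<kappa> C0 mult_left_mono[of "y ^ m" 1 "4 * \<kappa> * C"] power_le_one[of y m] by (simp add: mult_ac)
    also have "\<dots> \<le> 4 * \<kappa> * y ^ m * (\<delta> / 2 * U y powr (p + 1) - C)"
      using y d \<kappa> \<delta>(2) by (intro mult_left_mono) auto
    finally show "- (2 * y ^ Suc (Suc m) * (V y)\<^sup>2
     + \<kappa> * y ^ m * (4 * N * Nlin p M (U y) - 2 * real m * (U y * nlin p M (U y)))) \<le> 4 * \<kappa> * C"
      using poh[of y] y d by linarith
  qed (use d in auto)
  moreover have "Poh 0 = 0" "Poh 1 = 4 * \<kappa> * Nlin p M (U 1)" by (simp_all add: Poh_def P_ends En_def)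
  ultimately have "?c * (d ^ Suc m / N) \<le> 4 * \<kappa> * Nlin p M (U 1) + 4 * \<kappa> * C * (1 - d)" by simp
  also have "\<dots> = 4 * \<kappa> * (Nlin p M (U 1) + C * (1 - d))" by (simp add: algebra_simps)
  finally have "4 * \<kappa> * ((\<delta> / 2 * (b / 2) powr (p + 1) - C) * (d ^ Suc m / N)) \<le> 4 * \<kappa> * (Nlin p M (U 1) + C * (1 - d))"
    by (simp add: mult.assoc)
  then have main: "(\<delta> / 2 * (b / 2) powr (p + 1) - C) * (d ^ Suc m / N) \<le> Nlin p M (U 1) + C * (1 - d)"
    using \<kappa> by (simp only: mult_le_cancel_left_pos mult_pos_pos zero_less_numeral)
  have "\<delta> / 2 * (b / 2) powr (p + 1) * (d ^ Suc m / N) \<le> Nlin p M (U 1) + 2 * C"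
  proof -
    have "d ^ Suc m / N \<le> 1 / 1" using d by (intro frac_le power_le_one) auto
    then have "C * (d ^ Suc m / N) \<le> C * 1" using C0 by (intro mult_left_mono) auto
    moreover have "C * (1 - d) \<le> C * 1" using C0 d by (intro mult_left_mono) auto
    moreover have "x * z \<le> a + 2 * C" if "(x - C) * z \<le> a + C * (1 - d)" "C * z \<le> C * 1" "C * (1 - d) \<le> C * 1" for x z a
      using that by (simp add: left_diff_distrib)
    ultimately show ?thesis using main by blast
  qed
  also have "Nlin p M (U 1) \<le> A powr (p + 1)"
  proof -
    have u1: "0 < U 1" "U 1 \<le> M" by (auto intro!: reg_pos UM)
    have "Nlin p M (U 1) \<le> U 1 powr (p + 1) / (p + 1)" using u1 by (simp add: F_powr)
    also have "\<dots> \<le> U 1 powr (p + 1) / 1" using p by (intro divide_left_mono) auto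
    also have "\<dots> \<le> A powr (p + 1) / 1" using A u1 p by (intro divide_right_mono powr_mono2) auto
    finally show ?thesis by simp
  qed
  finally have fin: "\<delta> / 2 * (b / 2) powr (p + 1) * (d ^ Suc m / N) \<le> A powr (p + 1) + 2 * C" by simp
  \<comment> \<open>Positivity of this exponent is the same inequality as
    \<open>0 < \<delta>\<close>: both say \<open>p * real m < real m + 2\<close>.\<close>
  define s where "s = p + 1 - (p - 1) * N"
  have s: "0 < s"
  proof -
    have "real m / 2 < N / (p + 1)" using \<delta> by simp
    then have "real m * (p + 1) < N * 2" using p by (simp add: divide_less_eq less_divide_eq)
    moreover have "N = real m + 1" by simp
    ultimately have "(N - 1) * (p + 1) < N * 2" by simp
    then show ?thesis unfolding s_def by (simp add: algebra_simps)
  qed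
  define Q where "Q = N * (A powr (p + 1) + 2 * C) * (2 / \<delta>) * 2 powr (p + 1) * (4 * K) ^ Suc m"
  have dS: "d ^ Suc m = 1 / ((4 * K) ^ Suc m * b powr ((p - 1) * N))"
  proof -
    have "(b powr (p - 1)) ^ Suc m = b powr ((p - 1) * N)"
      using b by (simp add: powr_powr powr_realpow[symmetric] del: of_nat_Suc power_Suc)
    then show ?thesis by (simp only: d_def power_divide power_one power_mult_distrib)
  qed
  have bs: "b powr s \<le> Q"
  proof -
    have e1: "(b / 2) powr (p + 1) = b powr (p + 1) / 2 powr (p + 1)" using b by (simp add: powr_divide)
    have e2: "b powr (p + 1) = b powr s * b powr ((p - 1) * N)" by (simp add: s_def powr_add[symmetric])
    have "\<delta> / 2 * (b / 2) powr (p + 1) * (d ^ Suc m / N) = b powr s * (\<delta> / (2 * 2 powr (p + 1) * (4 * K) ^ Suc m * N))"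
      unfolding e1 e2 dS using b K by (simp add: field_simps del: of_nat_Suc power_Suc)
    with fin have "b powr s * (\<delta> / (2 * 2 powr (p + 1) * (4 * K) ^ Suc m * N)) \<le> A powr (p + 1) + 2 * C" by simp
    then have "b powr s * \<delta> \<le> (A powr (p + 1) + 2 * C) * (2 * 2 powr (p + 1) * (4 * K) ^ Suc m * N)"
      using K by (simp add: divide_le_eq del: of_nat_Suc power_Suc)
    then have "b powr s \<le> (A powr (p + 1) + 2 * C) * (2 * 2 powr (p + 1) * (4 * K) ^ Suc m * N) / \<delta>"
      using \<delta>(2) by (simp add: le_divide_eq del: of_nat_Suc power_Suc)
    also have "\<dots> = Q" by (simp add: Q_def field_simps del: of_nat_Suc power_Suc)
    finally show ?thesis .
  qed
  have "b = (b powr s) powr (1 / s)" using b s by (simp add: powr_powr)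
  also have "\<dots> \<le> Q powr (1 / s)" using bs s by (intro powr_mono2) auto
  finally show ?thesis by (simp add: Q_def s_def C_def)
qed

section \<open>Lower bound on \<open>\<kappa>\<close> for nonconstant solutions\<close>

lemma reg_zero: "\<exists>z>0. z < 1 \<and> nlin p M (U z) = 0"
proof -
  have "\<exists>z>0. z < 1 \<and> (P has_real_derivative 0) (at z)"
  proof (rule Rolle)
    show "continuous_on {0..1} P" by (intro P_cont) simp
    show "P differentiable (at x)" if "0 < x" "x < 1" for x
      using P_deriv[OF that] real_differentiable_def by blast
  qed (auto simp: P_ends)
  then obtain z where z: "0 < z" "z < 1" "(P has_real_derivative 0) (at z)" by blast
  from DERIV_unique[OF z(3) P_deriv[OF z(1,2)]] have "nlin p M (U z) = 0" using \<kappa> z by simp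
  with z show ?thesis by blast
qed

text \<open>For small \<open>\<kappa>\<close> a solution is nearly constant. Since
  \<open>nlin p M (U z) = 0\<close> for some \<open>z\<close>, the supremum \<open>S\<close> of the
  nonlinearity is at most \<open>L\<close> times the oscillation of \<open>U\<close>, hence at most
  \<open>\<kappa> * 2 ^ Suc m * L * S\<close>; and \<open>S > 0\<close> when
  \<open>b > 1\<close>.\<close>

lemma reg_kappa_bound:
  assumes b1: "1 < b"
  shows "1 \<le> \<kappa> * 2 ^ Suc m * L"
proof (rule ccontr)
  assume small: "\<not> ?thesis"
  have cf: "continuous_on {0..1} (\<lambda>y. \<bar>nlin p M (U y)\<bar>)"
    by (intro continuous_intros continuous_comp_nlin reg_cont) auto
  obtain t where t: "t \<in> {0..1}" "\<And>y. y \<in> {0..1} \<Longrightarrow> \<bar>nlin p M (U y)\<bar> \<le> \<bar>nlin p M (U t)\<bar>"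
    using continuous_attains_sup[OF _ _ cf] by auto
  define S where "S = \<bar>nlin p M (U t)\<bar>"
  have S: "\<bar>nlin p M (U y)\<bar> \<le> S" if "0 \<le> y" "y \<le> 1" for y using t(2)[of y] that by (simp add: S_def)
  have S0: "0 < S" using S[of 0] f_gt_1[OF b1] by (simp add: reg_U0)
  have V: "\<bar>V y\<bar> \<le> \<kappa> * S * 2 ^ Suc m" if y: "0 < y" "y < 1" for y
  proof (cases "y \<le> 1 / 2")
    case True
    have "\<bar>P y\<bar> \<le> \<kappa> * S * y ^ Suc m / N" by (rule P_left) (use y S in auto)
    also have "\<dots> \<le> \<kappa> * S * y ^ Suc m / 1" using \<kappa> y S0 by (intro divide_left_mono) auto
    finally have "\<bar>V y\<bar> \<le> \<kappa> * S * y ^ Suc m / ((1 - y) * y ^ Suc m)"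
      using y by (intro V_le_P) auto
    also have "\<dots> = \<kappa> * S * (1 / (1 - y))" using y by simp
    also have "\<dots> \<le> \<kappa> * S * 2 ^ Suc m"
    proof (intro mult_left_mono)
      have "1 / (1 - y) \<le> 2" using y True by (simp add: field_simps)
      also have "(2::real) \<le> 2 ^ Suc m" by simp
      finally show "1 / (1 - y) \<le> 2 ^ Suc m" .
    qed (use \<kappa> S0 in simp)
    finally show ?thesis .
  next
    case False
    have "\<bar>P y\<bar> \<le> \<kappa> * S * (1 - y)" by (rule P_right) (use y S in auto)
    then have "\<bar>V y\<bar> \<le> \<kappa> * S * (1 - y) / ((1 - y) * y ^ Suc m)"
      using y by (intro V_le_P) auto
    also have "\<dots> = \<kappa> * S * (1 / y) ^ Suc m" using y by (simp add: power_one_over divide_simps)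
    also have "\<dots> \<le> \<kappa> * S * 2 ^ Suc m"
      using y False \<kappa> S0 by (intro mult_left_mono power_mono) (auto simp: field_simps)
    finally show ?thesis .
  qed
  obtain z where z: "0 < z" "z < 1" "nlin p M (U z) = 0"
    using reg_zero by blast
  have lip: "U y' - U y \<le> \<kappa> * S * 2 ^ Suc m * (y' - y)" "- U y' - - U y \<le> \<kappa> * S * 2 ^ Suc m * (y' - y)"
    if "0 \<le> y" "y \<le> y'" "y' \<le> 1" for y y'
  proof -
    show "U y' - U y \<le> \<kappa> * S * 2 ^ Suc m * (y' - y)"
      by (rule deriv_compare_linear[OF _ reg_cont(1) reg_deriv(1)]) (use that V in \<open>force simp: abs_le_iff\<close>)+
    show "- U y' - - U y \<le> \<kappa> * S * 2 ^ Suc m * (y' - y)"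
      by (rule deriv_compare_linear[OF _ continuous_on_minus[OF reg_cont(1)] DERIV_minus[OF reg_deriv(1)]])
         (use that V in \<open>force simp: abs_le_iff\<close>)+
  qed
  have "\<bar>U t - U z\<bar> \<le> \<kappa> * S * 2 ^ Suc m * \<bar>t - z\<bar>"
    using lip[of t z] lip[of z t] t(1) z by (cases "t \<le> z") auto
  also have "\<dots> \<le> \<kappa> * S * 2 ^ Suc m * 1"
    using t(1) z \<kappa> S0 by (intro mult_left_mono) auto
  finally have "L * \<bar>U t - U z\<bar> \<le> L * (\<kappa> * S * 2 ^ Suc m)" using lipc_ge by simp
  then have "S \<le> (\<kappa> * 2 ^ Suc m * L) * S"
    using f_lipschitz[of "U t" "U z"] z(3) by (simp add: S_def mult_ac)
  then have "S * 1 \<le> S * (\<kappa> * 2 ^ Suc m * L)" by (simp add: mult_ac)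
  then show False using small S0 by (simp only: mult_le_cancel_left_pos)
qed

end

end

end

section \<open>The turning point\<close>

context shooting
begin

text \<open>The bounds of \<open>reg_end_bound\<close> and \<open>reg_start_bound\<close> as
  functions of \<open>K\<close>. They do not involve \<open>M\<close>, so the truncation level can
  be fixed after them.\<close>

definition endb :: "real \<Rightarrow> real" where
  "endb K = max (2 * U0) (2 ^ (m + 2) * K * (2 ^ (m + 2) * 2 powr p))"

definition startb :: "real \<Rightarrow> real" where
  "startb K = max 1 ((N * (endb K powr (p + 1) + (1 / (N / (p + 1) - real m / 2)) powr (2 / (p - 1)))
     * (2 / (N / (p + 1) - real m / 2)) * 2 powr (p + 1) * (4 * K) ^ Suc m)
           powr (1 / (p + 1 - (p - 1) * N)))"

lemma defect_one: "0 \<le> \<kappa> \<Longrightarrow> defect \<kappa> 1 = 0"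
proof -
  assume \<kappa>: "0 \<le> \<kappa>"
  have "\<bar>defect \<kappa> 1\<bar> \<le> 0"
    by (rule abs_le_left_limit[OF tendsto_defect[OF \<kappa> order_refl]]) (simp add: flux_one(1)[OF \<kappa> order_refl])
  then show ?thesis by simp
qed

lemma continuous_on_defect_b:
  assumes \<kappa>: "0 \<le> \<kappa>"
  shows "continuous_on A (defect \<kappa>)"
  unfolding continuous_on_def
proof
  fix x
  have "((\<lambda>y. defect \<kappa> y - defect \<kappa> x) \<longlongrightarrow> 0) (at x within A)"
  proof (rule Lim_null_comparison)
    show "\<forall>\<^sub>F y in at x within A. norm (defect \<kappa> y - defect \<kappa> x) \<le> bnd \<kappa> * \<bar>y - x\<bar>"
      by (simp add: defect_lipschitz_b[OF \<kappa> order_refl])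
    have "((\<lambda>y. bnd \<kappa> * \<bar>y - x\<bar>) \<longlongrightarrow> bnd \<kappa> * \<bar>x - x\<bar>) (at x within A)" by (intro tendsto_intros)
    then show "((\<lambda>y. bnd \<kappa> * \<bar>y - x\<bar>) \<longlongrightarrow> 0) (at x within A)" by simp
  qed
  then show "(defect \<kappa> \<longlongrightarrow> defect \<kappa> x) (at x within A)" by (simp add: LIM_zero_iff)
qed

lemma continuous_on_defect:
  "continuous_on (UNIV \<times> {0..K}) (\<lambda>x. defect (snd x) (fst x))"
  unfolding continuous_on_def
proof
  fix x :: "real \<times> real" assume x: "x \<in> UNIV \<times> {0..K}"
  let ?F = "at x within UNIV \<times> {0..K}"
  let ?C = "2 * L * (1 + bnd K) * exp (K * L) * \<bar>fst x - 1\<bar>"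
  have "((\<lambda>y. defect (snd y) (fst y) - defect (snd x) (fst x)) \<longlongrightarrow> 0) ?F"
  proof (rule Lim_null_comparison)
    have "\<forall>\<^sub>F y in ?F. y \<in> UNIV \<times> {0..K}" by (simp add: eventually_at_filter)
    then show "\<forall>\<^sub>F y in ?F. norm (defect (snd y) (fst y) - defect (snd x) (fst x))
        \<le> bnd K * \<bar>fst y - fst x\<bar> + ?C * \<bar>snd y - snd x\<bar>"
    proof eventually_elim
      case (elim y)
      have "\<bar>defect (snd y) (fst y) - defect (snd y) (fst x)\<bar> \<le> bnd K * \<bar>fst y - fst x\<bar>"
        using elim by (intro defect_lipschitz_b) auto
      moreover have "\<bar>defect (snd y) (fst x) - defect (snd x) (fst x)\<bar> \<le> ?C * \<bar>snd y - snd x\<bar>"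
        using elim x by (intro defect_lipschitz_k) auto
      ultimately show ?case by simp
    qed
    have "((\<lambda>y. bnd K * \<bar>fst y - fst x\<bar> + ?C * \<bar>snd y - snd x\<bar>) \<longlongrightarrow>
        bnd K * \<bar>fst x - fst x\<bar> + ?C * \<bar>snd x - snd x\<bar>) ?F"
      by (intro tendsto_intros)
    then show "((\<lambda>y. bnd K * \<bar>fst y - fst x\<bar> + ?C * \<bar>snd y - snd x\<bar>) \<longlongrightarrow> 0) ?F" by simp
  qed
  then show "((\<lambda>x. defect (snd x) (fst x)) \<longlongrightarrow> defect (snd x) (fst x)) ?F" by (simp add: LIM_zero_iff)
qed

text \<open>Uniform in \<open>\<kappa>\<close> because the linearised defect at \<open>1\<close> has
  the common lower bound \<open>l\<close> on \<open>[lo, hi]\<close>, and differentiability of the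
  defect is uniform.\<close>

lemma defect_pos_near_one:
  assumes "0 < lo" "lo \<le> hi" "hi < \<kappa>1"
  shows "\<exists>\<delta>>0. \<forall>\<kappa> b. lo \<le> \<kappa> \<longrightarrow> \<kappa> \<le> hi \<longrightarrow> 1 < b \<longrightarrow> b < 1 + \<delta> \<longrightarrow> 0 < defect \<kappa> b"
proof -
  note k0 = less_imp_le[OF \<kappa>1_pos]
  define l where "l = (N + 1 - hi * (p - 1)) * (lo * (p - 1) / N) * (1 / (N + 1) - 1 / (N + 2))"
  have hi: "hi * (p - 1) < N + 1"
    using mult_strict_right_mono[OF assms(3), of "p - 1"] p by (simp add: \<kappa>1_eq)
  have gap: "0 < 1 / (N + 1) - 1 / (N + 2)" using frac_less2[of 1 1 "N + 1" "N + 2"] by simp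
  have l0: "0 < l"
    unfolding l_def using hi assms p gap by (intro mult_pos_pos divide_pos_pos) auto
  obtain \<delta> where \<delta>: "\<delta> > 0" "\<And>\<kappa> b c. 0 \<le> \<kappa> \<Longrightarrow> \<kappa> \<le> \<kappa>1 \<Longrightarrow> \<bar>c - b\<bar> < \<delta> \<Longrightarrow>
      \<bar>defect \<kappa> c - defect \<kappa> b - (c - b) * ldefect \<kappa> b\<bar> \<le> l / 2 * \<bar>c - b\<bar>"
    using defect_differentiable[OF k0, of "l / 2"] l0 by auto
  have "0 < defect \<kappa> b" if \<kappa>: "lo \<le> \<kappa>" "\<kappa> \<le> hi" and b: "1 < b" "b < 1 + \<delta>" for \<kappa> b
  proof -
    have \<kappa>': "0 < \<kappa>" "\<kappa> \<le> \<kappa>1" using \<kappa> assms by auto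
    have "l \<le> (N + 1 - \<kappa> * (p - 1)) * (\<kappa> * (p - 1) / N) * (1 / (N + 1) - 1 / (N + 2))"
      unfolding l_def
    proof (intro mult_right_mono mult_mono)
      show "N + 1 - hi * (p - 1) \<le> N + 1 - \<kappa> * (p - 1)"
        using mult_right_mono[OF \<kappa>(2), of "p - 1"] p by simp
      then show "0 \<le> N + 1 - \<kappa> * (p - 1)" using hi by linarith
      show "lo * (p - 1) / N \<le> \<kappa> * (p - 1) / N"
        using \<kappa> p by (intro divide_right_mono mult_right_mono) auto
    qed (use assms p gap in auto)
    also have "\<dots> \<le> ldefect \<kappa> 1" by (rule ldefect_one_ge[OF \<kappa>'])
    finally have 1: "(b - 1) * l \<le> (b - 1) * ldefect \<kappa> 1" using b by (intro mult_left_mono) auto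
    have "\<bar>defect \<kappa> b - defect \<kappa> 1 - (b - 1) * ldefect \<kappa> 1\<bar> \<le> l / 2 * \<bar>b - 1\<bar>"
      using \<kappa>' b by (intro \<delta>) auto
    then have 2: "\<bar>defect \<kappa> b - (b - 1) * ldefect \<kappa> 1\<bar> \<le> (b - 1) * l / 2"
      using b \<kappa>' by (simp add: defect_one mult_ac)
    have "0 < (b - 1) * l" using b l0 by simp
    with 1 2 show ?thesis by linarith
  qed
  then show ?thesis using \<delta>(1) by blast
qed

lemma defect_zero_between:
  assumes \<kappa>: "0 < \<kappa>" "\<kappa> < \<kappa>1" and b: "1 < b" "defect \<kappa> b \<le> 0"
  shows "\<exists>c. 1 < c \<and> c \<le> b \<and> defect \<kappa> c = 0"
proof -
  obtain \<delta> where \<delta>: "\<delta> > 0" "\<And>b. 1 < b \<Longrightarrow> b < 1 + \<delta> \<Longrightarrow> 0 < defect \<kappa> b"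
    using defect_pos_near_one[of \<kappa> \<kappa>] \<kappa> by auto
  define b' where "b' = min b (1 + \<delta> / 2)"
  have b': "1 < b'" "b' \<le> b" "0 < defect \<kappa> b'"
    using \<delta> b by (auto simp: b'_def intro!: \<delta>(2))
  have "\<exists>x\<ge>b'. x \<le> b \<and> defect \<kappa> x = 0"
    using b b' \<kappa> continuous_on_defect_b[of \<kappa> "{b'..b}"] by (intro IVT2') auto
  then obtain c where "b' \<le> c" "c \<le> b" "defect \<kappa> c = 0" by blast
  then show ?thesis using b' by (intro exI[of _ c]) auto
qed

text \<open>The weaker bound \<open>b \<le> startb K + 1\<close> is what places the solution below
  the truncation level; the Pohozaev estimate then applies and improves it to
  \<open>startb K\<close>. So no zero lies in the gap between the two values.\<close>

lemma zero_bounds: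
  assumes m: "1 \<le> m" and \<kappa>: "0 < \<kappa>" "\<kappa> \<le> K" and K: "1 \<le> K" and b: "1 \<le> b" "b \<le> startb K + 1"
    and zero: "defect \<kappa> b = 0" and sub: "0 < N / (p + 1) - real m / 2"
    and M: "max (endb K) (startb K + 1) < M"
  shows "\<exists>U V W. regsol \<kappa> b U V W \<and> (\<forall>y\<in>{0..<1}. U y = prof \<kappa> b y) \<and>
      (\<forall>y\<in>{0..1}. 0 < U y \<and> U y < M) \<and> b \<le> startb K \<and>
      (1 < b \<longrightarrow> 1 \<le> \<kappa> * 2 ^ Suc m * L \<and> (\<exists>z\<in>{0..1}. U z \<noteq> U 0))"
proof -
  obtain U V W where sol: "regsol \<kappa> b U V W" and eq: "\<forall>y\<in>{0..<1}. U y = prof \<kappa> b y"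
    using regsol_exists[of \<kappa> b] \<kappa> zero by auto
  note r = m \<kappa>(1) b(1) sol
  have MU0: "U0 \<le> M"
    using M U0(1)[OF r] by (simp add: endb_def)
  have fin: "U 1 \<le> endb K" unfolding endb_def by (rule reg_end_bound[OF r MU0 \<kappa>(2) K])
  have UM: "U y < M" if y: "0 \<le> y" "y \<le> 1" for y
  proof (cases "y \<le> ystar")
    case True
    then show ?thesis using reg_le_left[OF r y(1)] b M by simp
  next
    case False
    then have "U y \<le> max (U 1) U0" using y by (intro reg_le_right[OF r MU0]) auto
    also have "\<dots> \<le> endb K" using fin U0(1)[OF r] by (simp add: endb_def)
    finally show ?thesis using M by simp
  qed
  have "b \<le> startb K"
    using reg_start_bound[OF r MU0 \<kappa>(2) K _ fin refl sub] UM unfolding startb_def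
    by (simp add: less_imp_le max.coboundedI2)
  moreover have "1 \<le> \<kappa> * 2 ^ Suc m * L" if "1 < b" by (rule reg_kappa_bound[OF r MU0 that])
  moreover have "\<exists>z\<in>{0..1}. U z \<noteq> U 0" if "1 < b"
  proof -
    obtain z where "0 < z" "z < 1" "nlin p M (U z) = 0" using reg_zero[OF r MU0] by blast
    moreover have "0 < nlin p M (U 0)" using f_gt_1[OF that] reg_U0[OF r] by simp
    ultimately show ?thesis by (intro bexI[of _ z]) auto
  qed
  ultimately show ?thesis using sol eq UM reg_pos[OF r] by (intro exI[of _ U] exI[of _ V] exI[of _ W]) auto
qed

lemma turning_point:
  assumes m: "1 \<le> m" and K: "1 \<le> K" "\<kappa>1 \<le> K" and sub: "0 < N / (p + 1) - real m / 2"
    and M: "max (endb K) (startb K + 1) < M"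
  shows "\<exists>\<kappa> b. 0 < \<kappa> \<and> \<kappa> \<le> K \<and> 1 < b \<and> b \<le> startb K \<and> defect \<kappa> b = 0 \<and> ldefect \<kappa> b = 0"
proof -
  note k0 = less_imp_le[OF \<kappa>1_pos]
  define B where "B = startb K"
  have B1: "1 \<le> B" by (simp add: B_def startb_def)
  \<comment> \<open>The threshold from \<open>reg_kappa_bound\<close>: below it there is no zero
    with \<open>1 < b \<le> B + 1\<close>.\<close>
  define \<kappa>m where "\<kappa>m = 1 / (2 ^ Suc m * L)"
  have L0: "0 < L" using lipc_ge by linarith
  have \<kappa>m0: "0 < \<kappa>m" using L0 by (simp add: \<kappa>m_def)
  have zb: "b \<le> B \<and> \<kappa>m \<le> \<kappa>" if "0 < \<kappa>" "\<kappa> \<le> \<kappa>1" "1 < b" "b \<le> B + 1" "defect \<kappa> b = 0" for \<kappa> b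
  proof -
    have "b \<le> startb K \<and> 1 \<le> \<kappa> * 2 ^ Suc m * L"
      using zero_bounds[OF m that(1) _ K(1) _ _ that(5) sub M] that K by (auto simp: B_def)
    moreover have "\<kappa>m \<le> \<kappa>" if "1 \<le> \<kappa> * (2 ^ Suc m * L)"
      using that L0 unfolding \<kappa>m_def by (subst divide_le_eq) auto
    ultimately show ?thesis by (simp add: B_def mult.assoc)
  qed
  define lipk where "lipk b = 2 * L * (1 + bnd \<kappa>1) * exp (\<kappa>1 * L) * \<bar>b - 1\<bar>" for b
  have lipk0: "0 \<le> lipk b" for b using lipc_ge bnd_nonneg[OF k0] by (simp add: lipk_def)
  have lipk: "\<bar>defect \<kappa> b - defect \<mu> b\<bar> \<le> lipk b * \<bar>\<kappa> - \<mu>\<bar>"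
    if "0 \<le> \<kappa>" "\<kappa> \<le> \<kappa>1" "0 \<le> \<mu>" "\<mu> \<le> \<kappa>1" for \<kappa> \<mu> b
    unfolding lipk_def using defect_lipschitz_k[OF that] .
  \<comment> \<open>Continuity in \<open>\<kappa>\<close> moves a negative value of the defect to a
    slightly smaller parameter. This is used twice: to descend from \<open>\<kappa>1\<close>, and to
    contradict minimality at the end.\<close>
  have neg_below: "\<exists>\<kappa>. 0 < \<kappa> \<and> \<kappa> < \<mu> \<and> defect \<kappa> b < 0"
    if \<mu>: "0 < \<mu>" "\<mu> \<le> \<kappa>1" "defect \<mu> b < 0" for \<mu> b
  proof -
    define r where "r = min (\<mu> / 2) (- defect \<mu> b / (2 * (lipk b + 1)))"
    have r: "0 < r" "r < \<mu>" "r \<le> - defect \<mu> b / (2 * (lipk b + 1))"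
      using \<mu> lipk0[of b] by (auto simp: r_def divide_neg_pos)
    have "\<bar>defect (\<mu> - r) b - defect \<mu> b\<bar> \<le> lipk b * \<bar>\<mu> - r - \<mu>\<bar>"
      using r \<mu> by (intro lipk) auto
    also have "\<dots> = lipk b * r" using r by simp
    also have "\<dots> \<le> (lipk b + 1) * (- defect \<mu> b / (2 * (lipk b + 1)))"
      using r lipk0[of b] by (intro mult_mono) auto
    also have "\<dots> = - defect \<mu> b / 2" using lipk0[of b] by (simp add: field_simps add_eq_0_iff_both_eq_0)
    finally have "defect (\<mu> - r) b < 0" using \<mu>(3) by (simp add: abs_le_iff)
    then show ?thesis using r by (intro exI[of _ "\<mu> - r"]) auto
  qed
  obtain b0 where b0: "1 < b0" "b0 < 2" "defect \<kappa>1 b0 < 0" using defect_neg[OF m, of 1] by auto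
  obtain \<kappa>2 where \<kappa>2: "0 < \<kappa>2" "\<kappa>2 < \<kappa>1" "defect \<kappa>2 b0 < 0"
    using neg_below[OF \<kappa>1_pos order_refl b0(3)] by blast
  obtain b2 where b2: "1 < b2" "b2 \<le> b0" "defect \<kappa>2 b2 = 0"
    using defect_zero_between[of \<kappa>2 b0] \<kappa>2 b0 by auto
  have z2: "b2 \<le> B" "\<kappa>m \<le> \<kappa>2" using zb[of \<kappa>2 b2] \<kappa>2 b2 b0 B1 by auto
  obtain \<delta> where \<delta>: "\<delta> > 0"
    "\<And>\<kappa> b. \<kappa>m \<le> \<kappa> \<Longrightarrow> \<kappa> \<le> \<kappa>2 \<Longrightarrow> 1 < b \<Longrightarrow> b < 1 + \<delta> \<Longrightarrow> 0 < defect \<kappa> b"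
    using defect_pos_near_one[OF \<kappa>m0 z2(2) \<kappa>2(2)] by blast
  \<comment> \<open>Compact, since positivity near \<open>b = 1\<close> separates these zeros from
    the trivial family by \<open>\<delta>\<close>, uniformly on
    \<open>[\<kappa>m, \<kappa>2]\<close>.\<close>
  define Z where "Z = {x\<in>{1 + \<delta>..B} \<times> {\<kappa>m..\<kappa>2}. defect (snd x) (fst x) = 0}"
  have inZ: "(b, \<kappa>) \<in> Z" if "\<kappa>m \<le> \<kappa>" "\<kappa> \<le> \<kappa>2" "1 < b" "b \<le> B" "defect \<kappa> b = 0" for b \<kappa>
    using \<delta>(2)[of \<kappa> b] that by (force simp: Z_def)
  have "closed Z"
    unfolding Z_def
  proof (rule continuous_closed_preimage_constant)
    show "continuous_on ({1 + \<delta>..B} \<times> {\<kappa>m..\<kappa>2}) (\<lambda>x. defect (snd x) (fst x))"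
      by (rule continuous_on_subset[OF continuous_on_defect[of \<kappa>2]]) (use \<kappa>m0 in auto)
  qed (intro closed_Times closed_atLeastAtMost)
  moreover have "Z \<subseteq> {1 + \<delta>..B} \<times> {\<kappa>m..\<kappa>2}" by (auto simp: Z_def)
  moreover have "bounded ({1 + \<delta>..B} \<times> {\<kappa>m..\<kappa>2})" by (intro bounded_Times bounded_closed_interval)
  ultimately have "compact Z" by (meson bounded_subset compact_eq_bounded_closed)
  moreover have "Z \<noteq> {}" using inZ[of \<kappa>2 b2] z2 b2 by auto
  ultimately obtain x where x: "x \<in> Z" "\<And>y. y \<in> Z \<Longrightarrow> snd x \<le> snd y"
    using continuous_attains_inf[of Z snd] continuous_on_snd[OF continuous_on_id] by blast
  define \<kappa> b where "\<kappa> = snd x" and "b = fst x"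
  have xb: "1 + \<delta> \<le> b" "b \<le> B" "\<kappa>m \<le> \<kappa>" "\<kappa> \<le> \<kappa>2" "defect \<kappa> b = 0"
    using x(1) by (auto simp: Z_def \<kappa>_def b_def)
  \<comment> \<open>A nonpositive value would force a zero with a parameter smaller than the
    minimum. The range reaches \<open>B + 1\<close> although all zeros satisfy
    \<open>b \<le> B\<close>, so that the minimising \<open>b\<close> has room on both
    sides.\<close>
  have pos: "0 < defect \<mu> c" if \<mu>: "0 < \<mu>" "\<mu> < \<kappa>" and c: "1 < c" "c \<le> B + 1" for \<mu> c
  proof (rule ccontr)
    assume "\<not> 0 < defect \<mu> c"
    then obtain c' where c': "1 < c'" "c' \<le> c" "defect \<mu> c' = 0"
      using defect_zero_between[of \<mu> c] \<mu> c xb \<kappa>2 by auto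
    have "c' \<le> B" "\<kappa>m \<le> \<mu>" using zb[of \<mu> c'] \<mu> c c' xb \<kappa>2 by auto
    then have "(c', \<mu>) \<in> Z" using \<mu> c' xb by (intro inZ) auto
    then show False using x(2) \<mu> by (force simp: \<kappa>_def)
  qed
  have nonneg: "0 \<le> defect \<kappa> c" if c: "1 < c" "c \<le> B + 1" for c
  proof (rule ccontr)
    assume "\<not> 0 \<le> defect \<kappa> c"
    then obtain \<mu> where "0 < \<mu>" "\<mu> < \<kappa>" "defect \<mu> c < 0"
      using neg_below[of \<kappa> c] xb \<kappa>m0 \<kappa>2 by auto
    then show False using pos[of \<mu> c] c by simp
  qed
  have "ldefect \<kappa> b = 0"
  proof (rule ccontr)
    assume l: "ldefect \<kappa> b \<noteq> 0"
    define l where "l = ldefect \<kappa> b"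
    have l0: "0 < \<bar>l\<bar>" using l by (simp add: l_def)
    obtain \<eta> where \<eta>: "\<eta> > 0" "\<And>\<kappa> b c. 0 \<le> \<kappa> \<Longrightarrow> \<kappa> \<le> \<kappa>1 \<Longrightarrow> \<bar>c - b\<bar> < \<eta> \<Longrightarrow>
        \<bar>defect \<kappa> c - defect \<kappa> b - (c - b) * ldefect \<kappa> b\<bar> \<le> \<bar>l\<bar> / 2 * \<bar>c - b\<bar>"
      using defect_differentiable[OF k0, of "\<bar>l\<bar> / 2"] l0 by auto
    define r where "r = min (\<eta> / 2) (min (\<delta> / 2) 1)"
    have r: "0 < r" "r < \<eta>" "r < \<delta>" "r \<le> 1" using \<eta>(1) \<delta>(1) by (auto simp: r_def)
    \<comment> \<open>A step against the sign of the derivative, towards negative values of the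
      defect; \<open>r < \<delta>\<close> keeps \<open>c\<close> above \<open>1\<close> and
      \<open>r \<le> 1\<close> keeps it below \<open>B + 1\<close>.\<close>
    define c where "c = b - sgn l * r"
    have s: "\<bar>sgn l\<bar> = 1" using l0 by (simp add: abs_sgn_eq)
    have cb: "\<bar>c - b\<bar> = r" using s r by (simp add: c_def abs_mult)
    have c: "1 < c" "c \<le> B + 1" using cb xb r by linarith+
    have "\<bar>defect \<kappa> c - defect \<kappa> b - (c - b) * l\<bar> \<le> \<bar>l\<bar> / 2 * \<bar>c - b\<bar>"
      unfolding l_def[symmetric] using \<eta>(2)[of \<kappa> c b] xb \<kappa>m0 \<kappa>2 cb r by (simp add: l_def)
    then have "defect \<kappa> c \<le> (c - b) * l + \<bar>l\<bar> / 2 * r" unfolding cb xb(5) by linarith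
    also have "(c - b) * l = - (r * \<bar>l\<bar>)" by (simp add: c_def abs_sgn mult_ac)
    also have "- (r * \<bar>l\<bar>) + \<bar>l\<bar> / 2 * r = - (\<bar>l\<bar> / 2 * r)" by simp
    also have "\<dots> < 0" using l0 r by simp
    finally show False using nonneg[OF c] by simp
  qed
  moreover have "0 < \<kappa>" "\<kappa> \<le> K" "1 < b" using xb \<kappa>m0 \<kappa>2 K \<delta>(1) by auto
  ultimately show ?thesis using xb by (auto simp: B_def)
qed

end

section \<open>The degenerate profile in terms of the true power\<close>

lemma degenerate_profile:
  fixes p :: real and m :: nat
  assumes m: "1 \<le> m" and p: "1 < p" and sub: "p * real m < real m + 2"
  shows "\<exists>\<kappa> U U1 U2 v v1 v2. 0 < \<kappa> \<and> (\<forall>y\<in>{0..1}. 0 < U y) \<and> (\<exists>z\<in>{0..1}. U z \<noteq> U 0) \<and>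
     continuous_on {0..1} U2 \<and>
     (\<forall>y\<in>{0..1}. (U has_real_derivative U1 y) (at y within {0..1})) \<and>
     (\<forall>y\<in>{0..1}. (U1 has_real_derivative U2 y) (at y within {0..1})) \<and>
     (\<forall>y\<in>{0..1}. y * (1 - y) * U2 y + (real m + 1 - (real m + 2) * y) * U1 y + \<kappa> * (U y powr p - U y) = 0) \<and>
     v 0 = 1 \<and> continuous_on {0..1} v2 \<and>
     (\<forall>y\<in>{0..1}. (v has_real_derivative v1 y) (at y within {0..1})) \<and>
     (\<forall>y\<in>{0..1}. (v1 has_real_derivative v2 y) (at y within {0..1})) \<and>
     (\<forall>y\<in>{0..1}. y * (1 - y) * v2 y + (real m + 1 - (real m + 2) * y) * v1 y
        + \<kappa> * (p * U y powr (p - 1) - 1) * v y = 0)"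
proof -
  \<comment> \<open>An auxiliary instance with the arbitrary level \<open>2\<close>: it gives access
    to \<open>\<kappa>1\<close>, \<open>endb\<close> and \<open>startb\<close>, whose values do not
    depend on the level, so that the actual \<open>M\<close> can be defined from them.\<close>
  interpret c: shooting p 2 m by standard (use p in auto)
  define K where "K = max 1 c.\<kappa>1"
  define M where "M = max (c.endb K) (c.startb K + 1) + 1"
  interpret shooting p M m
    by standard (use p in \<open>auto simp: M_def c.startb_def\<close>)
  have s: "0 < N / (p + 1) - real m / 2"
  proof -
    have "real m * (p + 1) < N * 2" using sub by (simp add: algebra_simps)
    then have "real m / 2 < N / (p + 1)" using p by (simp add: divide_less_eq less_divide_eq mult_ac)
    then show ?thesis by simp
  qed
  have K: "1 \<le> K" "\<kappa>1 \<le> K" by (auto simp: K_def c.\<kappa>1_def \<kappa>1_def)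
  have M: "max (endb K) (startb K + 1) < M"
    unfolding M_def endb_def startb_def c.endb_def c.startb_def U0_def c.U0_def by simp
  obtain \<kappa> b where kb: "0 < \<kappa>" "\<kappa> \<le> K" "1 < b" "b \<le> startb K" "defect \<kappa> b = 0" "ldefect \<kappa> b = 0"
    using turning_point[OF m K s M] by blast
  have b': "1 \<le> b" "b \<le> startb K + 1" using kb by auto
  obtain U V W where U: "regsol \<kappa> b U V W" "\<forall>y\<in>{0..<1}. U y = prof \<kappa> b y" "\<forall>y\<in>{0..1}. 0 < U y \<and> U y < M"
      "\<exists>z\<in>{0..1}. U z \<noteq> U 0"
    using zero_bounds[OF m kb(1,2) K(1) b' kb(5) s M] kb(3) by blast
  obtain v v1 v2 where v: "continuous_on {0..1} v2" "v 0 = 1"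
     "\<forall>y\<in>{0..1}. (v has_real_derivative v1 y) (at y within {0..1})"
     "\<forall>y\<in>{0..1}. (v1 has_real_derivative v2 y) (at y within {0..1})"
     "\<forall>y\<in>{0..1}. y * (1 - y) * v2 y + (N - (N + 1) * y) * v1 y + \<kappa> * dnlin p M (U y) * v y = 0"
    using lregsol_exists[OF _ U(1,2) _ kb(6)] U(3) kb(1) by auto
  have N: "N = real m + 1" "N + 1 = real m + 2" by auto
  have e1: "\<forall>y\<in>{0..1}. y * (1 - y) * W y + (real m + 1 - (real m + 2) * y) * V y + \<kappa> * (U y powr p - U y) = 0"
  proof
    fix y :: real assume y: "y \<in> {0..1}"
    then have "nlin p M (U y) = U y powr p - U y" using U(3) by (simp add: f_powr less_imp_le)
    then show "y * (1 - y) * W y + (real m + 1 - (real m + 2) * y) * V y + \<kappa> * (U y powr p - U y) = 0"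
      using reg_ode[OF m kb(1) b'(1) U(1), of y] y by (simp add: add.commute)
  qed
  have e2: "\<forall>y\<in>{0..1}. y * (1 - y) * v2 y + (real m + 1 - (real m + 2) * y) * v1 y
        + \<kappa> * (p * U y powr (p - 1) - 1) * v y = 0"
  proof
    fix y :: real assume y: "y \<in> {0..1}"
    then have "dnlin p M (U y) = p * U y powr (p - 1) - 1" using U(3) by (simp add: df_powr less_imp_le)
    then show "y * (1 - y) * v2 y + (real m + 1 - (real m + 2) * y) * v1 y
        + \<kappa> * (p * U y powr (p - 1) - 1) * v y = 0"
      using bspec[OF v(5) y] by (simp add: add.commute)
  qed
  have "continuous_on {0..1} W" "\<forall>y\<in>{0..1}. (U has_real_derivative V y) (at y within {0..1})"
     "\<forall>y\<in>{0..1}. (V has_real_derivative W y) (at y within {0..1})"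
    using U(1) by (auto simp: regsol_def)
  then show ?thesis using kb(1) U(3,4) e1 e2 v(1-4) by blast
qed

section \<open>Lifting profiles to homogeneous functions\<close>

text \<open>The iterated directional derivatives form the trace of the Hessian. The outer derivative
  sees the inner one in a neighbourhood of \<open>0\<close>, hence the open set
  \<open>S\<close>.\<close>

lemma eucl_laplacian_C2:
  fixes f :: "'a::euclidean_space \<Rightarrow> real"
  assumes S: "open S" "z \<in> S"
    and D: "\<And>x. x \<in> S \<Longrightarrow> (f has_derivative blinfun_apply (Df x)) (at x)"
    and D2: "(Df has_derivative blinfun_apply D2) (at z)"
  shows "eucl_laplacian f z = (\<Sum>b\<in>Basis. blinfun_apply (blinfun_apply D2 b) b)"
  unfolding eucl_laplacian_def
proof (rule sum.cong[OF refl])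
  fix b :: 'a
  have line: "((\<lambda>s. z + s *\<^sub>R b) has_derivative (\<lambda>h. h *\<^sub>R b)) (at t)" for t
    by (auto intro!: derivative_eq_intros)
  have "continuous_on UNIV (\<lambda>t. z + t *\<^sub>R b)" by (intro continuous_intros)
  then have "open ((\<lambda>t. z + t *\<^sub>R b) -` S)" using S(1) by (rule open_vimage[rotated])
  then have ev: "\<forall>\<^sub>F t in nhds 0. z + t *\<^sub>R b \<in> S"
    using eventually_nhds_in_open[of "(\<lambda>t. z + t *\<^sub>R b) -` S" 0] S(2) by auto
  have "\<forall>\<^sub>F t in nhds 0. deriv (\<lambda>s. f (z + s *\<^sub>R b)) t = blinfun_apply (Df (z + t *\<^sub>R b)) b"
    using ev
  proof eventually_elim
    case (elim t)
    have "((\<lambda>s. f (z + s *\<^sub>R b)) has_derivative (\<lambda>h. blinfun_apply (Df (z + t *\<^sub>R b)) (h *\<^sub>R b))) (at t)"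
      by (rule has_derivative_compose[OF line D[OF elim]])
    then have "((\<lambda>s. f (z + s *\<^sub>R b)) has_real_derivative blinfun_apply (Df (z + t *\<^sub>R b)) b) (at t)"
      by (simp add: has_field_derivative_def blinfun.scaleR_right mult_commute_abs)
    then show ?case by (rule DERIV_imp_deriv)
  qed
  then have "deriv (\<lambda>t. deriv (\<lambda>s. f (z + s *\<^sub>R b)) t) 0 = deriv (\<lambda>t. blinfun_apply (Df (z + t *\<^sub>R b)) b) 0"
    by (intro deriv_cong_ev) auto
  also have "\<dots> = blinfun_apply (blinfun_apply D2 b) b"
  proof (rule DERIV_imp_deriv)
    have "(Df has_derivative blinfun_apply D2) (at (z + 0 *\<^sub>R b))" using D2 by simp
    from has_derivative_compose[OF line this]
    have "((\<lambda>s. Df (z + s *\<^sub>R b)) has_derivative (\<lambda>h. blinfun_apply D2 (h *\<^sub>R b))) (at 0)" .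
    then have "((\<lambda>s. blinfun_apply (Df (z + s *\<^sub>R b)) b) has_derivative (\<lambda>h. blinfun_apply (blinfun_apply D2 (h *\<^sub>R b)) b)) (at 0)"
      by (rule bounded_linear.has_derivative[OF blinfun.bounded_linear_left])
    then show "((\<lambda>t. blinfun_apply (Df (z + t *\<^sub>R b)) b) has_real_derivative blinfun_apply (blinfun_apply D2 b) b) (at 0)"
      by (simp add: has_field_derivative_def blinfun.scaleR_right blinfun.scaleR_left mult_commute_abs)
  qed
  finally show "deriv (\<lambda>t. deriv (\<lambda>s. f (z + s *\<^sub>R b)) t) 0 = blinfun_apply (blinfun_apply D2 b) b" .
qed

section \<open>First and second derivatives of \<open>ratio\<close>\<close>

definition ratio :: "'b::euclidean_space \<times> 'c::euclidean_space \<Rightarrow> real" where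
  "ratio z = (snd z \<bullet> snd z) / (z \<bullet> z)"

definition sndp :: "'b::euclidean_space \<times> 'c::euclidean_space \<Rightarrow> 'b \<times> 'c" where
  "sndp z = (0, snd z)"

definition dratio :: "'b::euclidean_space \<times> 'c::euclidean_space \<Rightarrow> ('b \<times> 'c) \<Rightarrow>\<^sub>L real" where
  "dratio z = (2 / (z \<bullet> z)) *\<^sub>R blinfun_inner_right (sndp z)
     - (2 * (snd z \<bullet> snd z) / (z \<bullet> z)\<^sup>2) *\<^sub>R blinfun_inner_right z"

text \<open>The Hessian is written out as a bounded linear map because \<open>C2_on\<close> asks for
  such a map and for its continuity in operator norm.\<close>

definition d2ratio :: "'b::euclidean_space \<times> 'c::euclidean_space \<Rightarrow> ('b \<times> 'c) \<Rightarrow>\<^sub>L (('b \<times> 'c) \<Rightarrow>\<^sub>L real)" where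
  "d2ratio z = (- 4 / (z \<bullet> z)\<^sup>2) *\<^sub>R (blinfun_scaleR_left (blinfun_inner_right (sndp z)) o\<^sub>L blinfun_inner_right z)
     + (2 / (z \<bullet> z)) *\<^sub>R (Blinfun blinfun_inner_right o\<^sub>L Blinfun sndp)
     - ((4 / (z \<bullet> z)\<^sup>2) *\<^sub>R (blinfun_scaleR_left (blinfun_inner_right z) o\<^sub>L blinfun_inner_right (sndp z))
        - (8 * (snd z \<bullet> snd z) / (z \<bullet> z) ^ 3) *\<^sub>R (blinfun_scaleR_left (blinfun_inner_right z) o\<^sub>L blinfun_inner_right z)
        + (2 * (snd z \<bullet> snd z) / (z \<bullet> z)\<^sup>2) *\<^sub>R Blinfun blinfun_inner_right)"

lemma bounded_linear_sndp [bounded_linear]: "bounded_linear sndp"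
  unfolding sndp_def by (intro bounded_linear_Pair bounded_linear_zero bounded_linear_snd)

lemma sndp_inner: "sndp z \<bullet> h = snd z \<bullet> snd h"
  by (simp add: sndp_def inner_prod_def)

lemma Blinfun_apply_sndp: "blinfun_apply (Blinfun sndp) = sndp"
  by (rule bounded_linear_Blinfun_apply[OF bounded_linear_sndp])

lemma Blinfun_apply_inner: "blinfun_apply (Blinfun blinfun_inner_right) = blinfun_inner_right"
  by (rule bounded_linear_Blinfun_apply[OF bounded_linear_blinfun_inner_right])

lemma ratio_unit_interval: "ratio z \<in> {0..1}"
proof -
  have "snd z \<bullet> snd z \<le> z \<bullet> z" by (simp add: inner_prod_def)
  then show ?thesis by (auto simp: ratio_def divide_le_eq_1 inner_gt_zero_iff)
qed

lemma inner_self_deriv: "((\<lambda>z::'a::real_inner. z \<bullet> z) has_derivative (\<lambda>h. 2 * (z \<bullet> h))) (at z within S)"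
  by (auto intro!: derivative_eq_intros simp: inner_commute)

lemma snd_self_deriv:
  "((\<lambda>z::'b::euclidean_space \<times> 'c::euclidean_space. snd z \<bullet> snd z) has_derivative (\<lambda>h. 2 * (snd z \<bullet> snd h))) (at z within S)"
  by (auto intro!: derivative_eq_intros simp: inner_commute)

lemma ratio_deriv:
  assumes "z \<noteq> 0"
  shows "(ratio has_derivative blinfun_apply (dratio z)) (at z)"
proof -
  have nz: "z \<bullet> z \<noteq> 0" using assms by simp
  have "(ratio has_derivative (\<lambda>h. (2 * (snd z \<bullet> snd h) * (z \<bullet> z) - (snd z \<bullet> snd z) * (2 * (z \<bullet> h))) / ((z \<bullet> z) * (z \<bullet> z)))) (at z)"
    unfolding ratio_def[abs_def]
    by (rule has_derivative_divide'[OF snd_self_deriv inner_self_deriv nz])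
  moreover have "(\<lambda>h. (2 * (snd z \<bullet> snd h) * (z \<bullet> z) - (snd z \<bullet> snd z) * (2 * (z \<bullet> h))) / ((z \<bullet> z) * (z \<bullet> z))) = blinfun_apply (dratio z)"
    using nz by (auto simp: fun_eq_iff dratio_def blinfun.diff_left blinfun.scaleR_left sndp_inner field_simps power2_eq_square)
  ultimately show ?thesis by simp
qed

lemma dratio_deriv:
  assumes "z \<noteq> 0"
  shows "(dratio has_derivative blinfun_apply (d2ratio z)) (at z)"
proof -
  have nz: "z \<bullet> z \<noteq> 0" using assms by simp
  let ?r = "z \<bullet> z" and ?t = "snd z \<bullet> snd z"
  have a: "((\<lambda>z. 2 / (z \<bullet> z)) has_derivative (\<lambda>h. (- 4 / ?r\<^sup>2) * (z \<bullet> h))) (at z)"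
  proof -
    have "((\<lambda>z. 2 / (z \<bullet> z)) has_derivative (\<lambda>h. (0 * ?r - 2 * (2 * (z \<bullet> h))) / (?r * ?r))) (at z)"
      by (rule has_derivative_divide'[OF has_derivative_const inner_self_deriv nz])
    then show ?thesis by (simp add: power2_eq_square)
  qed
  have b: "((\<lambda>z. 2 * (snd z \<bullet> snd z) / (z \<bullet> z)\<^sup>2) has_derivative
      (\<lambda>h. (4 / ?r\<^sup>2) * (snd z \<bullet> snd h) - (8 * ?t / ?r ^ 3) * (z \<bullet> h))) (at z)"
  proof -
    have n: "((\<lambda>z. 2 * (snd z \<bullet> snd z)) has_derivative (\<lambda>h. 2 * (2 * (snd z \<bullet> snd h)))) (at z)"
      by (rule has_derivative_mult_right[OF snd_self_deriv])
    have d: "((\<lambda>z. (z \<bullet> z)\<^sup>2) has_derivative (\<lambda>h. 4 * ?r * (z \<bullet> h))) (at z)"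
      by (rule has_derivative_eq_rhs[OF has_derivative_power[OF inner_self_deriv]]) auto
    have "((\<lambda>z. 2 * (snd z \<bullet> snd z) / (z \<bullet> z)\<^sup>2) has_derivative
      (\<lambda>h. (2 * (2 * (snd z \<bullet> snd h)) * ?r\<^sup>2 - 2 * ?t * (4 * ?r * (z \<bullet> h))) / (?r\<^sup>2 * ?r\<^sup>2))) (at z)"
      by (rule has_derivative_divide'[OF n d]) (use nz in simp)
    moreover have "(2 * (2 * x) * ?r\<^sup>2 - 2 * ?t * (4 * ?r * y)) / (?r\<^sup>2 * ?r\<^sup>2) = (4 / ?r\<^sup>2) * x - (8 * ?t / ?r ^ 3) * y" for x y
      using nz by (simp add: field_simps power2_eq_square power3_eq_cube)
    ultimately show ?thesis by simp
  qed
  have i1: "((\<lambda>z. blinfun_inner_right (sndp z)) has_derivative (\<lambda>h. blinfun_inner_right (sndp h))) (at z)"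
    by (rule bounded_linear_imp_has_derivative)
       (rule bounded_linear_compose[OF bounded_linear_blinfun_inner_right bounded_linear_sndp])
  have i2: "(blinfun_inner_right has_derivative blinfun_inner_right) (at z)"
    by (rule bounded_linear_imp_has_derivative[OF bounded_linear_blinfun_inner_right])
  have "(dratio has_derivative (\<lambda>h.
      ((2 / ?r) *\<^sub>R blinfun_inner_right (sndp h) + ((- 4 / ?r\<^sup>2) * (z \<bullet> h)) *\<^sub>R blinfun_inner_right (sndp z))
      - ((2 * ?t / ?r\<^sup>2) *\<^sub>R blinfun_inner_right h
         + ((4 / ?r\<^sup>2) * (snd z \<bullet> snd h) - (8 * ?t / ?r ^ 3) * (z \<bullet> h)) *\<^sub>R blinfun_inner_right z))) (at z)"
    unfolding dratio_def[abs_def]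
    by (intro has_derivative_diff has_derivative_scaleR a b i1 i2)
  moreover have "(\<lambda>h.
      ((2 / ?r) *\<^sub>R blinfun_inner_right (sndp h) + ((- 4 / ?r\<^sup>2) * (z \<bullet> h)) *\<^sub>R blinfun_inner_right (sndp z))
      - ((2 * ?t / ?r\<^sup>2) *\<^sub>R blinfun_inner_right h
         + ((4 / ?r\<^sup>2) * (snd z \<bullet> snd h) - (8 * ?t / ?r ^ 3) * (z \<bullet> h)) *\<^sub>R blinfun_inner_right z))
     = blinfun_apply (d2ratio z)"
    by (auto simp: fun_eq_iff d2ratio_def blinfun.diff_left blinfun.add_left blinfun.scaleR_left
        Blinfun_apply_sndp Blinfun_apply_inner sndp_inner algebra_simps)
  ultimately show ?thesis by simp
qed

lemma continuous_on_dratio: "continuous_on (UNIV - {0}) dratio"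
  unfolding continuous_on_eq_continuous_within
  using has_derivative_continuous[OF dratio_deriv] by (auto intro: continuous_at_imp_continuous_at_within)

lemma continuous_on_d2ratio: "continuous_on (UNIV - {0}) d2ratio"
proof -
  have c: "continuous_on A (\<lambda>z. blinfun_inner_right (sndp z))" "continuous_on A (\<lambda>z. blinfun_inner_right z)"
    "continuous_on A (\<lambda>z. blinfun_scaleR_left (blinfun_inner_right (sndp z)) :: real \<Rightarrow>\<^sub>L _)"
    "continuous_on A (\<lambda>z. blinfun_scaleR_left (blinfun_inner_right z) :: real \<Rightarrow>\<^sub>L _)"
    for A :: "('b::euclidean_space \<times> 'c::euclidean_space) set"
    by (intro bounded_linear.continuous_on[OF bounded_linear_blinfun_inner_right]
        bounded_linear.continuous_on[OF bounded_linear_blinfun_scaleR_left]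
        bounded_linear.continuous_on[OF bounded_linear_sndp] continuous_on_id)+
  show ?thesis
    unfolding d2ratio_def[abs_def]
    by (intro continuous_intros bounded_bilinear.continuous_on[OF bounded_bilinear_blinfun_compose] c) auto
qed

section \<open>Profiles composed with \<open>ratio\<close>\<close>

context
  fixes U U1 U2 :: "real \<Rightarrow> real"
  assumes U: "\<forall>y\<in>{0..1}. (U has_real_derivative U1 y) (at y within {0..1})"
    and U1: "\<forall>y\<in>{0..1}. (U1 has_real_derivative U2 y) (at y within {0..1})"
    and U2: "continuous_on {0..1} U2"
begin

text \<open>One-sided derivatives of the profile at \<open>0\<close> and \<open>1\<close> suffice,
  because \<open>ratio\<close> takes values in \<open>[0,1]\<close> only.\<close>

lemma compose_ratio_deriv:
  fixes z :: "'b::euclidean_space \<times> 'c::euclidean_space"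
  assumes F: "\<forall>y\<in>{0..1}. (F has_real_derivative F' y) (at y within {0..1})" and z: "z \<noteq> 0"
  shows "((\<lambda>z. F (ratio z)) has_derivative (\<lambda>h. F' (ratio z) * blinfun_apply (dratio z) h)) (at z)"
proof -
  have "(F has_derivative (*) (F' (ratio z))) (at (ratio z) within {0..1})"
    using F ratio_unit_interval[of z] by (auto simp: has_field_derivative_def)
  then have "(F has_derivative (*) (F' (ratio z))) (at (ratio z) within range ratio)"
    by (rule has_derivative_subset) (use ratio_unit_interval in blast)
  from has_derivative_in_compose[OF ratio_deriv[OF z] this] show ?thesis .
qed

definition dlift :: "'b::euclidean_space \<times> 'c::euclidean_space \<Rightarrow> ('b \<times> 'c) \<Rightarrow>\<^sub>L real" where
  "dlift z = U1 (ratio z) *\<^sub>R dratio z"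

definition d2lift :: "'b::euclidean_space \<times> 'c::euclidean_space \<Rightarrow> ('b \<times> 'c) \<Rightarrow>\<^sub>L (('b \<times> 'c) \<Rightarrow>\<^sub>L real)" where
  "d2lift z = U1 (ratio z) *\<^sub>R d2ratio z + U2 (ratio z) *\<^sub>R (blinfun_scaleR_left (dratio z) o\<^sub>L dratio z)"

lemma lift_deriv: "z \<noteq> 0 \<Longrightarrow> ((\<lambda>z. U (ratio z)) has_derivative blinfun_apply (dlift z)) (at z)"
  using compose_ratio_deriv[OF U, of z]
  by (rule has_derivative_eq_rhs) (auto simp: dlift_def blinfun.scaleR_left)

lemma dlift_deriv:
  assumes "z \<noteq> 0"
  shows "(dlift has_derivative blinfun_apply (d2lift z)) (at z)"
proof -
  have "(dlift has_derivative (\<lambda>h. U1 (ratio z) *\<^sub>R blinfun_apply (d2ratio z) h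
      + (U2 (ratio z) * blinfun_apply (dratio z) h) *\<^sub>R dratio z)) (at z)"
    unfolding dlift_def[abs_def]
    by (intro has_derivative_scaleR compose_ratio_deriv[OF U1] dratio_deriv assms)
  moreover have "(\<lambda>h. U1 (ratio z) *\<^sub>R blinfun_apply (d2ratio z) h
      + (U2 (ratio z) * blinfun_apply (dratio z) h) *\<^sub>R dratio z) = blinfun_apply (d2lift z)"
    by (auto simp: fun_eq_iff d2lift_def blinfun.add_left blinfun.scaleR_left)
  ultimately show ?thesis by simp
qed

lemma C2_on_lift: "C2_on (UNIV - {0}) (\<lambda>z::'b::euclidean_space \<times> 'c::euclidean_space. U (ratio z))"
proof -
  have cr: "continuous_on (UNIV - {0}) (ratio :: 'b \<times> 'c \<Rightarrow> real)"
    unfolding continuous_on_eq_continuous_within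
    using has_derivative_continuous[OF ratio_deriv] by (auto intro: continuous_at_imp_continuous_at_within)
  have cU1: "continuous_on {0..1} U1"
    unfolding continuous_on_eq_continuous_within using U1 DERIV_continuous by blast
  have "continuous_on (UNIV - {0}) (d2lift :: 'b \<times> 'c \<Rightarrow> _)"
    unfolding d2lift_def[abs_def]
    by (intro continuous_on_add continuous_on_scaleR continuous_on_d2ratio continuous_on_dratio
        bounded_bilinear.continuous_on[OF bounded_bilinear_blinfun_compose]
        bounded_linear.continuous_on[OF bounded_linear_blinfun_scaleR_left]
        continuous_on_compose2[OF cU1 cr] continuous_on_compose2[OF U2 cr]) (use ratio_unit_interval in blast)+
  then show ?thesis
    unfolding C2_on_def using lift_deriv dlift_deriv by (intro exI[of _ dlift] conjI exI[of _ d2lift]) auto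
qed

text \<open>The chain rule for the Laplacian. At a unit vector with \<open>t = ratio z\<close>, the
  squared gradient of \<open>ratio\<close> is \<open>4 * t * (1 - t)\<close>, and its Laplacian is
  \<open>2 * DIM('c) - 2 * (DIM('b) + DIM('c)) * t\<close>. Both are sums over the basis, evaluated
  by Parseval.\<close>

lemma laplacian_lift:
  fixes z :: "'b::euclidean_space \<times> 'c::euclidean_space"
  assumes z: "norm z = 1"
  shows "eucl_laplacian (\<lambda>z. U (ratio z)) z = 4 * (ratio z * (1 - ratio z)) * U2 (ratio z)
     + (2 * real DIM('c) - 2 * real (DIM('b) + DIM('c)) * ratio z) * U1 (ratio z)"
proof -
  have zz: "z \<bullet> z = 1" using z by (simp add: dot_square_norm)
  have z0: "z \<noteq> 0" using z by auto
  define t where "t = ratio z"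
  have t: "snd z \<bullet> snd z = t" by (simp add: t_def ratio_def zz)
  have E: "(\<Sum>b\<in>Basis. (x \<bullet> b) * (y \<bullet> b)) = x \<bullet> y" for x y :: "'b \<times> 'c"
    by (rule euclidean_inner[symmetric])
  have pz: "sndp z \<bullet> z = t" "z \<bullet> sndp z = t" "sndp z \<bullet> sndp z = t"
    by (simp_all add: sndp_def inner_prod_def t)
  have P: "(\<Sum>b\<in>(Basis :: ('b \<times> 'c) set). snd b \<bullet> snd b) = real DIM('c)"
    unfolding Basis_prod_def
    by (subst sum.union_disjoint) (auto simp: sum.reindex inj_on_def inner_same_Basis)
  have I: "(\<Sum>b\<in>(Basis :: ('b \<times> 'c) set). b \<bullet> b) = real DIM('b) + real DIM('c)"
    by (simp add: inner_Basis)
  have d: "blinfun_apply (dratio z) b = 2 * (sndp z \<bullet> b) - 2 * t * (z \<bullet> b)" for b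
    by (simp add: dratio_def blinfun.diff_left blinfun.scaleR_left zz t)
  have d2: "blinfun_apply (blinfun_apply (d2ratio z) b) b
      = - 8 * ((z \<bullet> b) * (sndp z \<bullet> b)) + 2 * (snd b \<bullet> snd b) + 8 * t * ((z \<bullet> b) * (z \<bullet> b)) - 2 * t * (b \<bullet> b)" for b
    by (simp add: d2ratio_def blinfun.diff_left blinfun.add_left blinfun.scaleR_left zz t
        Blinfun_apply_sndp Blinfun_apply_inner) (simp add: sndp_inner)
  have dd: "blinfun_apply (dratio z) b * blinfun_apply (dratio z) b
      = 4 * ((sndp z \<bullet> b) * (sndp z \<bullet> b)) - 8 * t * ((z \<bullet> b) * (sndp z \<bullet> b)) + 4 * t\<^sup>2 * ((z \<bullet> b) * (z \<bullet> b))" for b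
    unfolding d by (simp add: algebra_simps power2_eq_square)
  have "eucl_laplacian (\<lambda>z. U (ratio z)) z = (\<Sum>b\<in>Basis. blinfun_apply (blinfun_apply (d2lift z) b) b)"
    by (rule eucl_laplacian_C2[of "UNIV - {0}" z _ dlift]) (use z0 in \<open>auto intro: lift_deriv dlift_deriv\<close>)
  also have "\<dots> = (\<Sum>b\<in>Basis. U1 t * blinfun_apply (blinfun_apply (d2ratio z) b) b
      + U2 t * (blinfun_apply (dratio z) b * blinfun_apply (dratio z) b))"
    by (simp add: d2lift_def blinfun.add_left blinfun.scaleR_left t_def mult.assoc)
  also have "\<dots> = U1 t * (\<Sum>b\<in>Basis. blinfun_apply (blinfun_apply (d2ratio z) b) b)
      + U2 t * (\<Sum>b\<in>Basis. blinfun_apply (dratio z) b * blinfun_apply (dratio z) b)"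
    by (simp add: sum.distrib sum_distrib_left)
  also have "(\<Sum>b\<in>Basis. blinfun_apply (blinfun_apply (d2ratio z) b) b)
      = - 8 * t + 2 * real DIM('c) + 8 * t * 1 - 2 * t * (real DIM('b) + real DIM('c))"
    unfolding d2 sum_subtractf sum.distrib sum_distrib_left[symmetric] E P I pz zz by simp
  also have "(\<Sum>b\<in>Basis. blinfun_apply (dratio z) b * blinfun_apply (dratio z) b)
      = 4 * t - 8 * t * t + 4 * t\<^sup>2 * 1"
    unfolding dd sum_subtractf sum.distrib sum_distrib_left[symmetric] E pz zz by simp
  finally show ?thesis by (simp add: t_def[symmetric] algebra_simps power2_eq_square)
qed

end

section \<open>Symmetries of \<open>ratio\<close> and the conclusion on complex projective
  space\<close>

lemma vec_inner_self: "x \<bullet> x = (\<Sum>i\<in>UNIV. (cmod (x $ i))\<^sup>2)" for x :: "complex ^ 'n"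
  by (simp add: inner_vec_def dot_square_norm)

lemma ratio_cscale:
  fixes z :: "complex \<times> (complex ^ 'n)"
  assumes "c \<noteq> 0"
  shows "ratio (cscale c z) = ratio z"
proof -
  have w: "(c *s w) \<bullet> (c *s w) = (cmod c)\<^sup>2 * (w \<bullet> w)" for w :: "complex ^ 'n"
    by (simp add: vec_inner_self norm_mult power_mult_distrib sum_distrib_left)
  have z0: "(c * a) \<bullet> (c * a) = (cmod c)\<^sup>2 * (a \<bullet> a)" for a :: complex
    by (simp add: dot_square_norm norm_mult power_mult_distrib)
  have "(cmod c)\<^sup>2 \<noteq> 0" using assms by simp
  then show ?thesis
    by (simp add: ratio_def cscale_def inner_prod_def w z0 distrib_left[symmetric])
qed

lemma unitary_inner:
  fixes A :: "complex ^ 'n ^ 'n"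
  assumes "unitary_mat A"
  shows "(A *v w) \<bullet> (A *v w) = w \<bullet> w"
proof -
  let ?B = "\<chi> i j. cnj (A $ j $ i)"
  \<comment> \<open>The definition provides the adjoint as a right inverse, whereas preservation of
    the norm uses it as a left inverse; for square matrices the two agree.\<close>
  have "?B ** A = mat 1"
    using assms matrix_left_right_inverse[of A ?B] by (simp add: unitary_mat_def)
  then have B: "(\<Sum>i\<in>UNIV. cnj (A $ i $ k) * A $ i $ j) = (if k = j then 1 else 0)" for j k
    by (auto simp: matrix_matrix_mult_def mat_def vec_eq_iff)
  have sq: "complex_of_real (x \<bullet> x) = (\<Sum>i\<in>UNIV. x $ i * cnj (x $ i))" for x :: "complex ^ 'n"
    by (simp add: vec_inner_self complex_norm_square del: of_real_power)
  have "complex_of_real ((A *v w) \<bullet> (A *v w))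
      = (\<Sum>i\<in>UNIV. (\<Sum>j\<in>UNIV. A $ i $ j * w $ j) * (\<Sum>k\<in>UNIV. cnj (A $ i $ k) * cnj (w $ k)))"
    unfolding sq by (simp add: matrix_vector_mult_def)
  also have "\<dots> = (\<Sum>i\<in>UNIV. \<Sum>j\<in>UNIV. \<Sum>k\<in>UNIV. (w $ j * cnj (w $ k)) * (cnj (A $ i $ k) * A $ i $ j))"
    by (simp add: sum_product mult_ac)
  also have "\<dots> = (\<Sum>j\<in>UNIV. \<Sum>k\<in>UNIV. \<Sum>i\<in>UNIV. (w $ j * cnj (w $ k)) * (cnj (A $ i $ k) * A $ i $ j))"
    by (subst sum.swap, rule sum.cong[OF refl], rule sum.swap)
  also have "\<dots> = (\<Sum>j\<in>UNIV. \<Sum>k\<in>UNIV. (w $ j * cnj (w $ k)) * (if k = j then 1 else 0))"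
    by (simp only: sum_distrib_left[symmetric] B)
  also have "\<dots> = complex_of_real (w \<bullet> w)"
    unfolding sq by (simp add: if_distrib[of "(*) _"] cong: if_cong)
  finally show ?thesis using of_real_eq_iff by blast
qed

lemma ratio_unitary: "unitary_mat A \<Longrightarrow> ratio (z0, A *v w) = ratio (z0, w)"
  by (simp add: ratio_def inner_prod_def unitary_inner)

text \<open>Carries statements about values of a profile back to points of projective space, for
  nonconstancy of \<open>u\<close> and nontriviality of \<open>v\<close>.\<close>

lemma ratio_surj:
  assumes y: "y \<in> {0..1}"
  shows "\<exists>z :: complex \<times> (complex ^ 'n). z \<noteq> 0 \<and> ratio z = y"
proof -
  define e :: "complex ^ 'n" where "e = axis undefined 1"
  have e: "e \<bullet> e = 1" by (simp add: e_def inner_axis_axis)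
  define z where "z = (complex_of_real (sqrt (1 - y)), sqrt y *\<^sub>R e)"
  have s: "snd z \<bullet> snd z = y" using y e by (simp add: z_def)
  have "fst z \<bullet> fst z = 1 - y" using y by (simp add: z_def dot_square_norm)
  then have zz: "z \<bullet> z = 1" using s by (simp add: inner_prod_def)
  then have "z \<noteq> 0" by auto
  moreover have "ratio z = y" using s zz by (simp add: ratio_def)
  ultimately show ?thesis by blast
qed

theorem theorem1p3:
  fixes q :: real
  assumes n2: "CARD('n::finite) \<ge> 2"
    and q: "2 < q" "q < 2 * real CARD('n) / (real CARD('n) - 1)"
  shows "\<exists>(lam::real) (u :: complex \<times> (complex^'n) \<Rightarrow> real).
           lam > 0 \<and>
           C2_on (UNIV - {0}) u \<and> cp_function u \<and> Un_invariant u \<and>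
           (\<forall>z. z \<noteq> 0 \<longrightarrow> u z > 0) \<and>
           (\<exists>z1 z2. z1 \<noteq> 0 \<and> z2 \<noteq> 0 \<and> u z1 \<noteq> u z2) \<and>
           (\<forall>z. norm z = 1 \<longrightarrow> - lap_FS u z + lam * u z = lam * u z powr (q - 1)) \<and>
           (\<exists>v :: complex \<times> (complex^'n) \<Rightarrow> real.
              C2_on (UNIV - {0}) v \<and> cp_function v \<and> (\<exists>z. z \<noteq> 0 \<and> v z \<noteq> 0) \<and>
              (\<forall>z. norm z = 1 \<longrightarrow>
                 - lap_FS v z + lam * v z = lam * (q - 1) * u z powr (q - 2) * v z))"
proof -
  define m where "m = CARD('n) - 1"
  have n: "real CARD('n) = real m + 1" and m: "1 \<le> m" using n2 by (auto simp: m_def)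
  define p where "p = q - 1"
  have p: "1 < p" using q by (simp add: p_def)
  \<comment> \<open>\<open>2n / (n - 1)\<close> is the critical Sobolev exponent in real dimension
    \<open>2n\<close>; in terms of \<open>p\<close> and \<open>m\<close> the bound is the
    subcriticality condition of \<open>degenerate_profile\<close>.\<close>
  have "q * real m < 2 * (real m + 1)" using q(2) m by (simp add: n less_divide_eq)
  then have sub: "p * real m < real m + 2" by (simp add: p_def algebra_simps)
  obtain \<kappa> U U1 U2 v v1 v2 where \<kappa>: "0 < \<kappa>" and pos: "\<forall>y\<in>{0..1}. 0 < U y"
    and nonconst: "\<exists>z\<in>{0..1}. U z \<noteq> U 0"
    and U: "continuous_on {0..1} U2"
     "\<forall>y\<in>{0..1}. (U has_real_derivative U1 y) (at y within {0..1})"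
     "\<forall>y\<in>{0..1}. (U1 has_real_derivative U2 y) (at y within {0..1})"
     "\<forall>y\<in>{0..1}. y * (1 - y) * U2 y + (real m + 1 - (real m + 2) * y) * U1 y + \<kappa> * (U y powr p - U y) = 0"
    and v: "v 0 = 1" "continuous_on {0..1} v2"
     "\<forall>y\<in>{0..1}. (v has_real_derivative v1 y) (at y within {0..1})"
     "\<forall>y\<in>{0..1}. (v1 has_real_derivative v2 y) (at y within {0..1})"
     "\<forall>y\<in>{0..1}. y * (1 - y) * v2 y + (real m + 1 - (real m + 2) * y) * v1 y
        + \<kappa> * (p * U y powr (p - 1) - 1) * v y = 0"
    using degenerate_profile[OF m p sub] by blast
  let ?r = "ratio :: complex \<times> (complex^'n) \<Rightarrow> real"
  let ?u = "\<lambda>z. U (?r z)" and ?v = "\<lambda>z. v (?r z)"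
  have r: "?r z \<in> {0..1}" for z by (rule ratio_unit_interval)
  have cp: "cp_function (\<lambda>z. F (?r z))" for F
    by (simp add: cp_function_def ratio_cscale)
  have un: "Un_invariant ?u" by (simp add: Un_invariant_def ratio_unitary)
  \<comment> \<open>The real dimensions are \<open>2\<close> and \<open>2n\<close> for the two
    factors, so the whole operator carries a factor \<open>4\<close>; this is why \<open>lam\<close>
    is \<open>4 * \<kappa>\<close>.\<close>
  have lap: "lap_FS (\<lambda>z. F (?r z)) z = 4 * (y * (1 - y) * F2 y + (real m + 1 - (real m + 2) * y) * F1 y)"
    if "\<forall>y\<in>{0..1}. (F has_real_derivative F1 y) (at y within {0..1})"
      "\<forall>y\<in>{0..1}. (F1 has_real_derivative F2 y) (at y within {0..1})" "continuous_on {0..1} F2"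
      "norm z = 1" "y = ?r z" for F F1 F2 z y
    using laplacian_lift[OF that(1-4)] unfolding lap_FS_def that(5)
    by (simp add: n algebra_simps)
  have eqU: "- lap_FS ?u z + (4 * \<kappa>) * ?u z = (4 * \<kappa>) * ?u z powr (q - 1)" if "norm z = 1" for z
    using lap[OF U(2,3,1) that refl] bspec[OF U(4) r[of z]] by (simp add: p_def algebra_simps)
  have eqv: "- lap_FS ?v z + (4 * \<kappa>) * ?v z = (4 * \<kappa>) * (q - 1) * ?u z powr (q - 2) * ?v z" if "norm z = 1" for z
    using lap[OF v(3,4,2) that refl] bspec[OF v(5) r[of z]] by (simp add: p_def algebra_simps)
  have nc: "\<exists>z1 z2. z1 \<noteq> 0 \<and> z2 \<noteq> 0 \<and> ?u z1 \<noteq> ?u z2"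
  proof -
    obtain y where y: "y \<in> {0..1}" "U y \<noteq> U 0" using nonconst by blast
    obtain z1 :: "complex \<times> (complex^'n)" where "z1 \<noteq> 0" "ratio z1 = y" using ratio_surj[OF y(1)] by blast
    moreover obtain z2 :: "complex \<times> (complex^'n)" where "z2 \<noteq> 0" "ratio z2 = 0" using ratio_surj[of 0] by auto
    ultimately show ?thesis using y by (intro exI[of _ z1] exI[of _ z2]) auto
  qed
  \<comment> \<open>Points with \<open>ratio = 0\<close> represent the fixed point of the action,
    where the linearised profile has the value \<open>1\<close>.\<close>
  have nz: "\<exists>z. z \<noteq> 0 \<and> ?v z \<noteq> 0"
  proof -
    obtain z2 :: "complex \<times> (complex^'n)" where "z2 \<noteq> 0" "ratio z2 = 0" using ratio_surj[of 0] by auto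
    then show ?thesis using v(1) by (intro exI[of _ z2]) auto
  qed
  have "C2_on (UNIV - {0}) ?u" "C2_on (UNIV - {0}) ?v"
    by (rule C2_on_lift[OF U(2,3,1)], rule C2_on_lift[OF v(3,4,2)])
  then show ?thesis
    using \<kappa> cp[of U] cp[of v] un pos r nc nz eqU eqv
    by (intro exI[of _ "4 * \<kappa>"] exI[of _ ?u] conjI exI[of _ ?v]) auto
qed

end
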